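(* Let $m\ge 3$ and let $N=\mathbb{Z}/2\times\mathbb{Z}/2^{m+1}$ (elements written as column vectors). (1) Let $(A,+,\circ)$ be a modular maximal-cyclic brace of size $2^{m+2}$ with non-cyclic additive group. Then there are generators $a,b$ of $(A,\circ)$ satisfying the presentation $\langle a,b\mid a^{2^{m+1}}=b^2=1,\ bab^{-1}=a^{1+2^m}\rangle$ and a group isomorphism $\gamma:(A,+)\to N$ such that, writing $S,T\in\mathrm{Aut}(N)$ for the automorphisms $\gamma\rho_a\gamma^{-1}$ and $\gamma\rho_b\gamma^{-1}$, the data $(S,T,\gamma(a),\gamma(b))$ is of one of the following two forms, for some $x,y\in\mathbb{Z}/2$ and some even $z\in\mathbb{Z}/2^m$: First form: $$S=\begin{pmatrix}1&y\\2^m x&1+2z\end{pmatrix},\quad T=\begin{pmatrix}1&0\\0&1+2^m(1+x)\end{pmatrix},\quad \gamma(a)=\begin{pmatrix}0\\1\end{pmatrix},\quad \gamma(b)=\begin{pmatrix}1\\0\end{pmatrix};$$ Second form: $$S=\begin{pmatrix}1&0\\2^m x&1+2z\end{pmatrix},\quad T=\begin{pmatrix}1&0\\2^m&1+2^m(1+x)\end{pmatrix},\quad \gamma(a)=\begin{pmatrix}0\\1\end{pmatrix},\quad \gamma(b)=\begin{pmatrix}1\\2^{m-1}\end{pmatrix}.$$ (2) Conversely, let $(A,\circ)$ be the group with presentation $\langle a,b\mid a^{2^{m+1}}=b^2=1,\ bab^{-1}=a^{1+2^m}\rangle$. For every choice of $x,y\in\mathbb{Z}/2$ and even $z\in\mathbb{Z}/2^m$,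 each of the two forms defines a brace structure on $(A,\circ)$: there is a right linear action $\rho$ of $(A,\circ)$ on $N$ with $\rho(a)=S$, $\rho(b)=T$, and a bijective right $1$-cocycle $\gamma:(A,\circ)\to N$ with respect to $\rho$ having the prescribed values $\gamma(a),\gamma(b)$, and hence $A$ with the addition $g+h:=\gamma^{-1}(\gamma(g)+\gamma(h))$ is a brace with adjoint group $(A,\circ)$. (3) No brace of the first form is isomorphic to a brace of the second form.
   Context: A (right) brace is a set $A$ with two group structures $+$ and $\circ$ such that $(A,+)$ is abelian and $(b+c)\circ a+a=b\circ a+c\circ a$ for all $a,b,c\in A$. The group $(A,\circ)$ is the adjoint group. A modular maximal-cyclic brace of size $2^{m+2}$ is a brace whose adjoint group is isomorphic to $M_{2^{m+2}}=\langle a,b\mid a^{2^{m+1}}=b^2=1,\ bab^{-1}=a^{1+2^m}\rangle$. For a brace $A$ and $a\in A$, $\rho_a\in\mathrm{Aut}(A,+)$ is the map $\rho_a(b)=b\circ a-a$; one has $\rho_{a\circ b}=\rho_b\rho_a$, so this is a right linear action of $(A,\circ)$ on $(A,+)$. A right linear action of a group $G$ on an abelian group $N$ is a map $\rho:G\to\mathrm{Aut}(N)$ with $\rho(gh)=\rho(h)\rho(g)$; a right $1$-cocycle with respect to $\rho$ is a map $\gamma:G\to N$ with $\gamma(gh)=\rho(h)(\gamma(g))+\gamma(h)$ for all $g,h\in G$. Matrices act on column vectors of $N=\mathbb{Z}/2\times\mathbb{Z}/2^{m+1}$ by usual matrix multiplication on integer representatives, reducing the first row mod $2$ and the second row mod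 $2^{m+1}$; automorphisms of $N$ are exactly given by matrices $\begin{pmatrix}1&y\\2^m x&1+2z\end{pmatrix}$ with $x,y\in\mathbb{Z}/2$, $z\in\mathbb{Z}/2^m$. Two braces are isomorphic if there is a bijection between them that preserves both $+$ and $\circ$. *)

theory Defs
  imports
    "HOL-Algebra.Bij"
    "HOL-Algebra.Ring"
    "HOL-Algebra.Elementary_Groups"
    "HOL-Analysis.Cartesian_Space"
begin

text \<open>
  Group words over \<open>'x\<close>: the letter \<open>(x, True)\<close> stands for \<open>x\<close> and \<open>(x, False)\<close> for its
  formal inverse. A pair \<open>(l, r)\<close> in a set of relations stands for the equation \<open>l = r\<close>.
\<close>

type_synonym 'x word = "('x \<times> bool) list"

inductive word_eq :: "('x word \<times> 'x word) set \<Rightarrow> 'x word \<Rightarrow> 'x word \<Rightarrow> bool" for R where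
  refl: "word_eq R u u"
| sym: "word_eq R u v \<Longrightarrow> word_eq R v u"
| trans: "word_eq R u v \<Longrightarrow> word_eq R v w \<Longrightarrow> word_eq R u w"
| cancel: "word_eq R (u @ [(x, s), (x, \<not> s)] @ v) (u @ v)"
| rel: "(l, r) \<in> R \<Longrightarrow> word_eq R (u @ l @ v) (u @ r @ v)"

definition word_class :: "('x word \<times> 'x word) set \<Rightarrow> 'x word \<Rightarrow> 'x word set" where
  "word_class R u = {v. word_eq R u v}"

definition presented_group :: "('x word \<times> 'x word) set \<Rightarrow> 'x word set monoid" where
  "presented_group R =
     \<lparr>carrier = range (word_class R),
      mult = (\<lambda>X Y. {w. \<exists>u\<in>X. \<exists>v\<in>Y. word_eq R (u @ v) w}),
      one = word_class R []\<rparr>"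

datatype gens = Gen_a | Gen_b

definition M_relations :: "nat \<Rightarrow> (gens word \<times> gens word) set" where
  "M_relations m =
     {(replicate (2 ^ (m + 1)) (Gen_a, True), []),
      ([(Gen_b, True), (Gen_b, True)], []),
      ([(Gen_b, True), (Gen_a, True), (Gen_b, False)], replicate (1 + 2 ^ m) (Gen_a, True))}"

definition M_group :: "nat \<Rightarrow> gens word set monoid" where
  "M_group m = presented_group (M_relations m)"

text \<open>
  The elements \<open>a, b\<close> of \<open>G\<close> satisfy the presentation, i.e. \<open>G\<close> is the group generated by \<open>a, b\<close>
  with these defining relations (not just some group in which the relations hold).
  The conjunct \<open>group G\<close> is needed since \<^const>\<open>iso\<close> does not constrain \<open>one G\<close>.
\<close>

definition M_generators :: "nat \<Rightarrow> ('a, 'k) monoid_scheme \<Rightarrow> 'a \<Rightarrow> 'a \<Rightarrow> bool" where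
  "M_generators m G a b \<longleftrightarrow>
     group G \<and>
     (\<exists>\<phi> \<in> iso (M_group m) G.
        \<phi> (word_class (M_relations m) [(Gen_a, True)]) = a \<and>
        \<phi> (word_class (M_relations m) [(Gen_b, True)]) = b)"

text \<open>
  A brace is carried by a ring record: \<open>add\<close> is the addition of the brace and \<open>mult\<close> is its
  circle operation.
\<close>

definition adjoint_group :: "('a, 'k) ring_scheme \<Rightarrow> 'a monoid" where
  "adjoint_group A = \<lparr>carrier = carrier A, mult = mult A, one = one A\<rparr>"

locale brace = abelian_group A for A (structure) +
  assumes adjoint_group: "group (adjoint_group A)"
    and compat: "\<lbrakk>a \<in> carrier A; b \<in> carrier A; c \<in> carrier A\<rbrakk> \<Longrightarrow>
      (b \<oplus> c) \<otimes> a \<oplus> a = b \<otimes> a \<oplus> c \<otimes> a"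

definition modular_maximal_cyclic_brace :: "nat \<Rightarrow> 'a ring \<Rightarrow> bool" where
  "modular_maximal_cyclic_brace m A \<longleftrightarrow> brace A \<and> adjoint_group A \<cong> M_group m"

definition brace_rho :: "'a ring \<Rightarrow> 'a \<Rightarrow> 'a \<Rightarrow> 'a" where
  "brace_rho A a = (\<lambda>b \<in> carrier A. b \<otimes>\<^bsub>A\<^esub> a \<ominus>\<^bsub>A\<^esub> a)"

definition brace_isomorphic :: "'a ring \<Rightarrow> 'b ring \<Rightarrow> bool" where
  "brace_isomorphic A B \<longleftrightarrow>
     (\<exists>f. f \<in> iso (add_monoid A) (add_monoid B) \<and> f \<in> iso (adjoint_group A) (adjoint_group B))"

definition right_linear_action ::
  "'g monoid \<Rightarrow> 'n monoid \<Rightarrow> ('g \<Rightarrow> 'n \<Rightarrow> 'n) \<Rightarrow> bool" where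
  "right_linear_action G N \<rho> \<longleftrightarrow>
     group G \<and> comm_group N \<and>
     \<rho> \<in> carrier G \<rightarrow> carrier (AutoGroup N) \<and>
     (\<forall>g \<in> carrier G. \<forall>h \<in> carrier G. \<rho> (g \<otimes>\<^bsub>G\<^esub> h) = \<rho> h \<otimes>\<^bsub>AutoGroup N\<^esub> \<rho> g)"

definition right_cocycle ::
  "'g monoid \<Rightarrow> 'n monoid \<Rightarrow> ('g \<Rightarrow> 'n \<Rightarrow> 'n) \<Rightarrow> ('g \<Rightarrow> 'n) \<Rightarrow> bool" where
  "right_cocycle G N \<rho> \<gamma> \<longleftrightarrow>
     \<gamma> \<in> carrier G \<rightarrow> carrier N \<and>
     (\<forall>g \<in> carrier G. \<forall>h \<in> carrier G. \<gamma> (g \<otimes>\<^bsub>G\<^esub> h) = \<rho> h (\<gamma> g) \<otimes>\<^bsub>N\<^esub> \<gamma> h)"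

definition cocycle_brace :: "'g monoid \<Rightarrow> 'n monoid \<Rightarrow> ('g \<Rightarrow> 'n) \<Rightarrow> 'g ring" where
  "cocycle_brace G N \<gamma> =
     \<lparr>carrier = carrier G, mult = mult G, one = one G,
      zero = inv_into (carrier G) \<gamma> \<one>\<^bsub>N\<^esub>,
      add = (\<lambda>g h. inv_into (carrier G) \<gamma> (\<gamma> g \<otimes>\<^bsub>N\<^esub> \<gamma> h))\<rparr>"

text \<open>
  The group operation of the following monoid record is written multiplicatively but is
  componentwise addition.
\<close>

definition N_group :: "nat \<Rightarrow> (int \<times> int) monoid" where
  "N_group m = integer_mod_group 2 \<times>\<times> integer_mod_group (2 ^ (m + 1))"

definition matrix_map :: "nat \<Rightarrow> int^2^2 \<Rightarrow> int \<times> int \<Rightarrow> int \<times> int" where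
  "matrix_map m M =
     (\<lambda>p \<in> carrier (N_group m).
        let w = M *v vector [fst p, snd p] in ((w $ 1) mod 2, (w $ 2) mod 2 ^ (m + 1)))"

type_synonym brace_data =
  "(int \<times> int \<Rightarrow> int \<times> int) \<times> (int \<times> int \<Rightarrow> int \<times> int) \<times> (int \<times> int) \<times> (int \<times> int)"

definition first_form :: "nat \<Rightarrow> int \<Rightarrow> int \<Rightarrow> int \<Rightarrow> brace_data" where
  "first_form m x y z =
     (matrix_map m (vector [vector [1, y],
                            vector [2 ^ m * x, 1 + 2 * z]]),
      matrix_map m (vector [vector [1, 0],
                            vector [0, 1 + 2 ^ m * (1 + x)]]),
      (0, 1),
      (1, 0))"

definition second_form :: "nat \<Rightarrow> int \<Rightarrow> int \<Rightarrow> brace_data" where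
  "second_form m x z =
     (matrix_map m (vector [vector [1, 0],
                            vector [2 ^ m * x, 1 + 2 * z]]),
      matrix_map m (vector [vector [1, 0],
                            vector [2 ^ m, 1 + 2 ^ m * (1 + x)]]),
      (0, 1),
      (1, 2 ^ (m - 1)))"

text \<open>
  Parameters in \<open>\<int>/2\<close>, \<open>\<int>/2\<close> and \<open>\<int>/2^m\<close> are given by their canonical representatives.
\<close>

definition parameters :: "nat \<Rightarrow> (int \<times> int \<times> int) set" where
  "parameters m =
     carrier (integer_mod_group 2) \<times> carrier (integer_mod_group 2) \<times>
     {z \<in> carrier (integer_mod_group (2 ^ m)). even z}"

definition transported_rho :: "nat \<Rightarrow> 'a ring \<Rightarrow> ('a \<Rightarrow> int \<times> int) \<Rightarrow> 'a \<Rightarrow> int \<times> int \<Rightarrow> int \<times> int" where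
  "transported_rho m A \<gamma> a =
     (\<lambda>p \<in> carrier (N_group m). \<gamma> (brace_rho A a (inv_into (carrier A) \<gamma> p)))"

definition brace_of_form :: "nat \<Rightarrow> 'a ring \<Rightarrow> brace_data \<Rightarrow> bool" where
  "brace_of_form m A D \<longleftrightarrow>
     (\<exists>a b \<gamma>. M_generators m (adjoint_group A) a b \<and>
        \<gamma> \<in> iso (add_monoid A) (N_group m) \<and>
        transported_rho m A \<gamma> a \<in> auto (N_group m) \<and>
        transported_rho m A \<gamma> b \<in> auto (N_group m) \<and>
        (transported_rho m A \<gamma> a, transported_rho m A \<gamma> b, \<gamma> a, \<gamma> b) = D)"

end

theory Submission
  imports Defs "HOL-Algebra.Multiplicative_Group" "HOL-Computational_Algebra.Primes"
begin

text \<open>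
  Write \<open>D = \<rho>\<^sub>a - 1\<close> and let \<open>I = (2, D)\<close> act on the additive group. In additive notation the elements
  \<open>c\<^sub>k = a\<close> to the power \<open>2\<^sup>k\<close> satisfy \<open>c\<^sub>k\<^sub>+\<^sub>1 = 2 c\<^sub>k + D\<^sub>k c\<^sub>k\<close>, where \<open>D\<^sub>0 = D\<close> and
  \<open>D\<^sub>k\<^sub>+\<^sub>1 = D\<^sub>k\<^sup>2 + 2 D\<^sub>k\<close>, so \<open>D\<^sub>k\<close> raises the \<open>I\<close>-adic degree by two for \<open>k \<ge> 1\<close>. As \<open>a\<close> has large order in
  the adjoint group, comparing the lengths of the layers of the filtration with the order of the group
  shows that \<open>a\<close> generates a cyclic subgroup of index two of the additive group as well. This identifies
  the additive group with \<open>N\<close> such that \<open>a\<close> becomes \<open>(0, 1)\<close>, and the relations of the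
  presentation, read in the holomorph of \<open>N\<close>, become congruences for the matrix entries that have exactly
  the two families as solutions, up to the automorphism \<open>(i, j) \<mapsto> (i, j + 2\<^sup>m i)\<close> of \<open>N\<close>.

  Conversely, the data of either form satisfy the relations in the holomorph, and the cocycle is bijective
  because no involution of the group has value \<open>0\<close>. The families are told apart by the element \<open>b\<close> of
  the second form: it is an involution of the adjoint group of additive order four, and the first form has
  no such element.
\<close>

section \<open>Affine maps of 2-power order on a finite abelian 2-group\<close>

text \<open>The obstacle is that the additive group is unknown at the start: rho_a is merely an
  automorphism of some abelian group of order 2^(m+2), and no matrix can be written down before a
  large cyclic summand is found. The filtration replaces coordinates; it uses only the order of the
  group and that the iterates of rho_a reach the identity. The bound m >= 3 enters twice. It gives 2
  m - 1 >= m + 2, so that a degree growing by two per step outruns the length of the filtration, and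
  it makes 8 divide 2^m, so that squares in the holomorph have diagonal entry 1 modulo 8. The
  condition that z be even comes from the value of the cocycle at a^(2^m), which is (0, 2^m (1 + z))
  and must not vanish. A presentation bounds its group only from above. The order of the group, and
  that 1, b and a^(2^m) are distinct, are read off the cocycle of the first form with x = y = z = 0,
  so the classification rests on the converse construction.\<close>

lemma (in group) coset_decomposition:
  assumes H: "subgroup H G" and K: "subgroup K G" and HK: "H \<subseteq> K" and fin: "finite K"
    and x: "x \<in> K" "x \<notin> H"
  shows "2 * card H \<le> card K"
    and "card K \<le> 2 * card H \<Longrightarrow> y \<in> K \<Longrightarrow> y \<in> H \<or> y \<otimes> inv x \<in> H"
proof -
  have xG: "x \<in> carrier G" using K x by (meson subgroup.mem_carrier)
  have finH: "finite H" using HK fin finite_subset by blast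
  have sub: "H \<union> (H #> x) \<subseteq> K"
    using HK x K by (auto simp: r_coset_def subgroup.m_closed)
  have disj: "H \<inter> (H #> x) = {}"
  proof (rule ccontr)
    assume "H \<inter> (H #> x) \<noteq> {}"
    then obtain h where h: "h \<in> H" "h \<otimes> x \<in> H" by (auto simp: r_coset_def)
    then have "inv h \<otimes> (h \<otimes> x) \<in> H" using H by (meson subgroup.m_closed subgroup.m_inv_closed)
    moreover have "inv h \<otimes> (h \<otimes> x) = x"
      using h H xG by (simp add: subgroup.mem_carrier[OF H] inv_solve_left')
    ultimately show False using x by simp
  qed
  have eq: "card (H #> x) = card H"
  proof -
    have "inj_on (\<lambda>h. h \<otimes> x) H"
      using xG subgroup.mem_carrier[OF H] by (auto intro: inj_onI)
    moreover have "H #> x = (\<lambda>h. h \<otimes> x) ` H" by (auto simp: r_coset_def)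
    ultimately show ?thesis by (simp add: card_image)
  qed
  have fin': "finite (H #> x)" using sub fin finite_subset by blast
  have card: "card (H \<union> (H #> x)) = 2 * card H"
    using card_Un_disjoint[OF finH fin' disj] eq by simp
  show "2 * card H \<le> card K" using card card_mono[OF fin sub] by simp
  assume le: "card K \<le> 2 * card H" and y: "y \<in> K"
  have "H \<union> (H #> x) = K"
    using card_subset_eq[OF fin sub] card card_mono[OF fin sub] le by simp
  then consider "y \<in> H" | h where "h \<in> H" "y = h \<otimes> x" using y by (auto simp: r_coset_def)
  then show "y \<in> H \<or> y \<otimes> inv x \<in> H"
    using xG subgroup.mem_carrier[OF H] by cases (auto simp: inv_solve_right' m_assoc)
qed

text \<open>In the application \<open>c k\<close> is the circle power of a with exponent 2^k,
  \<open>E k\<close> is rho of \<open>c k\<close>, and n = m + 1. The rule \<open>c_Suc\<close> is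
  then g o g = rho_g(g) + g.\<close>

locale iterated_affine = comm_group G for G (structure) +
  fixes E :: "nat \<Rightarrow> 'a \<Rightarrow> 'a" and c :: "nat \<Rightarrow> 'a" and n :: nat
  assumes card_carrier: "card (carrier G) = 2 ^ (n + 1)"
    and n: "4 \<le> n"
    and E_hom: "E k \<in> hom G G"
    and E_Suc: "x \<in> carrier G \<Longrightarrow> E (Suc k) x = E k (E k x)"
    and E_n: "x \<in> carrier G \<Longrightarrow> E n x = x"
    and c_closed: "c k \<in> carrier G"
    and c_Suc: "c (Suc k) = c k \<otimes> E k (c k)"
begin

lemma fin: "finite (carrier G)"
  using card_carrier by (metis card.infinite power_not_zero zero_neq_numeral)

section \<open>Difference operators of an iterated automorphism\<close>

definition D :: "nat \<Rightarrow> 'a \<Rightarrow> 'a" where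
  "D k x = E k x \<otimes> inv x"

lemma E_closed [simp]: "x \<in> carrier G \<Longrightarrow> E k x \<in> carrier G"
  using E_hom by (meson hom_in_carrier)

lemma E_mult: "x \<in> carrier G \<Longrightarrow> y \<in> carrier G \<Longrightarrow> E k (x \<otimes> y) = E k x \<otimes> E k y"
  using E_hom by (meson hom_mult)

lemma E_inv: "x \<in> carrier G \<Longrightarrow> E k (inv x) = inv (E k x)"
  using E_hom[of k] group_hom.hom_inv[of G G "E k" x]
  by (simp add: group_hom_def group_hom_axioms_def)

lemma D_closed [simp]: "x \<in> carrier G \<Longrightarrow> D k x \<in> carrier G"
  by (simp add: D_def)

lemma D_mult: "x \<in> carrier G \<Longrightarrow> y \<in> carrier G \<Longrightarrow> D k (x \<otimes> y) = D k x \<otimes> D k y"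
  by (simp add: D_def E_mult inv_mult m_ac)

lemma D_hom: "group_hom G G (D k)"
  by (auto simp: group_hom_def group_hom_axioms_def hom_def D_mult)

lemma D_one [simp]: "D k \<one> = \<one>"
  using group_hom.hom_one[OF D_hom] .

lemma D_inv: "x \<in> carrier G \<Longrightarrow> D k (inv x) = inv (D k x)"
  using group_hom.hom_inv[OF D_hom] .

lemma D_pow: "x \<in> carrier G \<Longrightarrow> D k (x [^] (i::nat)) = D k x [^] i"
  using group_hom.hom_nat_pow[OF D_hom] .

text \<open>This is (1 + D)^2 = 1 + 2 D + D^2 for the operator 1 + D = \<open>E k\<close>.\<close>

lemma D_Suc:
  assumes "x \<in> carrier G"
  shows "D (Suc k) x = D k (D k x) \<otimes> (D k x \<otimes> D k x)"
proof -
  let ?e = "E k x" let ?f = "E k (E k x)"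
  have "D k (D k x) \<otimes> (D k x \<otimes> D k x)
      = ?f \<otimes> inv ?e \<otimes> inv (?e \<otimes> inv x) \<otimes> ((?e \<otimes> inv x) \<otimes> (?e \<otimes> inv x))"
    using assms by (simp add: D_def E_mult E_inv)
  also have "\<dots> = ?f \<otimes> inv ?e \<otimes> (inv (?e \<otimes> inv x) \<otimes> (?e \<otimes> inv x)) \<otimes> (?e \<otimes> inv x)"
    using assms by (simp only: m_ac m_closed inv_closed E_closed)
  also have "\<dots> = ?f \<otimes> inv ?e \<otimes> (?e \<otimes> inv x)"
    using assms by (simp only: l_inv r_one m_closed inv_closed E_closed)
  also have "\<dots> = ?f \<otimes> (inv ?e \<otimes> ?e) \<otimes> inv x"
    using assms by (simp only: m_assoc m_closed inv_closed E_closed)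
  also have "\<dots> = D (Suc k) x"
    using assms by (simp add: D_def E_Suc)
  finally show ?thesis by simp
qed

lemma D_n: "x \<in> carrier G \<Longrightarrow> D n x = \<one>"
  by (simp add: D_def E_n)

lemma c_Suc_D: "c (Suc k) = c k \<otimes> c k \<otimes> D k (c k)"
proof -
  have "c k \<otimes> c k \<otimes> D k (c k) = c k \<otimes> E k (c k) \<otimes> (c k \<otimes> inv (c k))"
    unfolding D_def by (simp only: m_ac m_closed inv_closed E_closed c_closed)
  then show ?thesis by (simp add: c_closed c_Suc)
qed

text \<open>\<open>L j\<close> is \<open>I\<^sup>j G\<close> for the ideal \<open>I = (2, E 0 - 1)\<close> of \<open>\<int>[E 0]\<close>, with \<open>G\<close> written additively.\<close>

primrec L :: "nat \<Rightarrow> 'a set" where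
  "L 0 = carrier G"
| "L (Suc j) = {u \<otimes> u \<otimes> D 0 v | u v. u \<in> L j \<and> v \<in> L j}"

lemma L_subgroup: "subgroup (L j) G"
proof (induction j)
  case 0
  show ?case by (simp add: subgroup_self)
next
  case (Suc j)
  note mem = subgroup.mem_carrier[OF Suc] and closed = subgroup.m_closed[OF Suc]
  show ?case
  proof (rule subgroupI)
    show "L (Suc j) \<subseteq> carrier G" using mem by auto
    show "L (Suc j) \<noteq> {}" using subgroup.one_closed[OF Suc] by auto
  next
    fix x assume "x \<in> L (Suc j)"
    then obtain u v where "u \<in> L j" "v \<in> L j" "x = u \<otimes> u \<otimes> D 0 v" by auto
    then have "inv x = inv u \<otimes> inv u \<otimes> D 0 (inv v)" "inv u \<in> L j" "inv v \<in> L j"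
      using mem subgroup.m_inv_closed[OF Suc] by (simp_all add: inv_mult D_inv)
    then show "inv x \<in> L (Suc j)" by auto
  next
    fix x y assume "x \<in> L (Suc j)" "y \<in> L (Suc j)"
    then obtain u v u' v' where *: "u \<in> L j" "v \<in> L j" "x = u \<otimes> u \<otimes> D 0 v"
      "u' \<in> L j" "v' \<in> L j" "y = u' \<otimes> u' \<otimes> D 0 v'" by auto
    then have "x \<otimes> y = (u \<otimes> u') \<otimes> (u \<otimes> u') \<otimes> D 0 (v \<otimes> v')"
      using mem by (simp add: D_mult m_ac)
    with * closed show "x \<otimes> y \<in> L (Suc j)" by auto
  qed
qed

lemmas L_carrier = subgroup.mem_carrier[OF L_subgroup]
lemmas L_closed = subgroup.m_closed[OF L_subgroup]
lemmas L_one = subgroup.one_closed[OF L_subgroup]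
lemmas L_inv = subgroup.m_inv_closed[OF L_subgroup]

lemma L_SucI: "u \<in> L j \<Longrightarrow> v \<in> L j \<Longrightarrow> u \<otimes> u \<otimes> D 0 v \<in> L (Suc j)"
  by auto

lemma L_SucE:
  assumes "x \<in> L (Suc j)"
  obtains u v where "u \<in> L j" "v \<in> L j" "x = u \<otimes> u \<otimes> D 0 v"
  using assms by auto

lemma L_sq: "x \<in> L j \<Longrightarrow> x \<otimes> x \<in> L (Suc j)"
  using L_SucI[of x j \<one>] L_one L_carrier by auto

lemma L_D0: "x \<in> L j \<Longrightarrow> D 0 x \<in> L (Suc j)"
  using L_SucI[of \<one> j x] L_one L_carrier by auto

declare L.simps(2) [simp del]

lemma L_Suc_subset: "L (Suc j) \<subseteq> L j"
proof (induction j)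
  case 0
  show ?case using L_carrier by auto
next
  case (Suc j)
  show ?case
  proof
    fix x assume "x \<in> L (Suc (Suc j))"
    then show "x \<in> L (Suc j)" using Suc by (elim L_SucE) (auto intro: L_SucI)
  qed
qed

lemma L_anti: "i \<le> j \<Longrightarrow> L j \<subseteq> L i"
  by (rule lift_Suc_antimono_le[of L]) (rule L_Suc_subset)

text \<open>The operator \<open>D (Suc k)\<close> factors as D (D + 2) with D = \<open>D k\<close>.
  For k = 0 both factors lie in I, which already gains two degrees; for larger k the gain of
  \<open>D k\<close> itself suffices.\<close>

lemma L_D_Suc: "x \<in> L j \<Longrightarrow> D (Suc k) x \<in> L (j + 2)"
proof (induction k arbitrary: j x)
  case 0
  have "D 0 (D 0 x) \<in> L (j + 2)" "D 0 x \<otimes> D 0 x \<in> L (j + 2)"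
    using L_D0[OF L_D0[OF 0]] L_sq[OF L_D0[OF 0]] by simp_all
  then show ?case using D_Suc[OF L_carrier[OF 0]] L_closed by simp
next
  case (Suc k)
  have "D (Suc k) x \<in> L (j + 2)" using Suc by blast
  then have "D (Suc k) (D (Suc k) x) \<in> L (j + 2)" "D (Suc k) x \<otimes> D (Suc k) x \<in> L (j + 2)"
    using Suc.IH L_closed L_anti[of "j + 2" "j + 2 + 2"] by auto
  then show ?case using D_Suc[OF L_carrier[OF Suc.prems], of "Suc k"] L_closed by simp
qed

lemma L_D: "x \<in> L j \<Longrightarrow> D k x \<in> L (Suc j)"
  using L_D0 L_D_Suc L_anti[of "Suc j" "j + 2"] by (cases k) auto

text \<open>Nakayama's lemma, with the nilpotency of \<open>D 0\<close> modulo \<open>2\<close> replaced by \<open>D n = 0\<close>.\<close>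

lemma L_squares:
  assumes ij: "i \<le> j" and x: "x \<in> L j"
    and gen: "\<And>x. x \<in> L j \<Longrightarrow> \<exists>u \<in> L i. \<exists>v \<in> L j. x = u \<otimes> u \<otimes> D 0 v"
  shows "\<exists>u \<in> L i. x = u \<otimes> u"
proof -
  have "\<exists>u \<in> L i. \<exists>v \<in> L j. x = u \<otimes> u \<otimes> D k v" for k
    using x
  proof (induction k arbitrary: x)
    case 0
    show ?case using gen[OF 0] .
  next
    case (Suc k)
    obtain u v where uv: "u \<in> L i" "v \<in> L j" "x = u \<otimes> u \<otimes> D k v"
      using Suc by blast
    obtain u' v' where uv': "u' \<in> L i" "v' \<in> L j" "v = u' \<otimes> u' \<otimes> D k v'"
      using Suc.IH[OF uv(2)] by blast
    \<comment> \<open>Insert the decomposition of v into \<open>D k v\<close> and replace the square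
      of \<open>D k\<close> by \<open>D (Suc k)\<close> minus twice \<open>D k\<close>. All doubled
      terms collect in twice \<open>?w\<close>, and \<open>D (Suc k) v'\<close> remains.\<close>
    let ?w = "u \<otimes> D k u' \<otimes> inv (D k v')"
    note [simp] = L_carrier[OF uv(1)] L_carrier[OF uv(2)] L_carrier[OF uv'(1)] L_carrier[OF uv'(2)]
    have w: "?w \<in> L i"
      using uv uv' L_closed L_inv L_D L_Suc_subset L_anti[OF ij] by (meson subsetD)
    have "?w \<otimes> ?w \<otimes> D (Suc k) v'
        = u \<otimes> u \<otimes> (D k u' \<otimes> D k u' \<otimes> D k (D k v'))
            \<otimes> ((D k v' \<otimes> inv (D k v')) \<otimes> (D k v' \<otimes> inv (D k v')))"
      unfolding D_Suc[OF L_carrier[OF uv'(2)]] by (simp only: m_ac m_closed inv_closed D_closed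
        L_carrier[OF uv(1)] L_carrier[OF uv'(1)] L_carrier[OF uv'(2)])
    also have "\<dots> = u \<otimes> u \<otimes> D k v"
      by (simp add: uv'(3) D_mult)
    finally show ?case using w uv(3) uv'(2) by metis
  qed
  from this[of n] obtain u v where "u \<in> L i" "v \<in> L j" "x = u \<otimes> u \<otimes> D n v" by blast
  then show ?thesis using L_carrier D_n by auto
qed


section \<open>Lengths of the layers\<close>

lemma L_pow: "x \<in> L j \<Longrightarrow> x [^] (2 ^ k :: nat) \<in> L (j + k)"
proof (induction k)
  case (Suc k)
  then have "x [^] (2 ^ k :: nat) \<otimes> x [^] (2 ^ k :: nat) \<in> L (j + Suc k)"
    using L_sq[of "x [^] (2 ^ k :: nat)" "j + k"] by simp
  then show ?case using L_carrier[OF Suc.prems] by (simp add: nat_pow_mult mult_2)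
qed (use L_carrier in simp)

lemma pow_card: "x \<in> carrier G \<Longrightarrow> x [^] (2 ^ (n + 1) :: nat) = \<one>"
  using pow_order_eq_1[of x] card_carrier by (simp add: order_def)

lemma sqrt_pow:
  assumes "x \<in> L j" and "\<And>x. x \<in> L j \<Longrightarrow> \<exists>u \<in> L j. x = u \<otimes> u"
  shows "\<exists>y \<in> L j. x = y [^] (2 ^ k :: nat)"
proof (induction k)
  case 0
  show ?case using assms L_carrier by auto
next
  case (Suc k)
  then obtain y where y: "y \<in> L j" "x = y [^] (2 ^ k :: nat)" by blast
  obtain u where u: "u \<in> L j" "y = u \<otimes> u" using assms(2)[OF y(1)] by blast
  have "x = u [^] (2 ^ Suc k :: nat)"
    using y u L_carrier[OF u(1)] by (simp add: nat_pow_distrib nat_pow_mult mult_2)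
  with u show ?case by blast
qed

text \<open>If two consecutive terms agree, Nakayama makes every element of \<open>L j\<close> a
  double of an element of \<open>L j\<close>, hence a multiple of 2^(n+1), hence trivial. Otherwise
  the next term is a proper subgroup, of index at least two.\<close>

lemma L_half: "L j = {\<one>} \<or> 2 * card (L (Suc j)) \<le> card (L j)"
proof (cases "L (Suc j) = L j")
  case True
  have "\<exists>u \<in> L j. x = u \<otimes> u" if "x \<in> L j" for x
    using L_squares[OF order.refl that] L_SucE[of _ j] True by metis
  then have "x = \<one>" if "x \<in> L j" for x
    using sqrt_pow[OF that, of "n + 1"] pow_card L_carrier by blast
  then show ?thesis using L_one by auto
next
  case False
  then obtain x where "x \<in> L j" "x \<notin> L (Suc j)" using L_Suc_subset by blast
  then show ?thesis
    using coset_decomposition(1)[OF L_subgroup L_subgroup L_Suc_subset]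
      finite_subset[OF subgroup.subset[OF L_subgroup] fin] by blast
qed

lemma L_trivial_mono: "L i = {\<one>} \<Longrightarrow> i \<le> j \<Longrightarrow> L j = {\<one>}"
  using L_anti[of i j] L_one[of j] by auto

lemma card_L: "L (j + i) = {\<one>} \<or> 2 ^ i * card (L (j + i)) \<le> card (L j)"
proof (induction i)
  case (Suc i)
  show ?case
  proof (cases "L (j + i) = {\<one>}")
    case True
    then show ?thesis using L_trivial_mono[of "j + i"] by simp
  next
    case False
    then have "2 ^ i * (2 * card (L (j + Suc i))) \<le> 2 ^ i * card (L (j + i))"
      using L_half[of "j + i"] by (simp add: mult_le_mono2)
    also have "\<dots> \<le> card (L j)" using False Suc by simp
    finally show ?thesis by (simp add: mult.assoc mult.left_commute)
  qed
qed simp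

text \<open>Each step down from a nontrivial term costs a factor two, and a nontrivial
  \<open>L (j + i)\<close> still has two elements of its own; this accounts for the exponent i +
  1.\<close>

lemma L_trivialI:
  assumes "card (L j) < 2 ^ (i + 1)"
  shows "L (j + i) = {\<one>}"
proof (rule ccontr)
  assume "L (j + i) \<noteq> {\<one>}"
  with card_L[of j i] have "2 ^ i * card (L (j + i)) \<le> card (L j)" by simp
  also have "\<dots> < 2 ^ i * 2" using assms by simp
  finally have "card (L (j + i)) < 2" by (metis mult_less_cancel1)
  then have "card (L (j + i)) \<le> 1" by simp
  moreover have "finite (L (j + i))"
    using finite_subset[OF subgroup.subset[OF L_subgroup] fin] .
  ultimately have "x = \<one>" if "x \<in> L (j + i)" for x
    using that L_one card_le_Suc0_iff_eq by (metis One_nat_def)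
  with \<open>L (j + i) \<noteq> {\<one>}\<close> L_one show False by blast
qed

lemma L_index_two:
  assumes "card (L j) \<le> 2 * card (L (Suc j))" "x \<in> L j" "x \<notin> L (Suc j)" "y \<in> L j"
  shows "y \<in> L (Suc j) \<or> y \<otimes> inv x \<in> L (Suc j)"
  using coset_decomposition(2)[OF L_subgroup L_subgroup L_Suc_subset _ assms(2,3,1,4)]
    finite_subset[OF subgroup.subset[OF L_subgroup] fin] by blast

section \<open>The recursion measured by the filtration\<close>

lemma c_L: "c k \<in> L k"
proof (induction k)
  case (Suc k)
  then show ?case using c_Suc_D L_closed L_sq L_D by metis
qed (use c_closed in simp)

text \<open>For k = 0 the formula is exact. Afterwards each step doubles what is there and adds
  \<open>D (Suc k)\<close> applied to \<open>c (Suc k)\<close>, an element of degree k + 1, so the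
  error lands in degree k + 3.\<close>

lemma c_expansion:
  "\<exists>r \<in> L (k + 2). c (Suc k) = (c 0 \<otimes> c 0 \<otimes> D 0 (c 0)) [^] (2 ^ k :: nat) \<otimes> r"
proof (induction k)
  case 0
  show ?case using c_Suc_D[of 0] L_one c_closed by (intro bexI[of _ \<one>]) auto
next
  case (Suc k)
  let ?d = "c 0 \<otimes> c 0 \<otimes> D 0 (c 0)"
  obtain r where r: "r \<in> L (k + 2)" "c (Suc k) = ?d [^] (2 ^ k :: nat) \<otimes> r"
    using Suc by blast
  let ?s = "r \<otimes> r \<otimes> D (Suc k) (c (Suc k))"
  have "?s \<in> L (Suc k + 2)"
    using L_closed L_sq[OF r(1)] L_D_Suc[OF c_L[of "Suc k"], of k] by simp
  moreover have "c (Suc (Suc k)) = ?d [^] (2 ^ Suc k :: nat) \<otimes> ?s"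
  proof -
    have [simp]: "r \<in> carrier G" "?d \<in> carrier G" using r L_carrier c_closed by auto
    have "?d [^] (2 ^ Suc k :: nat) = ?d [^] (2 ^ k :: nat) \<otimes> ?d [^] (2 ^ k :: nat)"
      by (simp add: nat_pow_mult mult_2 c_closed)
    moreover have "c (Suc (Suc k)) = ?d [^] (2 ^ k :: nat) \<otimes> r \<otimes> (?d [^] (2 ^ k :: nat) \<otimes> r)
        \<otimes> D (Suc k) (c (Suc k))"
      using c_Suc_D[of "Suc k"] r(2) by simp
    ultimately show ?thesis by (simp add: m_ac c_closed)
  qed
  ultimately show ?case by blast
qed

text \<open>The hypotheses give G = <w> + 2 G. Iterating, G = <w> + 2^k G for every k, and 2^(n+1)
  annihilates G.\<close>

lemma cyclic_if_squares:
  assumes idx: "card (L 0) \<le> 2 * card (L (Suc 0))"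
    and w: "w \<in> L 0" "w \<notin> L (Suc 0)"
    and sq: "\<And>x. x \<in> L (Suc 0) \<Longrightarrow> \<exists>u \<in> carrier G. x = u \<otimes> u"
  shows "cyclic_group G"
proof -
  have [simp]: "w \<in> carrier G" using w by simp
  have "\<exists>i::int. \<exists>y \<in> carrier G. x = w [^] i \<otimes> y [^] (2 ^ k :: nat)" if "x \<in> carrier G" for x k
    using that
  proof (induction k arbitrary: x)
    case 0
    then show ?case by (intro exI[of _ 0] bexI[of _ x]) auto
  next
    case (Suc k)
    obtain i y where iy: "y \<in> carrier G" "x = w [^] (i::int) \<otimes> y [^] (2 ^ k :: nat)"
      using Suc by blast
    have "\<exists>e::int. \<exists>u \<in> carrier G. y = w [^] e \<otimes> (u \<otimes> u)"
      using L_index_two[OF idx w, of y, simplified, OF iy(1)]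
    proof
      assume "y \<in> L (Suc 0)"
      with sq obtain u where "u \<in> carrier G" "y = u \<otimes> u" by blast
      then show ?thesis by (intro exI[of _ 0] bexI[of _ u]) auto
    next
      assume "y \<otimes> inv w \<in> L (Suc 0)"
      with sq obtain u where u: "u \<in> carrier G" "y \<otimes> inv w = u \<otimes> u" by blast
      then have "y = w \<otimes> (u \<otimes> u)"
        using iy(1) inv_solve_right'[of "u \<otimes> u" y w] by (simp add: m_comm)
      with u(1) show ?thesis by (intro exI[of _ 1] bexI[of _ u]) auto
    qed
    then obtain e :: int and u where u: "u \<in> carrier G" "y = w [^] e \<otimes> (u \<otimes> u)" by blast
    have 1: "(w [^] e) [^] (2 ^ k :: nat) = w [^] (e * 2 ^ k)"
      by (metis \<open>w \<in> carrier G\<close> int_pow_int int_pow_pow of_nat_numeral of_nat_power)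
    have 2: "(u \<otimes> u) [^] (2 ^ k :: nat) = u [^] (2 ^ Suc k :: nat)"
      using u(1) by (simp add: nat_pow_distrib nat_pow_mult mult_2)
    have "y [^] (2 ^ k :: nat) = w [^] (e * 2 ^ k) \<otimes> u [^] (2 ^ Suc k :: nat)"
      unfolding u(2) 1[symmetric] 2[symmetric] using u(1) by (intro nat_pow_distrib) auto
    then have "x = w [^] (i + e * 2 ^ k) \<otimes> u [^] (2 ^ Suc k :: nat)"
      using iy(2) u(1) by (simp only: int_pow_mult \<open>w \<in> carrier G\<close> m_assoc int_pow_closed nat_pow_closed)
    with u(1) show ?case by blast
  qed
  from this[of _ "n + 1"] have "carrier G = range (\<lambda>i::int. w [^] i)"
    using pow_card by fastforce
  then show ?thesis unfolding cyclic_group by (intro bexI[of _ w]) auto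
qed

text \<open>The case split looks at degrees zero to two only. If some double lies outside
  \<open>L 2\<close>, either \<open>L 2\<close> has index at most four, which leaves exactly two
  layers of index two and makes G cyclic, or \<open>L 2\<close> is small enough to force
  \<open>L n\<close> to vanish one degree earlier than the order of G does.\<close>

theorem additive_order:
  assumes noncyclic: "\<not> cyclic_group G" and c_ne: "c (n - 1) \<noteq> \<one>"
  shows "c 0 [^] (2 ^ (n - 1) :: nat) \<noteq> \<one>"
proof
  assume c0: "c 0 [^] (2 ^ (n - 1) :: nat) = \<one>"
  have idx: "Suc (n - 2) = n - 1" "Suc (n - 3) = n - 2" using n by simp_all
  have triv: "L (n + 1) = {\<one>}" using L_trivialI[of 0 "n + 1"] card_carrier by simp
  consider (deep) "\<forall>x \<in> carrier G. x \<otimes> x \<in> L 2"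
    | (cyclic) x where "x \<in> carrier G" "x \<otimes> x \<notin> L 2" "2 ^ (n + 1) \<le> 4 * card (L 2)"
    | (small) "4 * card (L 2) < 2 ^ (n + 1)"
    by (cases "2 ^ (n + 1) \<le> 4 * card (L 2)") (auto simp: not_le)
  then show False
  proof cases
    \<comment> \<open>Multiplication by \<open>2\<close> raises the degree by two, so \<open>c k\<close> reaches \<open>0\<close> too early.\<close>
    case deep
    have sq: "x \<otimes> x \<in> L (j + 2)" if "x \<in> L j" for x j
      using that
    proof (induction j arbitrary: x)
      case (Suc j)
      then obtain u v where uv: "u \<in> L j" "v \<in> L j" "x = u \<otimes> u \<otimes> D 0 v" by (elim L_SucE)
      have "x \<otimes> x = (u \<otimes> u) \<otimes> (u \<otimes> u) \<otimes> D 0 (v \<otimes> v)"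
        using uv L_carrier by (simp add: D_mult m_ac)
      then show ?case using Suc.IH uv L_SucI by simp
    qed (use deep in \<open>simp add: numeral_2_eq_2\<close>)
    have "c (Suc k) \<in> L (2 * k + 1)" for k
    proof (induction k)
      case 0
      show ?case using c_L[of 1] by simp
    next
      case (Suc k)
      show ?case
        using L_closed[OF sq[OF Suc] L_D_Suc[OF Suc, of k]] c_Suc_D[of "Suc k"] by simp
    qed
    from this[of "n - 2"] have "c (n - 1) \<in> L (2 * (n - 2) + 1)"
      by (simp only: idx)
    \<comment> \<open>The inequality 2 (n - 2) + 1 >= n + 1 is exactly n >= 4.\<close>
    also have "\<dots> \<subseteq> L (n + 1)" using n by (intro L_anti) simp
    finally show False using triv c_ne by simp
  next
    \<comment> \<open>\<open>L 1\<close> is generated by \<open>2 G\<close> and \<open>L 2\<close>, hence equals \<open>2 G\<close>, which has index two.\<close>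
    case cyclic
    have two: "L 2 = L (Suc (Suc 0))" by (simp add: numeral_2_eq_2)
    \<comment> \<open>This keeps more than one element in \<open>L 2\<close>, so that
      \<open>L_half\<close> yields its second alternative for both upper layers.\<close>
    have "(2::nat) ^ 5 \<le> 2 ^ (n + 1)" using n by (intro power_increasing) auto
    then have big: "(32::nat) \<le> 2 ^ (n + 1)" by simp
    note cyc = cyclic[unfolded two]
    have "L (Suc (Suc 0)) \<noteq> {\<one>}" using cyc(3) big by auto
    then have "L 0 \<noteq> {\<one>}" "L (Suc 0) \<noteq> {\<one>}"
      using L_trivial_mono[of _ "Suc (Suc 0)"] by blast+
    then have half: "2 * card (L (Suc 0)) \<le> card (L 0)"
        "2 * card (L (Suc (Suc 0))) \<le> card (L (Suc 0))"
      using L_half[of 0] L_half[of "Suc 0"] by auto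
    have gen: "\<exists>u \<in> L 0. \<exists>v \<in> L (Suc 0). y = u \<otimes> u \<otimes> D 0 v" if y: "y \<in> L (Suc 0)" for y
    proof -
      \<comment> \<open>The double of x represents the nontrivial class of \<open>L 1\<close> modulo
        \<open>L 2\<close>. Up to that double, y therefore lies in \<open>L 2\<close>, which is 2
        \<open>L 1\<close> + \<open>D 0\<close> \<open>L 1\<close> by definition.\<close>
      have xx: "x \<otimes> x \<in> L (Suc 0)" "x \<otimes> x \<notin> L (Suc (Suc 0))"
        using cyc L_sq[of x 0] by auto
      have "card (L (Suc 0)) \<le> 2 * card (L (Suc (Suc 0)))"
        using half cyc(3) card_carrier by simp
      from L_index_two[OF this xx y] show ?thesis
      proof
        assume "y \<in> L (Suc (Suc 0))"
        then obtain u v where "u \<in> L (Suc 0)" "v \<in> L (Suc 0)" "y = u \<otimes> u \<otimes> D 0 v"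
          by (rule L_SucE)
        then show ?thesis using L_Suc_subset[of 0] by blast
      next
        assume "y \<otimes> inv (x \<otimes> x) \<in> L (Suc (Suc 0))"
        then obtain u v where uv: "u \<in> L (Suc 0)" "v \<in> L (Suc 0)"
          "y \<otimes> inv (x \<otimes> x) = u \<otimes> u \<otimes> D 0 v" by (rule L_SucE)
        have [simp]: "x \<in> carrier G" "y \<in> carrier G" "u \<in> carrier G" "v \<in> carrier G"
          using cyclic(1) y uv L_carrier by auto
        have "y = y \<otimes> inv (x \<otimes> x) \<otimes> (x \<otimes> x)"
          by (simp only: m_assoc m_closed inv_closed l_inv r_one \<open>x \<in> carrier G\<close> \<open>y \<in> carrier G\<close>)
        also have "\<dots> = (x \<otimes> u) \<otimes> (x \<otimes> u) \<otimes> D 0 v"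
          unfolding uv(3) by (simp add: m_ac)
        finally have "y = (x \<otimes> u) \<otimes> (x \<otimes> u) \<otimes> D 0 v" .
        moreover have "x \<otimes> u \<in> L 0" by simp
        ultimately show ?thesis using uv(2) by blast
      qed
    qed
    have "L (Suc 0) \<noteq> L 0" using half big card_carrier by auto
    then obtain w where w: "w \<in> L 0" "w \<notin> L (Suc 0)" using L_Suc_subset by blast
    have "card (L 0) \<le> 2 * card (L (Suc 0))" using half cyc(3) card_carrier by simp
    have "\<exists>u \<in> carrier G. x = u \<otimes> u" if "x \<in> L (Suc 0)" for x
      using L_squares[OF _ that gen] by simp
    with cyclic_if_squares[OF \<open>card (L 0) \<le> 2 * card (L (Suc 0))\<close> w] noncyclic show False by blast
  next
    \<comment> \<open>The layers from \<open>L (n - 2)\<close> on are so thin that \<open>D 0 r \<in> {0, p}\<close> modulo \<open>L (n - 1)\<close>, where \<open>p = 2 r\<close>;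
      doubling gives \<open>c (n - 1) = D 0 p = 0\<close>.\<close>
    case small
    then have small': "card (L 2) < 2 ^ (n - 1)"
      using n power_add[of "2::nat" 2 "n - 1"] by simp
    then have Ln: "L n = {\<one>}" using L_trivialI[of 2 "n - 2"] n idx by simp
    define p where "p = c 0 [^] (2 ^ (n - 2) :: nat)"
    define r where "r = c 0 [^] (2 ^ (n - 3) :: nat)"
    have cl [simp]: "p \<in> carrier G" "r \<in> carrier G" "c 0 \<in> carrier G"
      by (simp_all add: p_def r_def c_closed)
    have p_eq: "p = r \<otimes> r" and pp: "p \<otimes> p = \<one>"
    proof -
      have "2 ^ (n - 2) = 2 ^ (n - 3) + (2 ^ (n - 3) :: nat)"
           "2 ^ (n - 1) = 2 ^ (n - 2) + (2 ^ (n - 2) :: nat)"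
        using power_Suc[of "2::nat" "n - 3"] power_Suc[of "2::nat" "n - 2"] unfolding idx
        by simp_all
      with c0 show "p = r \<otimes> r" "p \<otimes> p = \<one>"
        unfolding p_def r_def nat_pow_mult[OF c_closed] by simp_all
    qed
    \<comment> \<open>At k = n - 2 the error term of the expansion lies in \<open>L n\<close>, which
      is trivial here, so c (n - 1) equals 2 p + \<open>D 0 p\<close>, and 2 p = 0.\<close>
    have cD: "c (n - 1) = D 0 p"
    proof -
      have "n - 2 + 2 = n" using n by simp
      then obtain r where "r \<in> L n"
          "c (Suc (n - 2)) = (c 0 \<otimes> c 0 \<otimes> D 0 (c 0)) [^] (2 ^ (n - 2) :: nat) \<otimes> r"
        using c_expansion[of "n - 2"] by metis
      then have "c (Suc (n - 2)) = (c 0 \<otimes> c 0 \<otimes> D 0 (c 0)) [^] (2 ^ (n - 2) :: nat)"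
        using Ln by (simp add: c_closed)
      also have "\<dots> = p \<otimes> p \<otimes> D 0 p"
        by (simp add: p_def nat_pow_distrib D_pow)
      finally show ?thesis using pp by (simp add: idx)
    qed
    have Dtriv: "D 0 x = \<one>" "x \<otimes> x = \<one>" if "x \<in> L (n - 1)" for x
      using L_D0[OF that] L_sq[OF that] Ln n by simp_all
    have p_mem: "p \<in> L (n - 2)" and p_not: "p \<notin> L (Suc (n - 2))"
      using L_pow[of "c 0" 0 "n - 2"] Dtriv(1)[of p] cD c_ne
      unfolding idx by (auto simp: p_def)
    have Dr: "D 0 r \<in> L (n - 2)"
      using L_D0[OF L_pow[of "c 0" 0 "n - 3"]] n
      by (simp add: r_def idx)
    have ne: "L (n - 1) \<noteq> {\<one>}" using c_L[of "n - 1"] c_ne by auto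
    \<comment> \<open>There are n - 4 halvings between \<open>L 2\<close> and
      \<open>L (n - 2)\<close>. Fewer than 2^(n-1) = 8 * 2^(n-4) elements at the top leave fewer
      than eight at the bottom, and a power of two below eight is at most four.\<close>
    have "L (n - 2) \<noteq> {\<one>}" using L_trivial_mono[of "n - 2" "n - 1"] ne by fastforce
    moreover have "2 + (n - 4) = n - 2" using n by simp
    ultimately have "2 ^ (n - 4) * card (L (n - 2)) \<le> card (L 2)"
      using card_L[of 2 "n - 4"] by metis
    also have "\<dots> < 2 ^ (n - 4) * 8"
      using small' n power_add[of "2::nat" "n - 4" 3] by simp
    finally have lt: "card (L (n - 2)) < 8" by simp
    have "card (L (n - 2)) dvd 2 ^ (n + 1)"
      using lagrange[OF L_subgroup] card_carrier unfolding order_def by (metis dvd_triv_right)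
    then obtain i where i: "card (L (n - 2)) = 2 ^ i"
      using divides_primepow_nat[OF two_is_prime_nat] by blast
    with lt have "2 ^ i < (2::nat) ^ 3" by simp
    then have "i \<le> 2" using power_less_imp_less_exp[of "2::nat" i 3] by simp
    then have le4: "card (L (n - 2)) \<le> 4"
      using i power_increasing[of i 2 "2::nat"] by simp
    have "card (L (n - 1)) \<noteq> 0" "card (L (n - 1)) \<noteq> 1"
      using L_one[of "n - 1"] ne finite_subset[OF subgroup.subset[OF L_subgroup] fin, of "n - 1"]
      by (auto simp: card_1_singleton_iff)
    then have "card (L (n - 2)) \<le> 2 * card (L (Suc (n - 2)))"
      using le4 by (simp add: idx)
    from L_index_two[OF this p_mem p_not Dr]
    have "D 0 r \<otimes> D 0 r = \<one>"
    proof
      assume "D 0 r \<in> L (Suc (n - 2))"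
      then show ?thesis using Dtriv(2) by (simp add: idx)
    next
      assume "D 0 r \<otimes> inv p \<in> L (Suc (n - 2))"
      then have "(D 0 r \<otimes> inv p) \<otimes> (D 0 r \<otimes> inv p) = \<one>"
        using Dtriv(2) by (simp add: idx)
      moreover have "(D 0 r \<otimes> inv p) \<otimes> (D 0 r \<otimes> inv p) = D 0 r \<otimes> D 0 r \<otimes> inv (p \<otimes> p)"
        by (simp add: m_ac inv_mult)
      ultimately show ?thesis using pp by simp
    qed
    then have "D 0 p = \<one>" by (simp add: p_eq D_mult)
    with cD c_ne show False by simp
  qed
qed

end

section \<open>The modular group given by its presentation\<close>

lemma word_eq_context: "word_eq R u v \<Longrightarrow> word_eq R (p @ u @ s) (p @ v @ s)"
proof (induction rule: word_eq.induct)
  case (cancel u x b v)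
  show ?case using word_eq.cancel[of R "p @ u" x b "v @ s"] by simp
next
  case (rel l r u v)
  show ?case using word_eq.rel[OF rel, of "p @ u" "v @ s"] by simp
qed (auto intro: word_eq.intros)

lemma word_eq_append:
  assumes "word_eq R u u'" "word_eq R v v'"
  shows "word_eq R (u @ v) (u' @ v')"
  using word_eq_context[OF assms(1), of "[]" v] word_eq_context[OF assms(2), of u' "[]"]
  by (auto intro: word_eq.trans)

lemma word_class_eq_iff: "word_class R u = word_class R v \<longleftrightarrow> word_eq R u v"
  unfolding word_class_def set_eq_iff by (auto intro: word_eq.intros)

lemma presented_group_mult:
  "word_class R u \<otimes>\<^bsub>presented_group R\<^esub> word_class R v = word_class R (u @ v)"
  unfolding presented_group_def word_class_def
  by (auto intro: word_eq.intros word_eq_append)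

definition word_eval :: "('g, 'k) monoid_scheme \<Rightarrow> ('x \<Rightarrow> 'g) \<Rightarrow> 'x word \<Rightarrow> 'g" where
  "word_eval G f w =
     foldr (\<lambda>(x, b) g. (if b then f x else inv\<^bsub>G\<^esub> (f x)) \<otimes>\<^bsub>G\<^esub> g) w \<one>\<^bsub>G\<^esub>"

context group
begin

lemma word_eval_closed [simp]: "range f \<subseteq> carrier G \<Longrightarrow> word_eval G f w \<in> carrier G"
  by (induction w) (auto simp: word_eval_def image_subset_iff)

lemma word_eval_Nil [simp]: "word_eval G f [] = \<one>"
  by (simp add: word_eval_def)

lemma word_eval_Cons:
  "word_eval G f ((x, b) # w) = (if b then f x else inv (f x)) \<otimes> word_eval G f w"
  by (simp add: word_eval_def)

lemma word_eval_append:
  "range f \<subseteq> carrier G \<Longrightarrow> word_eval G f (u @ v) = word_eval G f u \<otimes> word_eval G f v"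
proof (induction u)
  case (Cons p u)
  then have "f x \<in> carrier G" for x by auto
  with Cons show ?case by (cases p) (simp add: word_eval_Cons m_assoc)
qed simp

lemma word_eval_replicate:
  "range f \<subseteq> carrier G \<Longrightarrow> word_eval G f (replicate k (x, True)) = f x [^] k"
proof (induction k)
  case (Suc k)
  then have "f x \<in> carrier G" by auto
  with Suc show ?case by (simp add: word_eval_Cons flip: nat_pow_Suc2)
qed simp

lemma word_eval_eq:
  assumes f: "range f \<subseteq> carrier G"
    and R: "\<And>l r. (l, r) \<in> R \<Longrightarrow> word_eval G f l = word_eval G f r"
    and "word_eq R u v"
  shows "word_eval G f u = word_eval G f v"
  using assms(3)
proof (induction rule: word_eq.induct)
  case (cancel u x b v)
  have "f x \<in> carrier G" using f by auto
  then have "word_eval G f [(x, b), (x, \<not> b)] = \<one>"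
    by (cases b) (auto simp: word_eval_Cons)
  then show ?case using f word_eval_append[OF f, of "[(x, b), (x, \<not> b)]" v]
    by (simp add: word_eval_append)
next
  case (rel l r u v)
  then show ?case using f R by (simp add: word_eval_append)
qed auto

end

definition gens_map :: "'a \<Rightarrow> 'a \<Rightarrow> gens \<Rightarrow> 'a" where
  "gens_map a b x = (case x of Gen_a \<Rightarrow> a | Gen_b \<Rightarrow> b)"

lemma gens_map_simps [simp]: "gens_map a b Gen_a = a" "gens_map a b Gen_b = b"
  by (simp_all add: gens_map_def)

lemma range_gens_map: "a \<in> A \<Longrightarrow> b \<in> A \<Longrightarrow> range (gens_map a b) \<subseteq> A"
  by (auto simp: gens_map_def split: gens.split)

text \<open>Only the relations, with the conjugation written without inverses. Neither generation
  nor freeness is required, so pairs in the holomorph qualify as well as the generators of the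
  presented group.\<close>

locale modular_relations = group G for G (structure) +
  fixes m :: nat and a b
  assumes a_closed [simp]: "a \<in> carrier G" and b_closed [simp]: "b \<in> carrier G"
    and a_pow: "a [^] (2 ^ (m + 1) :: nat) = \<one>"
    and b_sq: "b \<otimes> b = \<one>"
    and b_a: "b \<otimes> a = a [^] (1 + 2 ^ m :: nat) \<otimes> b"
begin

lemma inv_b [simp]: "inv b = b"
  using b_sq by (simp add: inv_equality)

lemma word_eval_M_relations:
  assumes "(l, r) \<in> M_relations m"
  shows "word_eval G (gens_map a b) l = word_eval G (gens_map a b) r"
proof -
  have *: "range (gens_map a b) \<subseteq> carrier G" by (simp add: range_gens_map)
  have "b \<otimes> (a \<otimes> b) = a [^] (1 + 2 ^ m :: nat) \<otimes> (b \<otimes> b)"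
    using b_a by (simp add: m_assoc[symmetric])
  then have "b \<otimes> (a \<otimes> b) = a [^] (1 + 2 ^ m :: nat)" by (simp add: b_sq)
  then show ?thesis
    using assms a_pow b_sq unfolding M_relations_def
    by (auto simp: word_eval_replicate[OF *] word_eval_Cons simp del: replicate_Suc replicate_add power_Suc)
qed

end

text \<open>The quotient is traded for a map on words whose fibres are exactly the classes of
  \<open>word_eq\<close>. That equal values imply equivalent words is what makes the map of von
  Dyck's theorem well defined.\<close>

lemma M_generators_words:
  assumes "M_generators m G a b"
  shows "\<exists>\<pi>. \<pi> [(Gen_a, True)] = a \<and> \<pi> [(Gen_b, True)] = b \<and> range \<pi> = carrier G \<and>
    (\<forall>u v. \<pi> (u @ v) = \<pi> u \<otimes>\<^bsub>G\<^esub> \<pi> v) \<and>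
    (\<forall>u v. \<pi> u = \<pi> v \<longleftrightarrow> word_eq (M_relations m) u v)"
proof -
  let ?R = "M_relations m"
  obtain \<phi> where \<phi>: "\<phi> \<in> iso (M_group m) G"
    "\<phi> (word_class ?R [(Gen_a, True)]) = a" "\<phi> (word_class ?R [(Gen_b, True)]) = b"
    using assms unfolding M_generators_def by blast
  have carr: "carrier (M_group m) = range (word_class ?R)"
    by (simp add: M_group_def presented_group_def)
  have bij: "bij_betw \<phi> (range (word_class ?R)) (carrier G)" and hom: "\<phi> \<in> hom (M_group m) G"
    using \<phi>(1) carr by (auto simp: iso_def)
  show ?thesis
  proof (intro exI[of _ "\<lambda>w. \<phi> (word_class ?R w)"] conjI allI)
    show "range (\<lambda>w. \<phi> (word_class ?R w)) = carrier G"
      using bij by (auto simp: bij_betw_def)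
    show "\<phi> (word_class ?R (u @ v)) = \<phi> (word_class ?R u) \<otimes>\<^bsub>G\<^esub> \<phi> (word_class ?R v)" for u v
      using hom_mult[OF hom, of "word_class ?R u" "word_class ?R v"] carr
      by (simp add: M_group_def presented_group_mult)
    show "(\<phi> (word_class ?R u) = \<phi> (word_class ?R v)) = word_eq ?R u v" for u v
      using inj_on_eq_iff[OF bij_betw_imp_inj_on[OF bij] rangeI rangeI, of u v]
      by (simp add: word_class_eq_iff)
  qed (use \<phi> in auto)
qed

lemma M_generators_relations:
  assumes "M_generators m G a b"
  shows "modular_relations G m a b"
proof -
  obtain \<pi> where \<pi>: "\<pi> [(Gen_a, True)] = a" "\<pi> [(Gen_b, True)] = b" "range \<pi> = carrier G"
    "\<And>u v. \<pi> (u @ v) = \<pi> u \<otimes>\<^bsub>G\<^esub> \<pi> v"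
    "\<And>u v. \<pi> u = \<pi> v \<longleftrightarrow> word_eq (M_relations m) u v"
    using M_generators_words[OF assms] by blast
  interpret group G using assms by (simp add: M_generators_def)
  have carr: "\<pi> w \<in> carrier G" for w using \<pi>(3) by auto
  have one: "\<pi> [] = \<one>\<^bsub>G\<^esub>"
    using \<pi>(4)[of "[]" "[]"] carr by (metis append_Nil l_cancel_one')
  have rep: "\<pi> (replicate k (Gen_a, True)) = a [^]\<^bsub>G\<^esub> k" for k
  proof (induction k)
    case (Suc k)
    have "\<pi> (replicate (Suc k) (Gen_a, True)) = \<pi> (replicate k (Gen_a, True)) \<otimes>\<^bsub>G\<^esub> a"
      using \<pi>(1) \<pi>(4)[of "replicate k (Gen_a, True)" "[(Gen_a, True)]"]
      by (simp add: replicate_append_same)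
    with Suc show ?case by simp
  qed (use one in simp)
  have rel: "\<pi> l = \<pi> r" if "(l, r) \<in> M_relations m" for l r
    using word_eq.rel[OF that, of "[]" "[]"] \<pi>(5) by simp
  show ?thesis
  proof
    show "a \<in> carrier G" "b \<in> carrier G" using carr \<pi>(1,2) by metis+
    show "a [^]\<^bsub>G\<^esub> (2 ^ (m + 1) :: nat) = \<one>\<^bsub>G\<^esub>"
      using rel[of "replicate (2 ^ (m + 1)) (Gen_a, True)" "[]"] rep one
      by (simp add: M_relations_def)
    show "b \<otimes>\<^bsub>G\<^esub> b = \<one>\<^bsub>G\<^esub>"
      using rel[of "[(Gen_b, True), (Gen_b, True)]" "[]"] \<pi>(4)[of "[(Gen_b, True)]" "[(Gen_b, True)]"]
        \<pi>(2) one by (simp add: M_relations_def)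
    let ?u = "[(Gen_b, True), (Gen_a, True), (Gen_b, False)]"
    \<comment> \<open>The third relation ends in the formal inverse of b. Appending b cancels that
      letter and turns the relation into the inverse-free form of
      \<open>modular_relations\<close>.\<close>
    have "\<pi> (?u @ [(Gen_b, True)]) = \<pi> [(Gen_b, True), (Gen_a, True)]"
      unfolding \<pi>(5)
      using word_eq.cancel[of "M_relations m" "[(Gen_b, True), (Gen_a, True)]" Gen_b False "[]"] by simp
    moreover have "\<pi> [(Gen_b, True), (Gen_a, True)] = b \<otimes>\<^bsub>G\<^esub> a"
      using \<pi>(4)[of "[(Gen_b, True)]" "[(Gen_a, True)]"] \<pi>(1,2) by simp
    moreover have "\<pi> ?u = a [^]\<^bsub>G\<^esub> (1 + 2 ^ m :: nat)"
      using rel[of ?u "replicate (1 + 2 ^ m) (Gen_a, True)"] rep[of "1 + 2 ^ m"]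
      by (simp only: M_relations_def insert_iff simp_thms)
    moreover have "\<pi> (?u @ [(Gen_b, True)]) = \<pi> ?u \<otimes>\<^bsub>G\<^esub> b"
      using \<pi>(4)[of ?u "[(Gen_b, True)]"] \<pi>(2) by metis
    ultimately show "b \<otimes>\<^bsub>G\<^esub> a = a [^]\<^bsub>G\<^esub> (1 + 2 ^ m :: nat) \<otimes>\<^bsub>G\<^esub> b"
      by metis
  qed
qed

text \<open>Universal property of the presentation: evaluate an element through any word that
  represents it. Two such words are equivalent, and the relations hold in H, so the choice has no
  effect.\<close>

lemma von_Dyck:
  assumes gens: "M_generators m G a b" and H: "modular_relations H m \<alpha> \<beta>"
  shows "\<exists>h \<in> hom G H. h a = \<alpha> \<and> h b = \<beta>"
proof -
  interpret H: modular_relations H m \<alpha> \<beta> by (fact H)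
  obtain \<pi> where \<pi>: "\<pi> [(Gen_a, True)] = a" "\<pi> [(Gen_b, True)] = b" "range \<pi> = carrier G"
    "\<And>u v. \<pi> (u @ v) = \<pi> u \<otimes>\<^bsub>G\<^esub> \<pi> v"
    "\<And>u v. \<pi> u = \<pi> v \<longleftrightarrow> word_eq (M_relations m) u v"
    using M_generators_words[OF gens] by blast
  let ?e = "word_eval H (gens_map \<alpha> \<beta>)"
  have rng: "range (gens_map \<alpha> \<beta>) \<subseteq> carrier H" by (simp add: range_gens_map)
  define h where "h g = ?e (SOME w. \<pi> w = g)" for g
  have h: "h (\<pi> w) = ?e w" for w
  proof -
    have "\<pi> (SOME w'. \<pi> w' = \<pi> w) = \<pi> w" by (rule someI) simp
    then show ?thesis
      unfolding h_def using H.word_eval_eq[OF rng H.word_eval_M_relations] \<pi>(5) by blast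
  qed
  have "h \<in> hom G H"
  proof (rule homI)
    show "h x \<in> carrier H" if "x \<in> carrier G" for x
      using that \<pi>(3) h rng by (metis H.word_eval_closed rangeE)
    show "h (x \<otimes>\<^bsub>G\<^esub> y) = h x \<otimes>\<^bsub>H\<^esub> h y" if xy: "x \<in> carrier G" "y \<in> carrier G" for x y
    proof -
      obtain u v where "x = \<pi> u" "y = \<pi> v" using xy \<pi>(3) by (metis rangeE)
      then show ?thesis using h \<pi>(4)[of u v, symmetric] H.word_eval_append[OF rng] by simp
    qed
  qed
  moreover have "h a = \<alpha>" "h b = \<beta>"
    using h[of "[(Gen_a, True)]"] h[of "[(Gen_b, True)]"] \<pi>(1,2) by (simp_all add: H.word_eval_Cons)
  ultimately show ?thesis by blast
qed

section \<open>Normal forms a^i b^j\<close>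

context modular_relations
begin

lemma a_pow_mod: "a [^] (i mod 2 ^ (m + 1) :: nat) = a [^] (i :: nat)"
proof -
  have "a [^] i = a [^] (2 ^ (m + 1) * (i div 2 ^ (m + 1)) + i mod 2 ^ (m + 1))" by simp
  also have "\<dots> = (a [^] (2 ^ (m + 1) :: nat)) [^] (i div 2 ^ (m + 1)) \<otimes> a [^] (i mod 2 ^ (m + 1))"
    by (simp only: nat_pow_mult[symmetric] nat_pow_pow a_closed nat_pow_closed)
  finally show ?thesis by (simp only: a_pow nat_pow_one l_one nat_pow_closed a_closed)
qed

lemma a_pow_cong: "i mod 2 ^ (m + 1) = j mod 2 ^ (m + 1) \<Longrightarrow> a [^] i = a [^] (j :: nat)"
  using a_pow_mod by metis

lemma b_a_pow: "b \<otimes> a [^] (i :: nat) = a [^] (i * (1 + 2 ^ m)) \<otimes> b"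
proof (induction i)
  case (Suc i)
  have "b \<otimes> a [^] Suc i = (b \<otimes> a [^] i) \<otimes> a" by (simp add: m_assoc)
  also have "\<dots> = a [^] (i * (1 + 2 ^ m)) \<otimes> (b \<otimes> a)" unfolding Suc by (simp add: m_assoc)
  also have "\<dots> = a [^] (i * (1 + 2 ^ m) + (1 + 2 ^ m)) \<otimes> b"
    unfolding b_a nat_pow_mult[OF a_closed, symmetric, of _ "1 + 2 ^ m"]
    by (simp only: m_assoc a_closed b_closed nat_pow_closed)
  finally show ?case by (simp add: algebra_simps)
qed simp

lemma square_pow_b: "(a [^] i \<otimes> b) \<otimes> (a [^] i \<otimes> b) = a [^] (i * (2 + 2 ^ m) :: nat)"
proof -
  have "(a [^] i \<otimes> b) \<otimes> (a [^] i \<otimes> b) = a [^] i \<otimes> (b \<otimes> a [^] i) \<otimes> b" by (simp add: m_assoc)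
  also have "\<dots> = a [^] i \<otimes> a [^] (i * (1 + 2 ^ m)) \<otimes> (b \<otimes> b)"
    unfolding b_a_pow by (simp add: m_assoc)
  also have "\<dots> = a [^] (i + i * (1 + 2 ^ m))" by (simp only: b_sq nat_pow_mult a_closed r_one nat_pow_closed)
  finally show ?thesis by (simp add: algebra_simps)
qed

definition normal_form :: "nat \<times> nat \<Rightarrow> 'a" where
  "normal_form = (\<lambda>(i, j). a [^] i \<otimes> b [^] j)"

end

text \<open>An upper bound for the group; uniqueness of the exponents is not claimed. The set of all
  a^i and a^i b is stable under left multiplication by every letter, since the inverse of a is a
  positive power of a and b is its own inverse, so induction on words applies.\<close>

lemma M_generators_normal_form:
  assumes gens: "M_generators m G a b" and g: "g \<in> carrier G"
  shows "\<exists>i < 2 ^ (m + 1). \<exists>j < 2. g = modular_relations.normal_form G a b (i, j)"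
proof -
  interpret modular_relations G m a b by (rule M_generators_relations[OF gens])
  define S where "S = {a [^]\<^bsub>G\<^esub> i | i :: nat. True} \<union> {a [^]\<^bsub>G\<^esub> i \<otimes>\<^bsub>G\<^esub> b | i :: nat. True}"
  have S_a: "a [^]\<^bsub>G\<^esub> (i::nat) \<otimes>\<^bsub>G\<^esub> s \<in> S" if "s \<in> S" for i s
    using that nat_pow_mult[OF a_closed] unfolding S_def
    by (auto simp: m_assoc[symmetric])
  have S_b: "b \<otimes>\<^bsub>G\<^esub> s \<in> S" if "s \<in> S" for s
  proof -
    from that consider i :: nat where "s = a [^]\<^bsub>G\<^esub> i" | i :: nat where "s = a [^]\<^bsub>G\<^esub> i \<otimes>\<^bsub>G\<^esub> b"
      unfolding S_def by blast
    then show ?thesis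
    proof cases
      case 1
      then show ?thesis unfolding S_def using b_a_pow by blast
    next
      case (2 i)
      then have "b \<otimes>\<^bsub>G\<^esub> s = (b \<otimes>\<^bsub>G\<^esub> a [^]\<^bsub>G\<^esub> i) \<otimes>\<^bsub>G\<^esub> b" by (simp add: m_assoc)
      also have "\<dots> = a [^]\<^bsub>G\<^esub> (i * (1 + 2 ^ m))" unfolding b_a_pow by (simp add: m_assoc b_sq)
      finally show ?thesis unfolding S_def by blast
    qed
  qed
  have inv_a: "inv\<^bsub>G\<^esub> a = a [^]\<^bsub>G\<^esub> (2 ^ (m + 1) - 1 :: nat)"
  proof (rule inv_equality)
    have "a [^]\<^bsub>G\<^esub> (2 ^ (m + 1) - 1 :: nat) \<otimes>\<^bsub>G\<^esub> a = a [^]\<^bsub>G\<^esub> Suc (2 ^ (m + 1) - 1 :: nat)"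
      by (simp only: nat_pow_Suc)
    also have "Suc (2 ^ (m + 1) - 1 :: nat) = 2 ^ (m + 1)" by simp
    finally show "a [^]\<^bsub>G\<^esub> (2 ^ (m + 1) - 1 :: nat) \<otimes>\<^bsub>G\<^esub> a = \<one>\<^bsub>G\<^esub>" using a_pow by simp
  qed auto
  obtain h where h: "h \<in> hom G G" "h a = a" "h b = b"
    using von_Dyck[OF gens modular_relations_axioms] by blast
  obtain \<pi> where \<pi>: "\<pi> [(Gen_a, True)] = a" "\<pi> [(Gen_b, True)] = b" "range \<pi> = carrier G"
    "\<And>u v. \<pi> (u @ v) = \<pi> u \<otimes>\<^bsub>G\<^esub> \<pi> v"
    "\<And>u v. \<pi> u = \<pi> v \<longleftrightarrow> word_eq (M_relations m) u v"
    using M_generators_words[OF gens] by blast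
  have carr: "\<pi> w \<in> carrier G" for w using \<pi>(3) by auto
  have one: "\<pi> [] = \<one>\<^bsub>G\<^esub>" using \<pi>(4)[of "[]" "[]"] carr by (metis append_Nil l_cancel_one')
  have inv: "\<pi> [(x, False)] = inv\<^bsub>G\<^esub> \<pi> [(x, True)]" for x
  proof (rule inv_equality[symmetric])
    have "\<pi> ([] @ [(x, False), (x, \<not> False)] @ []) = \<pi> ([] @ [])"
      unfolding \<pi>(5) by (rule word_eq.cancel)
    then show "\<pi> [(x, False)] \<otimes>\<^bsub>G\<^esub> \<pi> [(x, True)] = \<one>\<^bsub>G\<^esub>"
      using \<pi>(4)[of "[(x, False)]" "[(x, True)]"] one by simp
  qed (use carr in auto)
  have "\<pi> w \<in> S" for w
  proof (induction w)
    case Nil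
    have "\<one>\<^bsub>G\<^esub> = a [^]\<^bsub>G\<^esub> (0::nat)" by simp
    then show ?case unfolding one S_def by blast
  next
    case (Cons p w)
    obtain x s where p: "p = (x, s)" by (cases p)
    have split: "\<pi> (p # w) = \<pi> [(x, s)] \<otimes>\<^bsub>G\<^esub> \<pi> w" using \<pi>(4)[of "[p]" w] p by simp
    have "\<pi> [(x, s)] = b \<or> (\<exists>i::nat. \<pi> [(x, s)] = a [^]\<^bsub>G\<^esub> i)"
    proof (cases x)
      case Gen_a
      have "a = a [^]\<^bsub>G\<^esub> (1::nat)" by simp
      then show ?thesis using Gen_a inv inv_a \<pi>(1) by (cases s) metis+
    next
      case Gen_b
      then show ?thesis using inv[of Gen_b] \<pi>(2) by (cases s) auto
    qed
    then show ?case unfolding split using S_a[OF Cons] S_b[OF Cons] by auto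
  qed
  moreover obtain w where "g = \<pi> w" using g \<pi>(3) by (metis rangeE)
  ultimately have "g \<in> S" by simp
  then consider i :: nat where "g = a [^]\<^bsub>G\<^esub> i" | i :: nat where "g = a [^]\<^bsub>G\<^esub> i \<otimes>\<^bsub>G\<^esub> b"
    unfolding S_def by blast
  then show ?thesis
  proof cases
    case (1 i)
    then have "g = normal_form (i mod 2 ^ (m + 1), 0)"
      using a_pow_mod[of i] by (simp add: normal_form_def)
    moreover have "i mod 2 ^ (m + 1) < 2 ^ (m + 1)" by simp
    ultimately show ?thesis by (metis pos2)
  next
    case (2 i)
    then have "g = normal_form (i mod 2 ^ (m + 1), 1)"
      using a_pow_mod[of i] by (simp add: normal_form_def)
    moreover have "i mod 2 ^ (m + 1) < 2 ^ (m + 1)" by simp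
    ultimately show ?thesis by (metis one_less_numeral_iff semiring_norm(76))
  qed
qed

section \<open>The right holomorph and cocycles\<close>

text \<open>
  The pair \<open>(\<theta>, v)\<close> stands for the affine map \<open>n \<mapsto> \<theta> n + v\<close>, composed from left to right. A homomorphism
  into this group is the same as a right linear action together with a right cocycle.
\<close>

definition hol :: "('n, 'k) monoid_scheme \<Rightarrow> (('n \<Rightarrow> 'n) \<times> 'n) monoid" where
  "hol N =
     \<lparr>carrier = auto N \<times> carrier N,
      monoid.mult = (\<lambda>(\<theta>, v) (\<theta>', v'). (compose (carrier N) \<theta>' \<theta>, \<theta>' v \<otimes>\<^bsub>N\<^esub> v')),
      one = (\<lambda>x \<in> carrier N. x, \<one>\<^bsub>N\<^esub>)\<rparr>"

lemma carrier_hol [simp]: "carrier (hol N) = auto N \<times> carrier N"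
  by (simp add: hol_def)

lemma mult_hol [simp]:
  "(\<theta>, v) \<otimes>\<^bsub>hol N\<^esub> (\<theta>', v') = (compose (carrier N) \<theta>' \<theta>, \<theta>' v \<otimes>\<^bsub>N\<^esub> v')"
  by (simp add: hol_def)

lemma one_hol: "\<one>\<^bsub>hol N\<^esub> = (\<lambda>x \<in> carrier N. x, \<one>\<^bsub>N\<^esub>)"
  by (simp add: hol_def)

lemma auto_closed: "\<theta> \<in> auto N \<Longrightarrow> x \<in> carrier N \<Longrightarrow> \<theta> x \<in> carrier N"
  unfolding auto_def by (blast intro: hom_in_carrier)

lemma auto_mult:
  "\<theta> \<in> auto N \<Longrightarrow> x \<in> carrier N \<Longrightarrow> y \<in> carrier N \<Longrightarrow> \<theta> (x \<otimes>\<^bsub>N\<^esub> y) = \<theta> x \<otimes>\<^bsub>N\<^esub> \<theta> y"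
  unfolding auto_def by (blast intro: hom_mult)

lemma auto_eqI:
  "\<theta> \<in> auto N \<Longrightarrow> \<theta>' \<in> auto N \<Longrightarrow> (\<And>x. x \<in> carrier N \<Longrightarrow> \<theta> x = \<theta>' x) \<Longrightarrow> \<theta> = \<theta>'"
  unfolding auto_def Bij_def by (auto intro: extensionalityI)

lemma (in group) auto_one: "\<theta> \<in> auto G \<Longrightarrow> \<theta> \<one> = \<one>"
  unfolding auto_def by (blast intro: hom_one is_group)

lemma auto_inj: "\<theta> \<in> auto N \<Longrightarrow> inj_on \<theta> (carrier N)"
  unfolding auto_def Bij_def by (auto simp: bij_betw_def)

lemma (in group) auto_compose: "\<theta> \<in> auto G \<Longrightarrow> \<theta>' \<in> auto G \<Longrightarrow> compose (carrier G) \<theta> \<theta>' \<in> auto G"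
  unfolding auto_def by (auto simp: hom_compose compose_Bij)

lemma (in group) auto_inverse:
  assumes "\<theta> \<in> auto G"
  shows "\<exists>\<theta>' \<in> auto G. (\<forall>x \<in> carrier G. \<theta> (\<theta>' x) = x) \<and> (\<forall>x \<in> carrier G. \<theta>' (\<theta> x) = x)"
proof
  let ?i = "restrict (inv_into (carrier G) \<theta>) (carrier G)"
  have \<theta>: "\<theta> \<in> hom G G" "\<theta> \<in> Bij (carrier G)" using assms by (auto simp: auto_def)
  then show "?i \<in> auto G"
    using restrict_inv_into_hom restrict_inv_into_Bij by (auto simp: auto_def)
  have bij: "bij_betw \<theta> (carrier G) (carrier G)" using \<theta> by (simp add: Bij_def)
  show "(\<forall>x \<in> carrier G. \<theta> (?i x) = x) \<and> (\<forall>x \<in> carrier G. ?i (\<theta> x) = x)"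
    using bij bij_betw_inv_into_right[OF bij] bij_betw_inv_into_left[OF bij]
    by (auto simp: bij_betw_apply)
qed

lemma (in group) group_hol: "group (hol G)"
proof (rule groupI)
  show "x \<otimes>\<^bsub>hol G\<^esub> y \<in> carrier (hol G)" if "x \<in> carrier (hol G)" "y \<in> carrier (hol G)" for x y
    using that by (cases x; cases y) (auto simp: auto_compose auto_closed)
  show "\<one>\<^bsub>hol G\<^esub> \<in> carrier (hol G)" by (simp add: one_hol id_in_auto)
  show "x \<otimes>\<^bsub>hol G\<^esub> y \<otimes>\<^bsub>hol G\<^esub> z = x \<otimes>\<^bsub>hol G\<^esub> (y \<otimes>\<^bsub>hol G\<^esub> z)"
    if "x \<in> carrier (hol G)" "y \<in> carrier (hol G)" "z \<in> carrier (hol G)" for x y z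
    using that
    by (cases x; cases y; cases z)
      (auto simp: auto_closed auto_mult m_assoc compose_eq Bij_imp_funcset auto_def compose_assoc)
  show "\<one>\<^bsub>hol G\<^esub> \<otimes>\<^bsub>hol G\<^esub> x = x" if "x \<in> carrier (hol G)" for x
  proof -
    obtain \<theta> v where x: "x = (\<theta>, v)" "\<theta> \<in> auto G" "v \<in> carrier G" using \<open>x \<in> _\<close> by auto
    have "compose (carrier G) \<theta> (\<lambda>x \<in> carrier G. x) = \<theta>"
      using x(2) by (auto simp: auto_def Bij_def extensional_def compose_def fun_eq_iff)
    then show ?thesis using x auto_one[OF x(2)] by (simp add: one_hol)
  qed
  show "\<exists>y \<in> carrier (hol G). y \<otimes>\<^bsub>hol G\<^esub> x = \<one>\<^bsub>hol G\<^esub>" if "x \<in> carrier (hol G)" for x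
  proof -
    obtain \<theta> v where x: "x = (\<theta>, v)" "\<theta> \<in> auto G" "v \<in> carrier G" using \<open>x \<in> _\<close> by auto
    obtain \<theta>' where \<theta>': "\<theta>' \<in> auto G" "\<forall>x \<in> carrier G. \<theta> (\<theta>' x) = x" "\<forall>x \<in> carrier G. \<theta>' (\<theta> x) = x"
      using auto_inverse[OF x(2)] by blast
    have "compose (carrier G) \<theta> \<theta>' = (\<lambda>x \<in> carrier G. x)"
      using \<theta>' by (auto simp: compose_def fun_eq_iff)
    then have "(\<theta>', \<theta>' (inv v)) \<otimes>\<^bsub>hol G\<^esub> x = \<one>\<^bsub>hol G\<^esub>"
      using \<theta>' x by (simp add: one_hol)
    moreover have "(\<theta>', \<theta>' (inv v)) \<in> carrier (hol G)"
      using \<theta>'(1) x auto_closed[OF \<theta>'(1)] by simp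
    ultimately show ?thesis by blast
  qed
qed

section \<open>Braces from homomorphisms into the holomorph\<close>

lemma hom_hol_action:
  assumes "group G" "comm_group N" and h: "h \<in> hom G (hol N)"
  shows "right_linear_action G N (\<lambda>g. fst (h g))"
    and "right_cocycle G N (\<lambda>g. fst (h g)) (\<lambda>g. snd (h g))"
proof -
  interpret N: comm_group N by fact
  have cl: "h g \<in> auto N \<times> carrier N" if "g \<in> carrier G" for g
    using hom_in_carrier[OF h that] by simp
  have mult: "h (g \<otimes>\<^bsub>G\<^esub> k) = (compose (carrier N) (fst (h k)) (fst (h g)),
      fst (h k) (snd (h g)) \<otimes>\<^bsub>N\<^esub> snd (h k))" if "g \<in> carrier G" "k \<in> carrier G" for g k
    using hom_mult[OF h that] by (cases "h g"; cases "h k") simp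
  have cl': "fst (h g) \<in> auto N" "snd (h g) \<in> carrier N" if "g \<in> carrier G" for g
    using cl[OF that] by auto
  have "fst (h g) \<in> Bij (carrier N)" if "g \<in> carrier G" for g
    using cl'(1)[OF that] by (simp add: auto_def)
  then show "right_linear_action G N (\<lambda>g. fst (h g))"
    using assms(1,2) cl' mult
    by (auto simp: right_linear_action_def AutoGroup_def BijGroup_def)
  show "right_cocycle G N (\<lambda>g. fst (h g)) (\<lambda>g. snd (h g))"
    using cl' mult by (auto simp: right_cocycle_def)
qed

text \<open>After applying \<open>\<gamma>\<close> both sides of the brace law become rho_a(\<gamma>
  b) + rho_a(\<gamma> c) + 2 \<gamma>(a).\<close>

lemma cocycle_brace_brace:
  assumes act: "right_linear_action G N \<rho>" and coc: "right_cocycle G N \<rho> \<gamma>"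
    and bij: "bij_betw \<gamma> (carrier G) (carrier N)"
  shows "brace (cocycle_brace G N \<gamma>)"
proof -
  interpret G: group G using act by (simp add: right_linear_action_def)
  interpret N: comm_group N using act by (simp add: right_linear_action_def)
  let ?B = "cocycle_brace G N \<gamma>" let ?i = "inv_into (carrier G) \<gamma>"
  have i_cl [simp]: "?i v \<in> carrier G" if "v \<in> carrier N" for v
    using bij that bij_betw_apply bij_betw_inv_into by metis
  have gi [simp]: "\<gamma> (?i v) = v" if "v \<in> carrier N" for v
    using bij_betw_inv_into_right[OF bij that] .
  have ig [simp]: "?i (\<gamma> g) = g" if "g \<in> carrier G" for g
    using bij_betw_inv_into_left[OF bij that] .
  have g_cl [simp]: "\<gamma> g \<in> carrier N" if "g \<in> carrier G" for g
    using bij that by (rule bij_betw_apply)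
  have simps [simp]: "carrier ?B = carrier G" "monoid.mult ?B = monoid.mult G" "one ?B = one G"
    "zero ?B = ?i \<one>\<^bsub>N\<^esub>" "\<And>g h. g \<oplus>\<^bsub>?B\<^esub> h = ?i (\<gamma> g \<otimes>\<^bsub>N\<^esub> \<gamma> h)"
    by (simp_all add: cocycle_brace_def)
  have "abelian_group ?B"
  proof (rule abelian_groupI)
    fix x assume "x \<in> carrier ?B"
    then show "\<exists>y \<in> carrier ?B. y \<oplus>\<^bsub>?B\<^esub> x = \<zero>\<^bsub>?B\<^esub>"
      by (intro bexI[of _ "?i (inv\<^bsub>N\<^esub> (\<gamma> x))"]) simp_all
  qed (simp_all add: N.m_ac)
  moreover have "group (adjoint_group ?B)"
    by (rule groupI)
      (auto simp: adjoint_group_def G.m_assoc intro: G.l_inv_ex)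
  moreover have "(b \<oplus>\<^bsub>?B\<^esub> c) \<otimes>\<^bsub>?B\<^esub> a \<oplus>\<^bsub>?B\<^esub> a = b \<otimes>\<^bsub>?B\<^esub> a \<oplus>\<^bsub>?B\<^esub> c \<otimes>\<^bsub>?B\<^esub> a"
    if abc: "a \<in> carrier ?B" "b \<in> carrier ?B" "c \<in> carrier ?B" for a b c
  proof -
    have \<gamma>: "\<gamma> (g \<otimes>\<^bsub>G\<^esub> h) = \<rho> h (\<gamma> g) \<otimes>\<^bsub>N\<^esub> \<gamma> h" if "g \<in> carrier G" "h \<in> carrier G" for g h
      using coc that by (simp add: right_cocycle_def)
    have \<rho>: "\<rho> a \<in> auto N"
      using act abc(1) by (auto simp: right_linear_action_def AutoGroup_def)
    have "\<gamma> (?i (\<gamma> b \<otimes>\<^bsub>N\<^esub> \<gamma> c) \<otimes>\<^bsub>G\<^esub> a) \<otimes>\<^bsub>N\<^esub> \<gamma> a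
        = \<gamma> (b \<otimes>\<^bsub>G\<^esub> a) \<otimes>\<^bsub>N\<^esub> \<gamma> (c \<otimes>\<^bsub>G\<^esub> a)"
      using abc by (simp add: \<gamma> auto_mult[OF \<rho>] auto_closed[OF \<rho>] N.m_ac)
    then show ?thesis by simp
  qed
  ultimately show ?thesis by (simp add: brace_def brace_axioms_def)
qed

lemma adjoint_group_cocycle_brace: "adjoint_group (cocycle_brace G N \<gamma>) = G"
  by (simp add: adjoint_group_def cocycle_brace_def)

text \<open>A cocycle is no homomorphism, but \<gamma>(g) = rho_k(\<gamma>(g k^-1)) + \<gamma>(k)
  with rho_k injective. Injectivity of \<gamma> thus reduces to a trivial zero set.\<close>

lemma snd_hom_hol_cancel:
  assumes "group G" "comm_group N" and h: "h \<in> hom G (hol N)"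
    and g: "g \<in> carrier G" and k: "k \<in> carrier G" and eq: "snd (h g) = snd (h k)"
  shows "snd (h (g \<otimes>\<^bsub>G\<^esub> inv\<^bsub>G\<^esub> k)) = \<one>\<^bsub>N\<^esub>"
proof -
  interpret G: group G by fact
  interpret N: comm_group N by fact
  let ?d = "g \<otimes>\<^bsub>G\<^esub> inv\<^bsub>G\<^esub> k"
  have d: "?d \<in> carrier G" using g k by simp
  have cl: "fst (h k) \<in> auto N" "snd (h k) \<in> carrier N" "snd (h ?d) \<in> carrier N"
    using hom_in_carrier[OF h k] hom_in_carrier[OF h d] by auto
  have "?d \<otimes>\<^bsub>G\<^esub> k = g" using g k by (simp add: G.m_assoc)
  then have "snd (h g) = fst (h k) (snd (h ?d)) \<otimes>\<^bsub>N\<^esub> snd (h k)"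
    using hom_mult[OF h d k] by (cases "h ?d"; cases "h k") simp
  then have "fst (h k) (snd (h ?d)) = fst (h k) \<one>\<^bsub>N\<^esub>"
    using cl eq N.auto_one[OF cl(1)] by (simp add: auto_closed)
  then show ?thesis using inj_onD[OF auto_inj[OF cl(1)]] cl(3) by blast
qed

lemma snd_hom_hol_one:
  assumes "group G" "comm_group N" "h \<in> hom G (hol N)"
  shows "snd (h \<one>\<^bsub>G\<^esub>) = \<one>\<^bsub>N\<^esub>"
  using hom_one[OF assms(3,1)] group.group_hol[of N] assms(2) by (simp add: one_hol comm_group_def)

section \<open>Involutions and the zeros of a cocycle\<close>

context modular_relations
begin

lemma a_pow_half: "2 ^ m dvd i \<Longrightarrow> a [^] (i :: nat) = \<one> \<or> a [^] i = a [^] (2 ^ m :: nat)"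
proof -
  assume "2 ^ m dvd i"
  then obtain t where t: "i = 2 ^ m * t" by blast
  have "i mod 2 ^ (m + 1) = 2 ^ m * (t mod 2) mod 2 ^ (m + 1)"
    unfolding t mult_mod_right by (simp only: power_add power_one_right mod_mod_trivial)
  then have "a [^] i = a [^] (2 ^ m * (t mod 2))" by (rule a_pow_cong)
  moreover have "t mod 2 = 0 \<or> t mod 2 = 1" by auto
  ultimately show ?thesis by auto
qed

text \<open>The number i (2 + 2^m) is the exponent of a in the square of a^i b. It equals 2 i (1 +
  2^(m-1)), whose last factor is odd once m >= 2.\<close>

lemma dvd_if_square_trivial:
  fixes i :: nat
  assumes m: "2 \<le> m" and dvd: "2 ^ (m + 1) dvd i * (2 + 2 ^ m)"
  shows "2 ^ m dvd i"
proof -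
  obtain t where t: "i * (2 + 2 ^ m) = 2 ^ (m + 1) * t" using dvd by (elim dvdE)
  have "2 * (i * (1 + 2 ^ (m - 1))) = i * (2 + 2 ^ m)"
    using m power_Suc[of "2::nat" "m - 1"] by (simp add: algebra_simps)
  also have "\<dots> = 2 * (2 ^ m * t)" unfolding t by simp
  finally have "i * (1 + 2 ^ (m - 1)) = 2 ^ m * t" by linarith
  then have "2 ^ m dvd i * (1 + 2 ^ (m - 1))" by (rule dvdI)
  moreover have "coprime (2 ^ m) (1 + 2 ^ (m - 1) :: nat)"
    using m by simp
  ultimately show ?thesis by (simp only: coprime_dvd_mult_left_iff)
qed

lemma involution_cases:
  assumes m: "2 \<le> m" and order: "\<And>i::nat. a [^] i = \<one> \<Longrightarrow> 2 ^ (m + 1) dvd i"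
    and g: "g = normal_form (i, j)" "j < 2" and sq: "g \<otimes> g = \<one>"
  shows "g \<in> {\<one>, a [^] (2 ^ m :: nat), b, a [^] (2 ^ m :: nat) \<otimes> b}"
proof -
  consider "j = 0" | "j = 1" using g(2) by linarith
  then show ?thesis
  proof cases
    case 1
    then have g': "g = a [^] i" using g by (simp add: normal_form_def)
    then have "2 ^ (m + 1) dvd i + i" using sq order by (simp only: nat_pow_mult a_closed)
    then have "2 ^ m dvd i" by (simp flip: mult_2)
    then show ?thesis using a_pow_half g' by auto
  next
    case 2
    then have g': "g = a [^] i \<otimes> b" using g by (simp add: normal_form_def)
    then have "2 ^ (m + 1) dvd i * (2 + 2 ^ m)" using sq order square_pow_b by metis
    then have "2 ^ m dvd i" by (rule dvd_if_square_trivial[OF m])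
    then show ?thesis using a_pow_half g' by force
  qed
qed

text \<open>In a 2-group every nontrivial element has a power that is an involution, so a subgroup
  that misses the involutions is trivial. The conclusion speaks of exponents instead of the element:
  this way it also delivers the order of a and the uniqueness of normal forms, which are not
  assumed.\<close>

lemma normal_form_trivial:
  assumes m: "2 \<le> m" and K: "\<one> \<in> K" "\<And>x y. x \<in> K \<Longrightarrow> y \<in> K \<Longrightarrow> x \<otimes> y \<in> K"
    and notin: "a [^] (2 ^ m :: nat) \<notin> K" "b \<notin> K" "a [^] (2 ^ m :: nat) \<otimes> b \<notin> K"
    and nf: "normal_form (i, j) \<in> K" and j: "j < 2"
  shows "j = 0 \<and> 2 ^ (m + 1) dvd i"
proof -
  have pow: "x [^] (k::nat) \<in> K" if "x \<in> K" for x k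
    using that K by (induction k) auto
  have dvd: "2 ^ (m + 1) dvd i" if "a [^] i \<in> K" for i :: nat
  proof (rule ccontr)
    assume nd: "\<not> 2 ^ (m + 1) dvd i"
    then have "i \<noteq> 0" by (metis dvd_0_right)
    then obtain k r where kr: "i = 2 ^ k * r" "odd r"
      by (rule multiplicity_decompose'[of i 2]) auto
    have "k \<le> m"
      using nd kr(1) by (metis Suc_eq_plus1 dvd_trans dvd_triv_left le_imp_power_dvd not_less_eq_eq)
    \<comment> \<open>The power is chosen to complete the factor 2^k of i to 2^m; the odd factor r
      then has no effect, because a^(2^m) squares to 1.\<close>
    then have "(a [^] i) [^] (2 ^ (m - k) :: nat) = a [^] (2 ^ m * r)"
      by (simp add: nat_pow_pow kr(1) mult_ac flip: power_add)
    also have "\<dots> = a [^] (2 ^ m :: nat)"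
    proof (rule a_pow_cong)
      obtain t where "r = 2 * t + 1" using kr(2) oddE by blast
      then have "2 ^ m * r = 2 ^ m + 2 ^ (m + 1) * t" by (simp add: algebra_simps)
      then show "2 ^ m * r mod 2 ^ (m + 1) = 2 ^ m mod 2 ^ (m + 1)" by (simp only: mod_mult_self2)
    qed
    finally show False using pow[OF that] notin(1) by metis
  qed
  consider "j = 0" | "j = 1" using j by linarith
  then show ?thesis
  proof cases
    case 1
    then show ?thesis using nf dvd by (simp add: normal_form_def)
  next
    case 2
    then have mem: "a [^] i \<otimes> b \<in> K" using nf by (simp add: normal_form_def)
    then have "2 ^ (m + 1) dvd i * (2 + 2 ^ m)" using K(2) square_pow_b dvd by metis
    then have "2 ^ m dvd i" by (rule dvd_if_square_trivial[OF m])
    then have "a [^] i = \<one> \<or> a [^] i = a [^] (2 ^ m :: nat)" by (rule a_pow_half)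
    then show ?thesis using mem notin by auto
  qed
qed

text \<open>Exponents are natural numbers, so the inverse of a^i' is written with exponent 2^(m+1) -
  i'. When j and j' differ, that power has to pass b and picks up the factor 1 + 2^m.\<close>

lemma normal_form_diff:
  assumes "i' \<le> 2 ^ (m + 1)" "j < 2" "j' < 2"
  shows "normal_form (i, j) \<otimes> inv (normal_form (i', j')) =
    (if j = j' then normal_form (i + (2 ^ (m + 1) - i'), 0)
     else normal_form (i + (2 ^ (m + 1) - i') * (1 + 2 ^ m), 1))"
proof -
  have inv: "inv (a [^] i') = a [^] (2 ^ (m + 1) - i')"
  proof (rule inv_equality)
    have "a [^] (2 ^ (m + 1) - i') \<otimes> a [^] i' = a [^] (2 ^ (m + 1) - i' + i')"
      by (simp only: nat_pow_mult a_closed)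
    then show "a [^] (2 ^ (m + 1) - i') \<otimes> a [^] i' = \<one>" using assms(1) a_pow by simp
  qed auto
  have cases: "(j = 0 \<or> j = 1) \<and> (j' = 0 \<or> j' = 1)" using assms by auto
  let ?c = "a [^] (2 ^ (m + 1) - i')"
  have 1: "(a [^] i \<otimes> b) \<otimes> ?c = normal_form (i + (2 ^ (m + 1) - i') * (1 + 2 ^ m), 1)"
  proof -
    have "(a [^] i \<otimes> b) \<otimes> ?c = a [^] i \<otimes> (b \<otimes> ?c)" by (simp only: m_assoc a_closed b_closed nat_pow_closed)
    also have "\<dots> = a [^] i \<otimes> a [^] ((2 ^ (m + 1) - i') * (1 + 2 ^ m)) \<otimes> b"
      unfolding b_a_pow by (simp only: m_assoc a_closed b_closed nat_pow_closed)
    finally show ?thesis by (simp add: normal_form_def nat_pow_mult)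
  qed
  have 2: "(a [^] i \<otimes> b) \<otimes> (b \<otimes> ?c) = a [^] i \<otimes> ?c"
  proof -
    have "(a [^] i \<otimes> b) \<otimes> (b \<otimes> ?c) = a [^] i \<otimes> (b \<otimes> b) \<otimes> ?c"
      by (simp only: m_assoc a_closed b_closed nat_pow_closed m_closed)
    then show ?thesis by (simp add: b_sq)
  qed
  have 3: "a [^] i \<otimes> (b \<otimes> ?c) = (a [^] i \<otimes> b) \<otimes> ?c"
    by (simp only: m_assoc a_closed b_closed nat_pow_closed)
  have 4: "a [^] i \<otimes> ?c = normal_form (i + (2 ^ (m + 1) - i'), 0)"
    by (simp add: normal_form_def nat_pow_mult)
  have nf: "normal_form (k, 0) = a [^] k" "normal_form (k, 1) = a [^] k \<otimes> b" for k
    by (simp_all add: normal_form_def)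
  have inv1: "inv (a [^] i' \<otimes> b) = b \<otimes> ?c" by (simp add: inv_mult_group inv)
  show ?thesis
    using cases by (elim conjE disjE) (simp_all only: nf inv inv1 1 2 3 4 if_True if_False simp_thms zero_neq_one one_neq_zero)
qed

end

text \<open>The zero set of a cocycle is closed under products because automorphisms fix 0, so it
  can serve as the set K of \<open>normal_form_trivial\<close>.\<close>

lemma snd_hom_hol_trivial:
  assumes m: "2 \<le> m" and rel: "modular_relations G m a b" and N: "comm_group N"
    and h: "h \<in> hom G (hol N)"
    and ne: "snd (h (a [^]\<^bsub>G\<^esub> (2 ^ m :: nat))) \<noteq> \<one>\<^bsub>N\<^esub>" "snd (h b) \<noteq> \<one>\<^bsub>N\<^esub>"
      "snd (h (a [^]\<^bsub>G\<^esub> (2 ^ m :: nat) \<otimes>\<^bsub>G\<^esub> b)) \<noteq> \<one>\<^bsub>N\<^esub>"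
    and nf: "snd (h (modular_relations.normal_form G a b (i, j))) = \<one>\<^bsub>N\<^esub>" and j: "j < 2"
  shows "j = 0 \<and> 2 ^ (m + 1) dvd i"
proof -
  interpret modular_relations G m a b by fact
  interpret N: comm_group N by fact
  let ?\<gamma> = "\<lambda>g. snd (h g)"
  define K where "K = {g \<in> carrier G. ?\<gamma> g = \<one>\<^bsub>N\<^esub>}"
  have coc: "?\<gamma> (g \<otimes>\<^bsub>G\<^esub> k) = fst (h k) (?\<gamma> g) \<otimes>\<^bsub>N\<^esub> ?\<gamma> k" "fst (h k) \<in> auto N"
    if "g \<in> carrier G" "k \<in> carrier G" for g k
    using hom_mult[OF h that] hom_in_carrier[OF h that(1)] hom_in_carrier[OF h that(2)]
    by (cases "h g"; cases "h k"; simp)+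
  have K: "\<one>\<^bsub>G\<^esub> \<in> K" "\<And>x y. x \<in> K \<Longrightarrow> y \<in> K \<Longrightarrow> x \<otimes>\<^bsub>G\<^esub> y \<in> K"
    using snd_hom_hol_one[OF is_group N h] coc(1) N.auto_one[OF coc(2)] by (auto simp: K_def)
  have "normal_form (i, j) \<in> K" using nf by (simp add: K_def normal_form_def)
  from normal_form_trivial[OF m K _ _ _ this j] ne show ?thesis by (simp add: K_def)
qed

text \<open>The order of G is not known at this point, so the count runs over exponent pairs: there
  are 2^(m+2) of them, as many as elements of N, and the cocycle separates them. Surjectivity
  follows by counting, and injectivity on G because the pairs exhaust G.\<close>

lemma snd_hom_hol_bij:
  assumes m: "2 \<le> m" and gens: "M_generators m G a b" and N: "comm_group N"
    and h: "h \<in> hom G (hol N)" and card: "card (carrier N) = 2 ^ (m + 2)"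
    and ne: "snd (h (a [^]\<^bsub>G\<^esub> (2 ^ m :: nat))) \<noteq> \<one>\<^bsub>N\<^esub>" "snd (h b) \<noteq> \<one>\<^bsub>N\<^esub>"
      "snd (h (a [^]\<^bsub>G\<^esub> (2 ^ m :: nat) \<otimes>\<^bsub>G\<^esub> b)) \<noteq> \<one>\<^bsub>N\<^esub>"
  shows "bij_betw (\<lambda>g. snd (h g)) (carrier G) (carrier N)"
proof -
  interpret modular_relations G m a b by (rule M_generators_relations[OF gens])
  interpret N: comm_group N by fact
  let ?\<gamma> = "\<lambda>g. snd (h g)"
  let ?I = "{..<2 ^ (m + 1)} \<times> {..<2 :: nat}"
  have cl: "?\<gamma> g \<in> carrier N" if "g \<in> carrier G" for g
    using hom_in_carrier[OF h that] by auto
  have nf_closed: "normal_form p \<in> carrier G" for p by (cases p) (simp add: normal_form_def)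
  have triv: "j = 0 \<and> 2 ^ (m + 1) dvd i" if "?\<gamma> (normal_form (i, j)) = \<one>\<^bsub>N\<^esub>" "j < 2" for i j
    using snd_hom_hol_trivial[OF m modular_relations_axioms N h ne that] .
  have inj: "inj_on (\<lambda>p. ?\<gamma> (normal_form p)) ?I"
  proof (rule inj_onI)
    fix p p' assume p: "p \<in> ?I" "p' \<in> ?I" and eq: "?\<gamma> (normal_form p) = ?\<gamma> (normal_form p')"
    obtain i j i' j' where ij: "p = (i, j)" "p' = (i', j')" by (cases p; cases p')
    have lt: "i < 2 ^ (m + 1)" "j < 2" "i' < 2 ^ (m + 1)" "j' < 2" using p ij by auto
    have "?\<gamma> (normal_form (i, j) \<otimes>\<^bsub>G\<^esub> inv\<^bsub>G\<^esub> (normal_form (i', j'))) = \<one>\<^bsub>N\<^esub>"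
      using snd_hom_hol_cancel[OF is_group N h nf_closed nf_closed eq] ij by simp
    then have mem: "?\<gamma> (if j = j' then normal_form (i + (2 ^ (m + 1) - i'), 0)
        else normal_form (i + (2 ^ (m + 1) - i') * (1 + 2 ^ m), 1)) = \<one>\<^bsub>N\<^esub>"
      using normal_form_diff[of i' j j' i] lt by simp
    have "j = j'"
    proof (rule ccontr)
      assume "j \<noteq> j'"
      then show False using mem triv[of _ 1] by auto
    qed
    then have "2 ^ (m + 1) dvd i + (2 ^ (m + 1) - i')" using mem triv[of _ 0] by auto
    then have "int (2 ^ (m + 1)) dvd int (i + (2 ^ (m + 1) - i'))"
      by (simp only: of_nat_dvd_iff)
    moreover have "int (i + (2 ^ (m + 1) - i')) = (int i - int i') + int (2 ^ (m + 1))"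
      using lt(3) by (simp only: of_nat_add of_nat_diff[OF less_imp_le])
    moreover have "int (2 ^ (m + 1)) = 2 ^ (m + 1)" by simp
    ultimately have "(2 ^ (m + 1) :: int) dvd int i - int i'"
      by (simp only: dvd_add_left_iff[OF dvd_refl])
    then have "int i mod 2 ^ (m + 1) = int i' mod 2 ^ (m + 1)" by (simp add: mod_eq_dvd_iff)
    moreover have "int i < 2 ^ (m + 1)" "int i' < 2 ^ (m + 1)"
      using lt of_nat_less_iff[of i "2 ^ (m + 1)", where 'a = int]
        of_nat_less_iff[of i' "2 ^ (m + 1)", where 'a = int] by simp_all
    ultimately have "i = i'" by simp
    with \<open>j = j'\<close> ij show "p = p'" by simp
  qed
  have G_eq: "carrier G = normal_form ` ?I"
    using nf_closed M_generators_normal_form[OF gens] by (fastforce simp: image_iff)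
  have fin: "finite (carrier N)" using card by (metis card.infinite power_not_zero zero_neq_numeral)
  have "(\<lambda>p. ?\<gamma> (normal_form p)) ` ?I \<subseteq> carrier N"
    using cl[OF nf_closed] by blast
  moreover have "card ((\<lambda>p. ?\<gamma> (normal_form p)) ` ?I) = card (carrier N)"
    using card_image[OF inj] card by (simp add: card_cartesian_product)
  ultimately have "(\<lambda>p. ?\<gamma> (normal_form p)) ` ?I = carrier N"
    using fin by (intro card_subset_eq)
  then have "?\<gamma> ` carrier G = carrier N" unfolding G_eq by (simp add: image_image)
  moreover have "inj_on ?\<gamma> (carrier G)"
    unfolding G_eq using inj by (auto simp: inj_on_def)
  ultimately show ?thesis by (simp add: bij_betw_def)
qed

section \<open>From a brace to the holomorph\<close>

context brace
begin

lemma one_in [simp]: "\<one> \<in> carrier A"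
  and mult_closed [simp]: "x \<in> carrier A \<Longrightarrow> y \<in> carrier A \<Longrightarrow> x \<otimes> y \<in> carrier A"
  and mult_assoc: "x \<in> carrier A \<Longrightarrow> y \<in> carrier A \<Longrightarrow> z \<in> carrier A \<Longrightarrow>
    x \<otimes> y \<otimes> z = x \<otimes> (y \<otimes> z)"
  using monoid.one_closed[OF group.is_monoid[OF adjoint_group]]
    monoid.m_closed[OF group.is_monoid[OF adjoint_group]]
    monoid.m_assoc[OF group.is_monoid[OF adjoint_group]]
  by (simp_all add: adjoint_group_def)

lemma mult_right_inverse:
  assumes "x \<in> carrier A"
  shows "\<exists>y \<in> carrier A. x \<otimes> y = \<one> \<and> (\<forall>z \<in> carrier A. z \<otimes> x \<otimes> y = z) \<and> (\<forall>z \<in> carrier A. z \<otimes> y \<otimes> x = z)"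
proof -
  interpret g: group "adjoint_group A" by (rule adjoint_group)
  have x: "x \<in> carrier (adjoint_group A)" using assms by (simp add: adjoint_group_def)
  let ?y = "inv\<^bsub>adjoint_group A\<^esub> x"
  have "?y \<in> carrier A" using g.inv_closed[OF x] by (simp add: adjoint_group_def)
  moreover have "x \<otimes> ?y = \<one>" "?y \<otimes> x = \<one>"
    using g.r_inv[OF x] g.l_inv[OF x] by (simp_all add: adjoint_group_def)
  moreover have "z \<otimes> \<one> = z" if "z \<in> carrier A" for z
    using g.r_one that by (simp add: adjoint_group_def)
  ultimately show ?thesis using assms by (intro bexI[of _ ?y]) (auto simp: mult_assoc)
qed

definition rho :: "'a \<Rightarrow> 'a \<Rightarrow> 'a" where
  "rho a = (\<lambda>b \<in> carrier A. b \<otimes> a \<ominus> a)"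

lemma rho_add:
  assumes "a \<in> carrier A" "b \<in> carrier A" "c \<in> carrier A"
  shows "rho a (b \<oplus> c) = rho a b \<oplus> rho a c"
proof -
  have "(b \<oplus> c) \<otimes> a = (b \<oplus> c) \<otimes> a \<oplus> a \<ominus> a"
    using assms by (simp add: minus_eq a_assoc r_neg)
  also have "\<dots> = b \<otimes> a \<oplus> c \<otimes> a \<ominus> a" using compat assms by simp
  finally show ?thesis using assms by (simp add: rho_def minus_eq a_ac)
qed

lemma rho_mult: "a \<in> carrier A \<Longrightarrow> b \<in> carrier A \<Longrightarrow> b \<otimes> a = rho a b \<oplus> a"
  by (simp add: rho_def minus_eq a_assoc l_neg)

lemma rho_closed [simp]: "a \<in> carrier A \<Longrightarrow> b \<in> carrier A \<Longrightarrow> rho a b \<in> carrier A"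
  by (simp add: rho_def)

lemma rho_compose:
  assumes "a \<in> carrier A" "b \<in> carrier A" "x \<in> carrier A"
  shows "rho (a \<otimes> b) x = rho b (rho a x)"
proof -
  have "rho (a \<otimes> b) x \<oplus> a \<otimes> b = (x \<otimes> a) \<otimes> b"
    using assms by (simp add: rho_mult[symmetric] mult_assoc)
  also have "\<dots> = rho b (rho a x \<oplus> a) \<oplus> b"
    using assms rho_mult[of b "x \<otimes> a"] rho_mult[of a x] by simp
  also have "\<dots> = rho b (rho a x) \<oplus> (rho b a \<oplus> b)" using assms by (simp add: rho_add a_assoc)
  also have "\<dots> = rho b (rho a x) \<oplus> a \<otimes> b" using assms by (simp add: rho_mult)
  finally show ?thesis using assms by simp
qed

lemma rho_one: "x \<in> carrier A \<Longrightarrow> rho \<one> x = x"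
proof -
  assume x: "x \<in> carrier A"
  interpret g: group "adjoint_group A" by (rule adjoint_group)
  have one: "z \<otimes> \<one> = z" if "z \<in> carrier A" for z
    using g.r_one that by (simp add: adjoint_group_def)
  \<comment> \<open>The brace law with the multiplier 1 and both summands 0 reads 0 + 1 = 0 +
    0.\<close>
  have "\<one> = \<zero>" using compat[of \<one> \<zero> \<zero>] one by simp
  then show ?thesis using x one rho_mult[of \<one> x] by simp
qed

lemma rho_auto: "a \<in> carrier A \<Longrightarrow> rho a \<in> auto (add_monoid A)"
proof -
  assume a: "a \<in> carrier A"
  obtain y where y: "y \<in> carrier A" "a \<otimes> y = \<one>" "\<And>z. z \<in> carrier A \<Longrightarrow> z \<otimes> y \<otimes> a = z"
    using mult_right_inverse[OF a] by blast
  have ya: "y \<otimes> a = \<one>"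
  proof -
    interpret g: group "adjoint_group A" by (rule adjoint_group)
    have "\<one> \<otimes> y = y" using g.l_one[of y] y by (simp add: adjoint_group_def)
    then show ?thesis using y(3)[of \<one>] by simp
  qed
  have "bij_betw (rho a) (carrier A) (carrier A)"
    by (rule bij_betw_byWitness[where f' = "rho y"])
      (use a y ya rho_compose[of a y] rho_compose[of y a] rho_one in auto)
  moreover have "rho a \<in> extensional (carrier A)" by (simp add: rho_def)
  ultimately show ?thesis using a by (simp add: auto_def Bij_def hom_def rho_add)
qed

end

lemma brace_rho_eq: "brace A \<Longrightarrow> brace_rho A = brace.rho A"
  by (simp add: fun_eq_iff brace_rho_def brace.rho_def)

text \<open>Right circle multiplication by g is the affine map x -> rho_g(x) + g. Carried over to N,
  these maps turn the relations between a and b into equations in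
  \<open>hol (N_group m)\<close>.\<close>

lemma transported_hom:
  assumes "brace A" and \<gamma>: "\<gamma> \<in> iso (add_monoid A) (N_group m)" and N: "comm_group (N_group m)"
  shows "(\<lambda>g. (transported_rho m A \<gamma> g, \<gamma> g)) \<in> hom (adjoint_group A) (hol (N_group m))"
proof -
  interpret brace A by fact
  interpret N: comm_group "N_group m" by fact
  let ?N = "N_group m" and ?i = "inv_into (carrier A) \<gamma>" and ?T = "transported_rho m A \<gamma>"
  have bij: "bij_betw \<gamma> (carrier A) (carrier ?N)" using \<gamma> by (simp add: iso_def)
  have \<gamma>_add: "\<gamma> (x \<oplus>\<^bsub>A\<^esub> y) = \<gamma> x \<otimes>\<^bsub>?N\<^esub> \<gamma> y" if "x \<in> carrier A" "y \<in> carrier A" for x y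
    using \<gamma> that by (auto simp: iso_def hom_def)
  have [simp]: "?i v \<in> carrier A" "\<gamma> (?i v) = v" if "v \<in> carrier ?N" for v
    using bij_betw_inv_into_right[OF bij that] bij_betw_apply[OF bij_betw_inv_into[OF bij] that] by auto
  have [simp]: "?i (\<gamma> g) = g" "\<gamma> g \<in> carrier ?N" if "g \<in> carrier A" for g
    using bij_betw_inv_into_left[OF bij that] bij_betw_apply[OF bij that] by auto
  have i_mult: "?i (u \<otimes>\<^bsub>?N\<^esub> v) = ?i u \<oplus>\<^bsub>A\<^esub> ?i v" if "u \<in> carrier ?N" "v \<in> carrier ?N" for u v
    using that \<gamma>_add[of "?i u" "?i v"] by (metis \<open>\<And>v. v \<in> carrier ?N \<Longrightarrow> ?i v \<in> carrier A\<close>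
      \<open>\<And>v. v \<in> carrier ?N \<Longrightarrow> \<gamma> (?i v) = v\<close> \<open>\<And>g. g \<in> carrier A \<Longrightarrow> ?i (\<gamma> g) = g\<close> add.m_closed)
  have T: "?T a v = \<gamma> (rho a (?i v))" if "v \<in> carrier ?N" for a v
    using that by (simp add: transported_rho_def brace_rho_eq[OF assms(1)])
  have T_ext: "?T a \<in> extensional (carrier ?N)" for a by (simp add: transported_rho_def)
  have T_auto: "?T a \<in> auto ?N" if a: "a \<in> carrier A" for a
  proof -
    have r: "bij_betw (rho a) (carrier A) (carrier A)"
      using rho_auto[OF a] by (simp add: auto_def Bij_def)
    have "bij_betw (\<gamma> \<circ> (rho a \<circ> ?i)) (carrier ?N) (carrier ?N)"
      using bij_betw_trans[OF bij_betw_trans[OF bij_betw_inv_into[OF bij] r] bij] by simp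
    then have "bij_betw (?T a) (carrier ?N) (carrier ?N)"
      by (rule bij_betw_cong[THEN iffD1, rotated]) (simp add: T)
    moreover have "?T a \<in> hom ?N ?N"
      using a by (auto simp: hom_def T i_mult rho_add \<gamma>_add)
    ultimately show ?thesis using T_ext by (simp add: auto_def Bij_def)
  qed
  show ?thesis
  proof (rule homI)
    show "(?T x, \<gamma> x) \<in> carrier (hol ?N)" if "x \<in> carrier (adjoint_group A)" for x
      using that T_auto by (simp add: adjoint_group_def)
    show "(?T (x \<otimes>\<^bsub>adjoint_group A\<^esub> y), \<gamma> (x \<otimes>\<^bsub>adjoint_group A\<^esub> y)) =
        (?T x, \<gamma> x) \<otimes>\<^bsub>hol ?N\<^esub> (?T y, \<gamma> y)"
      if "x \<in> carrier (adjoint_group A)" "y \<in> carrier (adjoint_group A)" for x y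
    proof -
      have xy: "x \<in> carrier A" "y \<in> carrier A" using that by (simp_all add: adjoint_group_def)
      have "?T (x \<otimes>\<^bsub>A\<^esub> y) = compose (carrier ?N) (?T y) (?T x)"
      proof (rule extensionalityI[OF T_ext])
        show "?T (x \<otimes>\<^bsub>A\<^esub> y) v = compose (carrier ?N) (?T y) (?T x) v" if "v \<in> carrier ?N" for v
          using that xy by (simp add: T compose_eq rho_compose)
      qed simp
      moreover have "\<gamma> (x \<otimes>\<^bsub>A\<^esub> y) = ?T y (\<gamma> x) \<otimes>\<^bsub>?N\<^esub> \<gamma> y"
        using xy by (simp add: T rho_mult \<gamma>_add)
      ultimately show ?thesis by (simp add: adjoint_group_def)
    qed
  qed
qed

section \<open>Automorphisms of the additive group as matrices\<close>

lemma N_group_carrier: "carrier (N_group m) = {0..<2} \<times> {0..<2 ^ (m + 1)}"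
  by (simp add: N_group_def DirProd_def carrier_integer_mod_group)

lemma N_group_mult [simp]:
  "(i, j) \<otimes>\<^bsub>N_group m\<^esub> (i', j') = ((i + i') mod 2, (j + j') mod 2 ^ (m + 1))"
  by (simp add: N_group_def DirProd_def)

lemma N_group_one: "\<one>\<^bsub>N_group m\<^esub> = (0, 0)"
  by (simp add: N_group_def DirProd_def)

lemma N_group_comm: "comm_group (N_group m)"
proof -
  have "group (N_group m)" unfolding N_group_def by (intro DirProd_group) auto
  then show ?thesis
    by (rule group.group_comm_groupI) (auto simp: N_group_carrier add.commute)
qed

lemma N_group_group: "group (N_group m)"
  using N_group_comm by (simp add: comm_group_def)

lemma N_group_card: "card (carrier (N_group m)) = 2 ^ (m + 2)"
  by (simp add: N_group_carrier card_cartesian_product nat_mult_distrib nat_power_eq)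

lemma N_group_pow:
  assumes "(i, j) \<in> carrier (N_group m)"
  shows "(i, j) [^]\<^bsub>N_group m\<^esub> (k::nat) = ((int k * i) mod 2, (int k * j) mod 2 ^ (m + 1))"
proof (induction k)
  case (Suc k)
  then show ?case by (simp add: algebra_simps mod_simps)
qed (simp add: N_group_one)

definition lin :: "nat \<Rightarrow> int \<Rightarrow> int \<Rightarrow> int \<Rightarrow> int \<times> int \<Rightarrow> int \<times> int" where
  "lin m x y w = (\<lambda>p \<in> carrier (N_group m).
     ((fst p + y * snd p) mod 2, (2 ^ m * x * fst p + w * snd p) mod 2 ^ (m + 1)))"

lemma lin_apply:
  "(i, j) \<in> carrier (N_group m) \<Longrightarrow>
    lin m x y w (i, j) = ((i + y * j) mod 2, (2 ^ m * x * i + w * j) mod 2 ^ (m + 1))"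
  by (simp add: lin_def)

lemma matrix_map_lin:
  "matrix_map m (vector [vector [1, y], vector [2 ^ m * x, w]]) = lin m x y w"
  by (simp add: matrix_map_def lin_def matrix_vector_mult_def sum_2 Let_def)

lemma first_form_lin:
  "first_form m x y z =
    (lin m x y (1 + 2 * z), lin m 0 0 (1 + 2 ^ m * (1 + x)), (0, 1), (1, 0))"
  using matrix_map_lin[of m 0 0] by (simp add: first_form_def matrix_map_lin)

lemma second_form_lin:
  "second_form m x z =
    (lin m x 0 (1 + 2 * z), lin m 1 0 (1 + 2 ^ m * (1 + x)), (0, 1), (1, 2 ^ (m - 1)))"
  using matrix_map_lin[of m 0 1] by (simp add: second_form_def matrix_map_lin)

lemma mod_eqI: "a = b + c * n \<Longrightarrow> a mod n = b mod (n :: int)"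
  by simp

lemma mod_two_eq_iff: "a mod 2 = b mod 2 \<longleftrightarrow> (even a \<longleftrightarrow> even (b :: int))"
  by presburger

lemma lin_cong:
  assumes "even (x - x')" "even (y - y')" "2 ^ (m + 1) dvd w - w'"
  shows "lin m x y w = lin m x' y' w'"
proof -
  obtain r s where r: "x - x' = 2 * r" and s: "w - w' = 2 ^ (m + 1) * s"
    using assms(1,3) by (elim dvdE)
  then have r': "x = x' + 2 * r" and s': "w = w' + 2 ^ (m + 1) * s" by simp_all
  have "(2 ^ m * x * i + w * j) mod 2 ^ (m + 1) = (2 ^ m * x' * i + w' * j) mod 2 ^ (m + 1)" for i j
    unfolding r' s' by (rule mod_eqI[where c = "r * i + s * j"]) (simp add: algebra_simps)
  moreover have "(i + y * j) mod 2 = (i + y' * j) mod 2" for i j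
    using assms(2) by (simp add: mod_two_eq_iff)
  ultimately show ?thesis by (simp add: lin_def)
qed

lemma lin_closed: "p \<in> carrier (N_group m) \<Longrightarrow> lin m x y w p \<in> carrier (N_group m)"
  by (cases p) (simp add: lin_apply N_group_carrier)

lemma even_mod_double [simp]: "even (a mod (2 * k)) \<longleftrightarrow> even (a :: int)"
  by (simp add: dvd_mod_iff)

text \<open>This is the matrix product. The off-diagonal entries matter only modulo 2, where the odd
  w and w' act as 1, so they simply add; the term 2^m x' y in the upper left corner is even and
  disappears.\<close>

lemma lin_compose:
  assumes m: "1 \<le> m" and w: "odd w" and w': "odd w'"
  shows "compose (carrier (N_group m)) (lin m x y w) (lin m x' y' w') =
    lin m (x + x') (y + y') (w * w' + 2 ^ m * x * y')"
proof (rule extensionalityI[where A = "carrier (N_group m)"])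
  fix p assume p: "p \<in> carrier (N_group m)"
  obtain i j where ij: "p = (i, j)" by (cases p)
  obtain k where k: "w = 2 * k + 1" using w by (rule oddE)
  let ?A = "i + y' * j" and ?B = "2 ^ m * x' * i + w' * j"
  have A: "?A mod 2 = ?A - 2 * (?A div 2)" by (simp add: minus_mult_div_eq_mod)
  have B: "?B mod 2 ^ (m + 1) = ?B - 2 ^ (m + 1) * (?B div 2 ^ (m + 1))"
    by (simp only: minus_mult_div_eq_mod)
  have "2 ^ m * x * (?A mod 2) + w * (?B mod 2 ^ (m + 1)) =
      2 ^ m * (x + x') * i + (w * w' + 2 ^ m * x * y') * j +
      (k * x' * i - x * (?A div 2) - w * (?B div 2 ^ (m + 1))) * 2 ^ (m + 1)"
    unfolding A B by (simp add: k algebra_simps)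
  then have 2: "(2 ^ m * x * (?A mod 2) + w * (?B mod 2 ^ (m + 1))) mod 2 ^ (m + 1) =
      (2 ^ m * (x + x') * i + (w * w' + 2 ^ m * x * y') * j) mod 2 ^ (m + 1)"
    by (rule mod_eqI)
  have 1: "(?A mod 2 + y * (?B mod 2 ^ (m + 1))) mod 2 = (i + (y + y') * j) mod 2"
    using m w' by (auto simp: mod_two_eq_iff)
  have "(?A mod 2, ?B mod 2 ^ (m + 1)) \<in> carrier (N_group m)"
    by (simp add: N_group_carrier)
  then show "compose (carrier (N_group m)) (lin m x y w) (lin m x' y' w') p =
      lin m (x + x') (y + y') (w * w' + 2 ^ m * x * y') p"
    using p unfolding ij by (simp only: compose_eq lin_apply 1 2)
qed (auto simp: lin_def compose_def)

lemma lin_auto: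
  assumes m: "1 \<le> m" and w: "odd w"
  shows "lin m x y w \<in> auto (N_group m)"
proof -
  let ?N = "N_group m"
  interpret N: group "N_group m" by (rule N_group_group)
  have hom: "lin m x y w \<in> hom ?N ?N"
  proof (rule homI)
    fix p p' assume p: "p \<in> carrier ?N" "p' \<in> carrier ?N"
    obtain i j i' j' where ij: "p = (i, j)" "p' = (i', j')" by (cases p; cases p')
    let ?A = "i + i'" and ?B = "j + j'"
    have A: "?A mod 2 = ?A - 2 * (?A div 2)" by (simp add: minus_mult_div_eq_mod)
    have B: "?B mod 2 ^ (m + 1) = ?B - 2 ^ (m + 1) * (?B div 2 ^ (m + 1))"
      by (simp only: minus_mult_div_eq_mod)
    have "2 ^ m * x * (?A mod 2) + w * (?B mod 2 ^ (m + 1)) =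
        (2 ^ m * x * i + w * j) + (2 ^ m * x * i' + w * j') +
        (- x * (?A div 2) - w * (?B div 2 ^ (m + 1))) * 2 ^ (m + 1)"
      unfolding A B by (simp add: algebra_simps)
    then have 2: "(2 ^ m * x * (?A mod 2) + w * (?B mod 2 ^ (m + 1))) mod 2 ^ (m + 1) =
        ((2 ^ m * x * i + w * j) + (2 ^ m * x * i' + w * j')) mod 2 ^ (m + 1)"
      by (rule mod_eqI)
    have 1: "(?A mod 2 + y * (?B mod 2 ^ (m + 1))) mod 2 = ((i + y * j) + (i' + y * j')) mod 2"
      using m by (auto simp: mod_two_eq_iff)
    have "(?A mod 2, ?B mod 2 ^ (m + 1)) \<in> carrier ?N"
      by (simp add: N_group_carrier)
    then show "lin m x y w (p \<otimes>\<^bsub>?N\<^esub> p') = lin m x y w p \<otimes>\<^bsub>?N\<^esub> lin m x y w p'"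
      using p unfolding ij by (simp only: N_group_mult lin_apply 1 2 mod_add_eq)
  qed (rule lin_closed)
  have inj: "inj_on (lin m x y w) (carrier ?N)"
  proof -
    interpret group_hom ?N ?N "lin m x y w"
      using hom by (simp add: group_hom_def group_hom_axioms_def N_group_group)
    have "p = \<one>\<^bsub>?N\<^esub>" if p: "p \<in> carrier ?N" and one: "lin m x y w p = \<one>\<^bsub>?N\<^esub>" for p
    proof -
      obtain i j where ij: "p = (i, j)" by (cases p)
      have e: "even (i + y * j)" "2 ^ (m + 1) dvd 2 ^ m * x * i + w * j"
        using one p unfolding ij N_group_one by (auto simp only: lin_apply prod.inject mod_eq_0_iff_dvd)
      have "2 dvd (2::int) ^ (m + 1)" by simp
      then have "even (2 ^ m * x * i + w * j)" using e(2) dvd_trans by blast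
      then have "even j" using m w by auto
      then have i: "i = 0" using e(1) p ij by (auto simp: N_group_carrier)
      then have "2 ^ (m + 1) dvd j * w" using e(2) by (simp add: mult.commute)
      moreover have "coprime (2 ^ (m + 1)) w" using w by simp
      ultimately have "2 ^ (m + 1) dvd j" by (simp only: coprime_dvd_mult_left_iff)
      then have "j = 0" using p ij zdvd_not_zless[of j "2 ^ (m + 1)"] by (force simp: N_group_carrier)
      with i ij show ?thesis by (simp add: N_group_one)
    qed
    then show ?thesis using inj_on_one_iff by blast
  qed
  have "finite (carrier ?N)" by (simp add: N_group_carrier)
  moreover have "lin m x y w ` carrier ?N \<subseteq> carrier ?N" using lin_closed by blast
  ultimately have "bij_betw (lin m x y w) (carrier ?N) (carrier ?N)"
    using inj by (simp add: bij_betw_def endo_inj_surj)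
  moreover have "lin m x y w \<in> extensional (carrier ?N)" by (simp add: lin_def)
  ultimately show ?thesis using hom by (simp add: auto_def Bij_def)
qed

text \<open>The images of (1, 0) and (0, 1) determine the map. The first has order two, so its
  second coordinate is a multiple of 2^m. Injectivity at (0, 2^m) makes w odd; then (0, 2^m) is
  fixed, and (1, 0) must avoid both it and 0, which leaves upper left entry 1.\<close>

lemma auto_lin:
  assumes m: "1 \<le> m" and \<theta>: "\<theta> \<in> auto (N_group m)"
  shows "\<exists>x \<in> {0, 1}. \<exists>y \<in> {0, 1}. \<exists>w \<in> {0..<2 ^ (m + 1)}. odd w \<and> \<theta> = lin m x y w"
proof -
  let ?N = "N_group m"
  interpret group_hom ?N ?N \<theta>
    using \<theta> by (simp add: group_hom_def group_hom_axioms_def N_group_group auto_def)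
  have inj: "inj_on \<theta> (carrier ?N)" using auto_inj[OF \<theta>] .
  obtain p r where pr: "\<theta> (1, 0) = (p, r)" by (cases "\<theta> (1, 0)")
  obtain y w where yw: "\<theta> (0, 1) = (y, w)" by (cases "\<theta> (0, 1)")
  have one_lt: "(1::int) < 2 ^ (m + 1)" by (rule one_less_power) simp_all
  have e1: "(1, 0) \<in> carrier ?N" and e2: "(0, 1) \<in> carrier ?N" and eq: "(0, 2 ^ m) \<in> carrier ?N"
    using one_lt by (simp_all add: N_group_carrier)
  have cl: "(p, r) \<in> carrier ?N" "(y, w) \<in> carrier ?N"
    using hom_closed[OF e1] hom_closed[OF e2] pr yw by simp_all
  have rng: "p \<in> {0, 1}" "y \<in> {0, 1}" "w \<in> {0..<2 ^ (m + 1)}" "r \<in> {0..<2 ^ (m + 1)}"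
    using cl by (auto simp: N_group_carrier)
  have \<theta>_eq: "\<theta> (i, j) = ((i * p + j * y) mod 2, (i * r + j * w) mod 2 ^ (m + 1))"
    if "(i, j) \<in> carrier ?N" for i j
  proof -
    have ij: "0 \<le> i" "i < 2" "0 \<le> j" "j < 2 ^ (m + 1)" using that by (auto simp: N_group_carrier)
    have "(i, j) = (1, 0) [^]\<^bsub>?N\<^esub> nat i \<otimes>\<^bsub>?N\<^esub> (0, 1) [^]\<^bsub>?N\<^esub> nat j"
      using ij by (simp add: N_group_pow[OF e1] N_group_pow[OF e2])
    then have "\<theta> (i, j) = (p, r) [^]\<^bsub>?N\<^esub> nat i \<otimes>\<^bsub>?N\<^esub> (y, w) [^]\<^bsub>?N\<^esub> nat j"
      using e1 e2 by (simp add: hom_mult hom_nat_pow pr yw)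
    then show ?thesis
      unfolding N_group_pow[OF cl(1)] N_group_pow[OF cl(2)] using ij by (simp add: mod_simps)
  qed
  have two_r: "2 ^ m dvd r"
  proof -
    have "(1, 0) \<otimes>\<^bsub>?N\<^esub> (1, 0) = \<one>\<^bsub>?N\<^esub>" by (simp add: N_group_one)
    then have "(p, r) \<otimes>\<^bsub>?N\<^esub> (p, r) = \<one>\<^bsub>?N\<^esub>" using hom_mult[OF e1 e1] pr hom_one by simp
    then have "2 ^ (m + 1) dvd 2 * r" by (simp add: N_group_one mod_eq_0_iff_dvd)
    then show ?thesis by simp
  qed
  have \<theta>0: "\<theta> (0, 0) = (0, 0)" using hom_one by (simp add: N_group_one)
  have zero: "(0, 0) \<in> carrier ?N" by (simp add: N_group_carrier)
  have \<theta>q: "\<theta> (0, 2 ^ m) = (0, 2 ^ m * w mod 2 ^ (m + 1))" using \<theta>_eq[OF eq] m by simp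
  have w: "odd w"
  proof
    assume "even w"
    then have "\<theta> (0, 2 ^ m) = \<theta> (0, 0)" unfolding \<theta>q \<theta>0 by auto
    then show False using inj_onD[OF inj _ eq zero] by simp
  qed
  then have \<theta>q': "\<theta> (0, 2 ^ m) = (0, 2 ^ m)"
    unfolding \<theta>q by (auto elim!: oddE simp: algebra_simps)
  obtain x where x: "r = 2 ^ m * x" using two_r by blast
  have "0 \<le> x" "x < 2" using rng(4) unfolding x by (auto simp: zero_le_mult_iff)
  then have x01: "x \<in> {0, 1}" by auto
  have "p = 1"
  proof (rule ccontr)
    assume "p \<noteq> 1"
    then have "p = 0" using rng by simp
    then have "\<theta> (1, 0) = \<theta> (0, 0) \<or> \<theta> (1, 0) = \<theta> (0, 2 ^ m)"
      using x01 unfolding pr \<theta>q' \<theta>0 x by auto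
    then show False using inj_onD[OF inj _ e1 zero] inj_onD[OF inj _ e1 eq] by auto
  qed
  have "\<theta> = lin m x y w"
  proof (rule auto_eqI[OF \<theta> lin_auto[OF m w]])
    fix v assume v: "v \<in> carrier ?N"
    obtain i j where "v = (i, j)" by (cases v)
    with v show "\<theta> v = lin m x y w v"
      by (simp add: \<theta>_eq lin_apply x \<open>p = 1\<close> mult_ac)
  qed
  with x01 rng w show ?thesis by blast
qed

section \<open>Powers of the image of a in the holomorph\<close>

lemma N_hol_group: "group (hol (N_group m))"
  using group.group_hol[OF N_group_group] .

lemma lin_pair_in_hol:
  "1 \<le> m \<Longrightarrow> odd w \<Longrightarrow> v \<in> carrier (N_group m) \<Longrightarrow> (lin m x y w, v) \<in> carrier (hol (N_group m))"
  by (simp add: lin_auto)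

lemma lin_id: "lin m 0 0 1 = (\<lambda>p \<in> carrier (N_group m). p)"
  by (auto simp: lin_def fun_eq_iff N_group_carrier)

lemma lin_id_cong: "2 ^ (m + 1) dvd w - 1 \<Longrightarrow> lin m 0 0 w = (\<lambda>p \<in> carrier (N_group m). p)"
  using lin_cong[of 0 0 0 0 m w 1] by (simp add: lin_id)

lemma mod_mult_add: "(w * (b mod n) + a) mod n = (w * b + a) mod (n :: int)"
  by (rule mod_add_cong) (simp_all add: mod_mult_right_eq)

lemma mod_add_mult: "(a + w * (b mod n)) mod n = (a + w * b) mod (n :: int)"
  by (rule mod_add_cong) (simp_all add: mod_mult_right_eq)

lemma eight_dvd_pow: "3 \<le> m \<Longrightarrow> (2::int) ^ m = 8 * 2 ^ (m - 3)"
  using power_add[of "2::int" 3 "m - 3"] by simp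

text \<open>The induction starts at exponent four because one squaring removes both off-diagonal
  entries and a second one removes the first coordinate y of the vector. The entry 1 modulo 8 arises
  from an odd square and from 8 dividing 2^m. The parity of u keeps track of t = (1 + w) /
  2.\<close>

lemma lin_pair_pow_four:
  fixes x y w t :: int
  assumes m: "3 \<le> m" and w: "odd w" and t: "1 + w = 2 * t"
  defines "\<alpha> \<equiv> (lin m x y w, (0, 1))"
  shows "\<exists>e u. \<alpha> [^]\<^bsub>hol (N_group m)\<^esub> (4::nat) =
      (lin m 0 0 (1 + 8 * e), (0, (4 * u) mod 2 ^ (m + 1))) \<and> (even u \<longleftrightarrow> even t)"
proof -
  let ?N = "N_group m" let ?H = "hol (N_group m)"
  interpret H: group ?H by (rule N_hol_group)
  have m1: "1 \<le> m" using m by simp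
  have one_lt: "(1::int) < 2 ^ (m + 1)" by (rule one_less_power) simp_all
  have e2: "(0, 1) \<in> carrier ?N" using one_lt by (simp add: N_group_carrier)
  have \<alpha>: "\<alpha> \<in> carrier ?H" unfolding \<alpha>_def by (rule lin_pair_in_hol[OF m1 w e2])
  define p where "p = (2::int) ^ (m - 3)"
  have q: "(2::int) ^ m = 8 * p" unfolding p_def by (rule eight_dvd_pow[OF m])
  obtain s where s: "w = 2 * s + 1" using w by (rule oddE)
  have "even (s * (s + 1))" by simp
  then obtain r where r: "s * (s + 1) = 2 * r" by (elim evenE)
  define e0 where "e0 = r + p * x * y"
  let ?D = "w * w + 2 ^ m * x * y"
  have "w * w = 4 * (s * (s + 1)) + 1" unfolding s by (simp add: algebra_simps)
  then have D: "?D = 1 + 8 * e0" unfolding r q e0_def by (simp add: algebra_simps)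
  have oddD: "odd ?D" unfolding D by simp
  have sq: "\<alpha> \<otimes>\<^bsub>?H\<^esub> \<alpha> = (lin m 0 0 ?D, (y mod 2, (1 + w) mod 2 ^ (m + 1)))"
  proof -
    have "lin m (x + x) (y + y) ?D = lin m 0 0 ?D" by (rule lin_cong) simp_all
    then show ?thesis
      unfolding \<alpha>_def mult_hol lin_compose[OF m1 w w] lin_apply[OF e2]
      by (simp add: mod_simps add.commute)
  qed
  define v where "v = (1 + w) mod 2 ^ (m + 1)"
  have cl: "(y mod 2, v) \<in> carrier ?N" by (simp add: N_group_carrier v_def)
  have four: "\<alpha> [^]\<^bsub>?H\<^esub> (4::nat) = (\<alpha> \<otimes>\<^bsub>?H\<^esub> \<alpha>) \<otimes>\<^bsub>?H\<^esub> (\<alpha> \<otimes>\<^bsub>?H\<^esub> \<alpha>)"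
    using \<alpha> by (simp add: numeral_eq_Suc H.m_assoc del: carrier_hol)
  have "\<alpha> [^]\<^bsub>?H\<^esub> (4::nat) = (lin m 0 0 (?D * ?D),
      ((y mod 2 + y mod 2) mod 2, (?D * v + v) mod 2 ^ (m + 1)))"
    unfolding four sq v_def[symmetric] mult_hol lin_compose[OF m1 oddD oddD] lin_apply[OF cl] by (simp add: mod_simps)
  also have "(y mod 2 + y mod 2) mod 2 = 0" by presburger
  also have "(?D * v + v) mod 2 ^ (m + 1) = (?D * (1 + w) + (1 + w)) mod 2 ^ (m + 1)"
    unfolding v_def by (simp only: mod_add_right_eq mod_mult_add)
  also have "?D * (1 + w) + (1 + w) = 4 * (t * (1 + 4 * e0))"
    unfolding D t by (simp add: algebra_simps)
  also have "?D * ?D = 1 + 8 * (2 * e0 + 8 * e0 * e0)" unfolding D by (simp add: algebra_simps)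
  finally show ?thesis
    by (intro exI[of _ "2 * e0 + 8 * e0 * e0"] exI[of _ "t * (1 + 4 * e0)"] conjI) simp_all
qed

text \<open>Squaring multiplies the vector by D + 1, where D is the diagonal entry. Since D is 1
  modulo 4, this factor is twice an odd number, so the parity of u survives every step.\<close>

lemma lin_pair_pow:
  fixes x y w t :: int
  assumes m: "3 \<le> m" and w: "odd w" and t: "1 + w = 2 * t"
  defines "\<alpha> \<equiv> (lin m x y w, (0, 1))"
  shows "\<exists>e u. \<alpha> [^]\<^bsub>hol (N_group m)\<^esub> (2 ^ (k + 2) :: nat) =
      (lin m 0 0 (1 + 2 ^ (k + 3) * e), (0, (2 ^ (k + 2) * u) mod 2 ^ (m + 1))) \<and> (even u \<longleftrightarrow> even t)"
proof (induction k)
  case 0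
  show ?case using lin_pair_pow_four[OF m w t] unfolding \<alpha>_def by simp
next
  case (Suc k)
  let ?N = "N_group m" let ?H = "hol (N_group m)"
  interpret H: group ?H by (rule N_hol_group)
  have m1: "1 \<le> m" using m by simp
  have one_lt: "(1::int) < 2 ^ (m + 1)" by (rule one_less_power) simp_all
  have e2: "(0, 1) \<in> carrier ?N" using one_lt by (simp add: N_group_carrier)
  have \<alpha>: "\<alpha> \<in> carrier ?H" unfolding \<alpha>_def by (rule lin_pair_in_hol[OF m1 w e2])
  obtain e u where eu: "\<alpha> [^]\<^bsub>?H\<^esub> (2 ^ (k + 2) :: nat) =
      (lin m 0 0 (1 + 2 ^ (k + 3) * e), (0, (2 ^ (k + 2) * u) mod 2 ^ (m + 1)))"
      "even u \<longleftrightarrow> even t" using Suc by blast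
  define P where "P = (2::int) ^ k"
  have P: "(2::int) ^ (k + 2) = 4 * P" "(2::int) ^ (k + 3) = 8 * P" "(2::int) ^ (Suc k + 3) = 16 * P"
    "(2::int) ^ (Suc k + 2) = 8 * P"
    unfolding P_def by (simp_all add: power_add)
  let ?D = "1 + 8 * P * e" let ?V = "4 * P * u"
  have oddD: "odd ?D" by simp
  define v where "v = ?V mod 2 ^ (m + 1)"
  have cl: "(0, v) \<in> carrier ?N" by (simp add: N_group_carrier v_def)
  have "(2::nat) ^ (Suc k + 2) = 2 ^ (k + 2) + 2 ^ (k + 2)" by simp
  then have "\<alpha> [^]\<^bsub>?H\<^esub> (2 ^ (Suc k + 2) :: nat) =
      \<alpha> [^]\<^bsub>?H\<^esub> (2 ^ (k + 2) :: nat) \<otimes>\<^bsub>?H\<^esub> \<alpha> [^]\<^bsub>?H\<^esub> (2 ^ (k + 2) :: nat)"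
    by (simp only: H.nat_pow_mult[OF \<alpha>])
  also have "\<dots> = (lin m 0 0 (?D * ?D),
      (0, (?D * v + v) mod 2 ^ (m + 1)))"
    unfolding eu P v_def[symmetric] mult_hol lin_compose[OF m1 oddD oddD] lin_apply[OF cl] by (simp add: mod_simps)
  also have "(?D * v + v) mod 2 ^ (m + 1) = (?D * ?V + ?V) mod 2 ^ (m + 1)"
    unfolding v_def by (simp only: mod_add_right_eq mod_mult_add)
  also have "?D * ?V + ?V = 8 * P * (u * (1 + 4 * P * e))" by (simp add: algebra_simps)
  also have "?D * ?D = 1 + 16 * P * (e + 4 * P * e * e)" by (simp add: algebra_simps)
  finally have "\<alpha> [^]\<^bsub>?H\<^esub> (2 ^ (Suc k + 2) :: nat) =
      (lin m 0 0 (1 + 2 ^ (Suc k + 3) * (e + 4 * P * e * e)),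
        (0, (2 ^ (Suc k + 2) * (u * (1 + 4 * P * e))) mod 2 ^ (m + 1)))"
    by (simp only: P)
  moreover have "even (u * (1 + 4 * P * e)) \<longleftrightarrow> even t" using eu(2) by simp
  ultimately show ?case by blast
qed

text \<open>For w = 1 + 2 z one has t = 1 + z, so this power has a nonzero vector exactly if z is
  even.\<close>

lemma lin_pair_pow_half:
  assumes m: "3 \<le> m" and w: "odd w" and t: "1 + w = 2 * t"
  shows "(lin m x y w, (0, 1)) [^]\<^bsub>hol (N_group m)\<^esub> (2 ^ m :: nat) =
      (\<lambda>p \<in> carrier (N_group m). p, (0, if even t then 0 else 2 ^ m))"
proof -
  have idx: "m - 2 + 2 = m" "m - 2 + 3 = m + 1" using m by simp_all
  obtain e u where eu: "(lin m x y w, (0, 1)) [^]\<^bsub>hol (N_group m)\<^esub> (2 ^ m :: nat) =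
      (lin m 0 0 (1 + 2 ^ (m + 1) * e), (0, (2 ^ m * u) mod 2 ^ (m + 1)))" "even u \<longleftrightarrow> even t"
    using lin_pair_pow[OF m w t, of x y "m - 2"] unfolding idx by blast
  have "(2 ^ m * u) mod 2 ^ (m + 1) = 2 ^ m * (u mod 2)"
    unfolding mult_mod_right by (simp add: mult.commute)
  moreover have "u mod 2 = (if even t then 0 else 1)" using eu(2) by presburger
  ultimately show ?thesis unfolding eu(1) by (simp add: lin_id_cong)
qed

section \<open>The two normal forms\<close>

lemma N_group_memI: "0 \<le> j \<Longrightarrow> j < 2 ^ (m + 1) \<Longrightarrow> i \<in> {0, 1} \<Longrightarrow> (i, j) \<in> carrier (N_group m)"
  by (auto simp: N_group_carrier)

text \<open>Both forms at once: \<open>x' = 0\<close> gives the first one, \<open>x' = 1\<close> (which forces \<open>y = 0\<close>) the second.\<close>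

lemma forms_satisfy_relations:
  fixes x y z x' :: int
  assumes m: "3 \<le> m" and z: "even z" and x': "x' \<in> {0, 1}" and xy: "even (x' * y)"
  shows "modular_relations (hol (N_group m)) m (lin m x y (1 + 2 * z), (0, 1))
    (lin m x' 0 (1 + 2 ^ m * (1 + x)), (1, 2 ^ (m - 1) * x'))"
proof -
  let ?N = "N_group m" let ?H = "hol (N_group m)"
  interpret H: group ?H by (rule N_hol_group)
  \<comment> \<open>All powers of two in sight are multiples of p: 4 p = 2^(m-1), 8 p = 2^m, and the
    modulus is 16 p. The congruences become polynomial identities in p with explicit
    quotients.\<close>
  define p where "p = (2::int) ^ (m - 3)"
  have q: "(2::int) ^ m = 8 * p" unfolding p_def by (rule eight_dvd_pow[OF m])
  have M: "(2::int) ^ (m + 1) = 16 * p" using q by simp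
  have h: "(2::int) ^ (m - 1) = 4 * p"
    using power_Suc[of "2::int" "m - 1"] m q by simp
  have p1: "1 \<le> p" unfolding p_def by simp
  have m1: "1 \<le> m" using m by simp
  let ?w = "1 + 2 * z" let ?W = "1 + 8 * p * (1 + x)" let ?v = "4 * p * x'"
  let ?\<alpha> = "(lin m x y ?w, (0, 1))" and ?\<beta> = "(lin m x' 0 ?W, (1, ?v))"
  have w: "odd ?w" and W: "odd ?W" by simp_all
  have e2: "(0, 1) \<in> carrier ?N" by (intro N_group_memI one_less_power) auto
  have eb: "(1, ?v) \<in> carrier ?N" using p1 x' M by (intro N_group_memI) auto
  have eq: "(0, (1 + 8 * p) mod 2 ^ (m + 1)) \<in> carrier ?N" by (simp add: N_group_carrier)
  have \<alpha>: "?\<alpha> \<in> carrier ?H" by (rule lin_pair_in_hol[OF m1 w e2])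
  have \<beta>: "?\<beta> \<in> carrier ?H" by (rule lin_pair_in_hol[OF m1 W eb])
  obtain z' where z': "z = 2 * z'" using z by (elim evenE)
  have half: "?\<alpha> [^]\<^bsub>?H\<^esub> (2 ^ m :: nat) = (\<lambda>p \<in> carrier ?N. p, (0, 8 * p))"
    using lin_pair_pow_half[OF m w, of "1 + z" x y] z q by simp
  have eq': "(0, 8 * p) \<in> carrier ?N" using p1 M by (intro N_group_memI) auto
  have full: "?\<alpha> [^]\<^bsub>?H\<^esub> (2 ^ (m + 1) :: nat) = \<one>\<^bsub>?H\<^esub>"
  proof -
    have "(2::nat) ^ (m + 1) = 2 ^ m + 2 ^ m" by simp
    then have "?\<alpha> [^]\<^bsub>?H\<^esub> (2 ^ (m + 1) :: nat) =
        ?\<alpha> [^]\<^bsub>?H\<^esub> (2 ^ m :: nat) \<otimes>\<^bsub>?H\<^esub> ?\<alpha> [^]\<^bsub>?H\<^esub> (2 ^ m :: nat)"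
      by (simp only: H.nat_pow_mult[OF \<alpha>])
    then show ?thesis
      unfolding half one_hol N_group_one mult_hol using eq' by (simp add: M[simplified])
  qed
  have \<beta>2: "?\<beta> \<otimes>\<^bsub>?H\<^esub> ?\<beta> = \<one>\<^bsub>?H\<^esub>"
  proof -
    have "lin m (x' + x') (0 + 0) (?W * ?W + 2 ^ m * x' * 0) = lin m 0 0 1"
    proof (rule lin_cong)
      have "?W * ?W + 2 ^ m * x' * 0 - 1 = 2 ^ (m + 1) * ((1 + x) + 4 * p * (1 + x) * (1 + x))"
        unfolding M by (simp add: algebra_simps)
      then show "2 ^ (m + 1) dvd ?W * ?W + 2 ^ m * x' * 0 - 1" by (rule dvdI)
    qed simp_all
    moreover have "((2 ^ m * x' * 1 + ?W * ?v) mod 2 ^ (m + 1) + ?v) mod 2 ^ (m + 1) = 0"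
    proof -
      have "2 ^ m * x' * 1 + ?W * ?v + ?v = 0 + (x' + 2 * p * x' * (1 + x)) * 2 ^ (m + 1)"
        unfolding M q by (simp add: algebra_simps)
      from mod_eqI[OF this] show ?thesis by (simp add: mod_add_left_eq)
    qed
    ultimately show ?thesis
      unfolding mult_hol lin_compose[OF m1 W W] lin_apply[OF eb] one_hol N_group_one N_group_mult lin_id
      by simp
  qed
  have "?\<alpha> [^]\<^bsub>?H\<^esub> (1 + 2 ^ m :: nat) = ?\<alpha> [^]\<^bsub>?H\<^esub> (1::nat) \<otimes>\<^bsub>?H\<^esub> ?\<alpha> [^]\<^bsub>?H\<^esub> (2 ^ m :: nat)"
    by (simp only: H.nat_pow_mult[OF \<alpha>])
  also have "\<dots> = ?\<alpha> \<otimes>\<^bsub>?H\<^esub> (\<lambda>p \<in> carrier ?N. p, (0, 8 * p))"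
    unfolding half using H.nat_pow_eone[OF \<alpha>] by simp
  also have "\<dots> = (lin m x y ?w, (0, (1 + 8 * p) mod 2 ^ (m + 1)))"
    using e2 lin_auto[OF m1 w, of x y] unfolding mult_hol
    by (auto simp: compose_def lin_def fun_eq_iff N_group_carrier)
  finally have pow: "?\<alpha> [^]\<^bsub>?H\<^esub> (1 + 2 ^ m :: nat) = (lin m x y ?w, (0, (1 + 8 * p) mod 2 ^ (m + 1)))" .
  have comm: "?\<beta> \<otimes>\<^bsub>?H\<^esub> ?\<alpha> = ?\<alpha> [^]\<^bsub>?H\<^esub> (1 + 2 ^ m :: nat) \<otimes>\<^bsub>?H\<^esub> ?\<beta>"
  proof -
    \<comment> \<open>The two matrices commute up to the summand 2^m x' y in the lower right entry,
      which the evenness of x' y removes.\<close>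
    have 1: "lin m (x + x') (y + 0) (?w * ?W + 2 ^ m * x * 0) =
        lin m (x' + x) (0 + y) (?W * ?w + 2 ^ m * x' * y)"
    proof (rule lin_cong)
      obtain k where k: "x' * y = 2 * k" using xy by (elim evenE)
      have "?w * ?W + 2 ^ m * x * 0 - (?W * ?w + 2 ^ m * x' * y) = - 8 * p * (x' * y)"
        unfolding q by (simp add: algebra_simps)
      also have "\<dots> = 2 ^ (m + 1) * (- k)" unfolding k M by simp
      finally show "2 ^ (m + 1) dvd ?w * ?W + 2 ^ m * x * 0 - (?W * ?w + 2 ^ m * x' * y)"
        by (rule dvdI)
    qed simp_all
    have 2: "((1 + y * ?v) mod 2 + 0) mod 2 = ((0 + 0 * ((1 + 8 * p) mod 2 ^ (m + 1))) mod 2 + 1) mod 2"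
    proof -
      have "1 + y * ?v = 1 + (2 * y * p * x') * 2" by simp
      from mod_eqI[OF this] show ?thesis by simp
    qed
    \<comment> \<open>Modulo 2^(m+1), the term 2^m x contributed by S at b and the 2^m from a^(2^m)
      are balanced by the 2^m (1 + x) in T; hence the shape of that entry. The remaining product of
      2 z and v vanishes since z is even.\<close>
    have "2 ^ m * x * 1 + ?w * ?v + 1 =
        (2 ^ m * x' * 0 + ?W * (1 + 8 * p)) + ?v + (z' * x' - 1 - 4 * p * (1 + x)) * 2 ^ (m + 1)"
      unfolding M q z' by (simp add: algebra_simps)
    from mod_eqI[OF this]
    have 3: "((2 ^ m * x * 1 + ?w * ?v) mod 2 ^ (m + 1) + 1) mod 2 ^ (m + 1) =
        ((2 ^ m * x' * 0 + ?W * ((1 + 8 * p) mod 2 ^ (m + 1))) mod 2 ^ (m + 1) + ?v) mod 2 ^ (m + 1)"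
      by (simp only: mod_add_left_eq mod_add_mult)
    show ?thesis
      unfolding pow mult_hol lin_compose[OF m1 w W] lin_compose[OF m1 W w] lin_apply[OF eb]
        lin_apply[OF eq] N_group_mult 1 2 3 ..
  qed
  have "modular_relations ?H m ?\<alpha> ?\<beta>"
    by (intro modular_relations.intro H.is_group modular_relations_axioms.intro \<alpha> \<beta> full \<beta>2 comm)
  then show ?thesis by (simp only: q h)
qed

text \<open>The last hypotheses are what injectivity of \<gamma> contributes: a^(2^m) has nonzero
  value, and b has neither value 0 nor the value of a^(2^m). The rest compares entries: the
  commutation relation gives E1, E2 and E5, the square of b gives E3, E4 and E6.\<close>

lemma relations_determine_form:
  fixes x y w x' y' w' u v :: int
  assumes m: "3 \<le> m"
    and rel: "modular_relations (hol (N_group m)) m (lin m x y w, (0, 1)) (lin m x' y' w', (u, v))"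
    and rng: "x' \<in> {0, 1}" "y' \<in> {0, 1}" "u \<in> {0, 1}" "y \<in> {0, 1}"
    and w: "odd w" and w': "odd w'"
    and half: "snd ((lin m x y w, (0, 1)) [^]\<^bsub>hol (N_group m)\<^esub> (2 ^ m :: nat)) \<noteq> (0, 0)"
    and uv: "(u, v) \<noteq> (0, 0)" "(u, v) \<noteq> (0, 2 ^ m)"
  shows "4 dvd w - 1 \<and> u = 1 \<and> y' = 0 \<and> (x' = 0 \<or> y = 0) \<and>
    2 ^ (m + 1) dvd w' - (1 + 2 ^ m * (1 + x)) \<and> (v = 2 ^ (m - 1) * x' \<or> v = 2 ^ (m - 1) * x' + 2 ^ m)"
proof -
  let ?N = "N_group m" let ?H = "hol (N_group m)"
  let ?\<alpha> = "(lin m x y w, (0, 1::int))" and ?\<beta> = "(lin m x' y' w', (u, v))"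
  interpret modular_relations ?H m ?\<alpha> ?\<beta> by (fact rel)
  define p where "p = (2::int) ^ (m - 3)"
  have q: "(2::int) ^ m = 8 * p" unfolding p_def by (rule eight_dvd_pow[OF m])
  have M: "(2::int) ^ (m + 1) = 16 * p" using q by simp
  have h: "(2::int) ^ (m - 1) = 4 * p"
    using power_Suc[of "2::int" "m - 1"] m q by simp
  have p1: "1 \<le> p" unfolding p_def by simp
  have m1: "1 \<le> m" using m by simp
  have cl: "(u, v) \<in> carrier ?N" using b_closed by simp
  then have v_rng: "0 \<le> v" "v < 16 * p" by (auto simp: N_group_carrier M[simplified])
  have e2: "(0, 1) \<in> carrier ?N" by (intro N_group_memI one_less_power) auto
  have eq: "(0, (1 + 8 * p) mod 2 ^ (m + 1)) \<in> carrier ?N" by (simp add: N_group_carrier)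
  obtain t where t: "1 + w = 2 * t" using w by (elim oddE) (auto intro: that[of "_ + 1"])
  have odd_t: "odd t"
    using half unfolding lin_pair_pow_half[OF m w t] by (auto split: if_splits)
  then obtain s where s: "w = 4 * s + 1" using t by (elim oddE) (auto intro: that)
  have halfq: "?\<alpha> [^]\<^bsub>?H\<^esub> (2 ^ m :: nat) = (\<lambda>p \<in> carrier ?N. p, (0, 8 * p))"
    using lin_pair_pow_half[OF m w t] odd_t q by simp
  have "?\<alpha> [^]\<^bsub>?H\<^esub> (1 + 2 ^ m :: nat) = ?\<alpha> [^]\<^bsub>?H\<^esub> (1::nat) \<otimes>\<^bsub>?H\<^esub> ?\<alpha> [^]\<^bsub>?H\<^esub> (2 ^ m :: nat)"
    by (simp only: nat_pow_mult[OF a_closed])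
  also have "\<dots> = ?\<alpha> \<otimes>\<^bsub>?H\<^esub> (\<lambda>p \<in> carrier ?N. p, (0, 8 * p))"
    unfolding halfq using nat_pow_eone[OF a_closed] by simp
  also have "\<dots> = (lin m x y w, (0, (1 + 8 * p) mod 2 ^ (m + 1)))"
    using e2 unfolding mult_hol
    by (auto simp: compose_def lin_def fun_eq_iff N_group_carrier)
  finally have pow: "?\<alpha> [^]\<^bsub>?H\<^esub> (1 + 2 ^ m :: nat) = (lin m x y w, (0, (1 + 8 * p) mod 2 ^ (m + 1)))" .
  note comm = b_a[unfolded pow mult_hol lin_compose[OF m1 w w'] lin_compose[OF m1 w' w]
      lin_apply[OF cl] lin_apply[OF eq] N_group_mult prod.inject]
  note sq = b_sq[unfolded mult_hol lin_compose[OF m1 w' w'] lin_apply[OF cl] N_group_mult one_hol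
      N_group_one prod.inject]
  have "lin m (x + x') (y + y') (w * w' + 2 ^ m * x * y') (0, 1) =
      lin m (x' + x) (y' + y) (w' * w + 2 ^ m * x' * y) (0, 1)"
    using comm by simp
  then have "2 ^ (m + 1) dvd (w * w' + 2 ^ m * x * y') - (w' * w + 2 ^ m * x' * y)"
    unfolding lin_apply[OF e2] prod.inject mod_eq_dvd_iff by simp
  then have "16 * p dvd 8 * p * (x * y' - x' * y)"
    unfolding M q by (simp add: algebra_simps)
  then have "8 * p * 2 dvd 8 * p * (x * y' - x' * y)" by (simp add: mult_ac)
  then have E5: "even (x * y' - x' * y)" using p1 by (simp only: dvd_mult_cancel_left) simp
  have "((u + y * v) mod 2 + 0) mod 2 = ((0 + y' * ((1 + 8 * p) mod 2 ^ (m + 1))) mod 2 + u) mod 2"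
    using comm by blast
  then have E1: "even (y * v) \<longleftrightarrow> even y'" by (auto simp: mod_two_eq_iff)
  have "((u + y' * v) mod 2 + u) mod 2 = 0" using sq by blast
  then have E3: "even (y' * v)" by (auto simp: mod_eq_0_iff_dvd)
  \<comment> \<open>For odd y', E1 would make v odd, against E3.\<close>
  have "even y'" using E1 E3 by auto
  then have y': "y' = 0" using rng by auto
  have x'y: "x' = 0 \<or> y = 0" using E5 rng y' by auto
  have "lin m (x' + x') (y' + y') (w' * w' + 2 ^ m * x' * y') (0, 1) = (0, 1)"
    using sq e2 by simp
  then have "(w' * w') mod (16 * p) = 1 mod (16 * p)"
    unfolding lin_apply[OF e2] y' M using p1 by simp
  then have E6: "16 * p dvd w' * w' - 1" by (simp add: mod_eq_dvd_iff)
  have "((2 ^ m * x * u + w * v) mod 2 ^ (m + 1) + 1) mod 2 ^ (m + 1) =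
      ((2 ^ m * x' * 0 + w' * ((1 + 8 * p) mod 2 ^ (m + 1))) mod 2 ^ (m + 1) + v) mod 2 ^ (m + 1)"
    using comm by blast
  then have "(8 * p * x * u + w * v + 1) mod (16 * p) = (w' * (1 + 8 * p) + v) mod (16 * p)"
    unfolding M q by (simp only: mod_add_left_eq mod_add_mult mod_mult_add mult_zero_right add_0)
  then have E2: "16 * p dvd 8 * p * x * u + w * v + 1 - (w' * (1 + 8 * p) + v)"
    by (simp only: mod_eq_dvd_iff)
  have "((2 ^ m * x' * u + w' * v) mod 2 ^ (m + 1) + v) mod 2 ^ (m + 1) = 0" using sq by blast
  then have E4: "16 * p dvd 8 * p * x' * u + w' * v + v"
    unfolding M q by (simp only: mod_add_left_eq mod_eq_0_iff_dvd)
  \<comment> \<open>E2 modulo 4, where w is 1 and every multiple of 8 p vanishes. This excludes the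
    square roots of 1 near -1 before E6 is used.\<close>
  have "4 dvd w' - 1"
  proof -
    obtain c where c: "8 * p * x * u + w * v + 1 - (w' * (1 + 8 * p) + v) = 16 * p * c"
      using E2 by (elim dvdE)
    then have "w' - 1 = 4 * (2 * p * x * u + s * v - 2 * p * w' - 4 * p * c)"
      unfolding s by (simp add: algebra_simps)
    then show ?thesis by (rule dvdI)
  qed
  then obtain r where r: "w' = 4 * r + 1" by (metis add.commute diff_add_cancel dvd_def)
  \<comment> \<open>In w'^2 - 1 = 8 r (2 r + 1) the last factor is odd, so E6 falls entirely on r
    and w' is 1 modulo 2^m.\<close>
  have "2 * p dvd r"
  proof -
    have "w' * w' - 1 = 8 * (r * (2 * r + 1))" unfolding r by (simp add: algebra_simps)
    then have "8 * (2 * p) dvd 8 * (r * (2 * r + 1))" using E6 by simp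
    then have "2 * p dvd r * (2 * r + 1)" by (simp only: dvd_mult_cancel_left) simp
    moreover have "coprime (2 * p) (2 * r + 1)" unfolding p_def by simp
    ultimately show ?thesis by (simp only: coprime_dvd_mult_left_iff)
  qed
  then obtain e where e: "r = 2 * p * e" by (elim dvdE)
  have w'e: "w' = 1 + 8 * p * e" unfolding r e by simp
  obtain c where c: "8 * p * x' * u + w' * v + v = 16 * p * c" using E4 by (elim dvdE)
  have "even v"
  proof -
    define k where "k = 4 * p * c - 2 * p * x' * u - 2 * p * e * v"
    have "2 * v = 2 * (2 * k)"
      using c unfolding w'e k_def by (simp add: algebra_simps)
    then have "v = 2 * k" by linarith
    then show ?thesis by (rule dvdI)
  qed
  then obtain v2 where v2: "v = 2 * v2" by (elim evenE)
  have v_eq: "v = 8 * p * (c - e * v2) - 4 * p * (x' * u)"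
    using c unfolding w'e v2 by (simp add: algebra_simps)
  define d where "d = c - e * v2"
  have v_d: "v = 8 * p * d - 4 * p * (x' * u)" using v_eq by (simp add: d_def)
  \<comment> \<open>E4 fixes v modulo 8 p only, which leaves two residues below 16 p.\<close>
  have v_cases: "v = 4 * p * (x' * u) \<or> v = 4 * p * (x' * u) + 8 * p"
  proof -
    have xu: "x' * u = 0 \<or> x' * u = 1" using rng by auto
    define k where "k = 8 * d - 4 * (x' * u)"
    have "p * k = v" unfolding v_d k_def by (simp add: algebra_simps)
    then have "0 \<le> p * k" "p * k < p * 16" using v_rng by simp_all
    then have "0 \<le> 8 * d - 4 * (x' * u)" "8 * d - 4 * (x' * u) < 16"
      using p1 unfolding k_def[symmetric] by (simp_all add: zero_le_mult_iff)
    then have "d = x' * u \<or> d = x' * u + 1" using xu by presburger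
    then show ?thesis unfolding v_d by (auto simp: algebra_simps)
  qed
  have u: "u = 1"
  proof (rule ccontr)
    assume "u \<noteq> 1"
    then have "u = 0" using rng by simp
    then show False using v_cases uv q by auto
  qed
  \<comment> \<open>With v and u known, E2 leaves a condition on the parity of e: it agrees with
    that of 1 + x.\<close>
  have "2 ^ (m + 1) dvd w' - (1 + 2 ^ m * (1 + x))"
  proof -
    obtain g where g: "8 * p * x * u + w * v + 1 - (w' * (1 + 8 * p) + v) = 16 * p * g"
      using E2 by (elim dvdE)
    have "w' - (1 + 2 ^ m * (1 + x)) =
        2 ^ (m + 1) * (s * (2 * d - x') - 4 * p * e - g - 1)"
      using g unfolding M q w'e s v_d u by (simp add: algebra_simps)
    then show ?thesis by (rule dvdI)
  qed
  moreover have "4 dvd w - 1" unfolding s by simp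
  ultimately show ?thesis using u y' x'y v_cases h q by simp
qed

text \<open>Without a cyclic generator the exponent is at most 2^(m+1), so s attains it and <s> has
  index two. In additive terms an element w0 outside satisfies 2 w0 = k s. An odd k would give
  2^(m+1) w0 = 2^m s, which is nonzero; so k = 2 l, and w0 - l s is an involution spanning a
  complement.\<close>

lemma (in comm_group) complement_iso:
  assumes card: "card (carrier G) = 2 ^ (m + 2)" and noncyclic: "\<not> cyclic_group G"
    and s: "s \<in> carrier G" "s [^] (2 ^ m :: nat) \<noteq> \<one>"
  shows "\<exists>\<gamma> \<in> iso G (N_group m). \<gamma> s = (0, 1)"
proof -
  let ?N = "N_group m"
  interpret N: group ?N by (rule N_group_group)
  have fin: "finite (carrier G)" using card by (metis card.infinite power_not_zero zero_neq_numeral)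
  have exponent: "x [^] (2 ^ (m + 1) :: nat) = \<one>" if x: "x \<in> carrier G" for x
  proof -
    have "ord x dvd 2 ^ (m + 2)" using ord_dvd_group_order[OF x] card by (simp add: order_def)
    then obtain i where i: "i \<le> m + 2" "ord x = 2 ^ i"
      using divides_primepow_nat[OF two_is_prime_nat] by blast
    have "i \<noteq> m + 2"
    proof
      assume "i = m + 2"
      then have "card (generate G {x}) = card (carrier G)"
        using generate_pow_card[OF x] i(2) card by simp
      then have "generate G {x} = carrier G"
        using card_subset_eq[OF fin generate_incl] x by simp
      then have "carrier G = range (\<lambda>k::int. x [^] k)" using generate_pow[OF x] by (simp add: full_SetCompr_eq)
      then show False using noncyclic x unfolding cyclic_group by blast
    qed
    then have "ord x dvd 2 ^ (m + 1)" using i le_imp_power_dvd[of i "m + 1" "2::nat"] by simp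
    then show ?thesis using pow_eq_id[OF x] by blast
  qed
  have ord_s: "ord s = 2 ^ (m + 1)"
  proof -
    have "ord s dvd 2 ^ (m + 1)" using exponent[OF s(1)] pow_eq_id[OF s(1)] by blast
    then obtain i where i: "i \<le> m + 1" "ord s = 2 ^ i"
      using divides_primepow_nat[OF two_is_prime_nat] by blast
    have "\<not> i \<le> m"
    proof
      assume "i \<le> m"
      then have "ord s dvd 2 ^ m" using i by (simp add: le_imp_power_dvd)
      then show False using s pow_eq_id[OF s(1)] by blast
    qed
    then have "i = m + 1" using i(1) by simp
    then show ?thesis using i by simp
  qed
  let ?S = "generate G {s}"
  have S: "subgroup ?S G" using generate_is_subgroup s(1) by simp
  have S_eq: "?S = {s [^] k | k::int. True}" using generate_pow[OF s(1)] by auto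
  have card_S: "card ?S = 2 ^ (m + 1)" using generate_pow_card[OF s(1)] ord_s by simp
  have "?S \<noteq> carrier G" using card card_S by auto
  then obtain w0 where w0: "w0 \<in> carrier G" "w0 \<notin> ?S" using subgroup.subset[OF S] by blast
  have "w0 \<otimes> w0 \<in> ?S"
  proof -
    have "w0 \<otimes> w0 \<in> ?S \<or> (w0 \<otimes> w0) \<otimes> inv w0 \<in> ?S"
      using coset_decomposition(2)[OF S subgroup_self subgroup.subset[OF S] fin w0] card card_S w0
      by simp
    moreover have "(w0 \<otimes> w0) \<otimes> inv w0 = w0" using w0 by (simp add: m_assoc)
    ultimately show ?thesis using w0(2) by simp
  qed
  then obtain k :: int where k: "w0 \<otimes> w0 = s [^] k" unfolding S_eq by blast
  have "even k"
  proof (rule ccontr)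
    assume "odd k"
    then obtain l where l: "k = 2 * l + 1" by (elim oddE)
    have "\<one> = w0 [^] (2 ^ (m + 1) :: nat)" using exponent[OF w0(1)] by simp
    also have "\<dots> = (w0 \<otimes> w0) [^] (2 ^ m :: nat)"
      using w0(1) by (simp add: nat_pow_distrib nat_pow_mult mult_2)
    also have "\<dots> = (s [^] (2 ^ m :: nat)) [^] k"
      unfolding k int_pow_int[symmetric] using s(1) by (simp only: int_pow_pow mult.commute)
    also have "\<dots> = (s [^] (2 ^ m :: nat) \<otimes> s [^] (2 ^ m :: nat)) [^] l \<otimes> s [^] (2 ^ m :: nat)"
      unfolding l mult_2 using s(1)
      by (simp only: int_pow_mult int_pow_mult_distrib int_pow_1 nat_pow_closed)
    also have "s [^] (2 ^ m :: nat) \<otimes> s [^] (2 ^ m :: nat) = \<one>"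
      using exponent[OF s(1)] s(1) by (simp add: nat_pow_mult mult_2)
    finally show False using s by simp
  qed
  then obtain l where l: "k = 2 * l" by (elim evenE)
  define w where "w = w0 \<otimes> inv (s [^] l)"
  have w: "w \<in> carrier G" unfolding w_def using w0 s by simp
  have w_notin: "w \<notin> ?S"
  proof
    assume "w \<in> ?S"
    moreover have "s [^] l \<in> ?S" unfolding S_eq by blast
    ultimately have "w \<otimes> s [^] l \<in> ?S" using subgroup.m_closed[OF S] by blast
    moreover have "w \<otimes> s [^] l = w0" unfolding w_def using w0 s by (simp add: m_assoc)
    ultimately show False using w0 by simp
  qed
  have ww: "w \<otimes> w = \<one>"
  proof -
    have "w \<otimes> w = (w0 \<otimes> w0) \<otimes> inv (s [^] l \<otimes> s [^] l)"
      unfolding w_def using w0 s by (simp add: inv_mult m_ac)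
    also have "s [^] l \<otimes> s [^] l = s [^] k" unfolding l mult_2 using s by (simp only: int_pow_mult)
    finally show ?thesis using k s by simp
  qed
  have w_pow: "w [^] (i mod 2 :: int) = w [^] i" for i
  proof -
    have "w [^] i = w [^] (2 * (i div 2) + i mod 2)" by simp
    also have "\<dots> = (w [^] (2::int)) [^] (i div 2) \<otimes> w [^] (i mod 2)"
      using w by (simp only: int_pow_mult int_pow_pow)
    also have "w [^] (2::int) = w [^] (1 + 1 :: int)" by simp
    also have "\<dots> = \<one>" using ww int_pow_mult[OF w, of 1 1] w by simp
    finally show ?thesis using w by simp
  qed
  have s_pow: "s [^] (i mod 2 ^ (m + 1) :: int) = s [^] i" for i
  proof -
    have "s [^] i = s [^] (2 ^ (m + 1) * (i div 2 ^ (m + 1)) + i mod 2 ^ (m + 1))" by simp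
    also have "\<dots> = (s [^] (2 ^ (m + 1) :: int)) [^] (i div 2 ^ (m + 1)) \<otimes> s [^] (i mod 2 ^ (m + 1))"
      using s by (simp only: int_pow_mult int_pow_pow)
    also have "s [^] (2 ^ (m + 1) :: int) = \<one>"
      using exponent[OF s(1)] int_pow_int[of G s "2 ^ (m + 1)"] by simp
    finally show ?thesis using s by simp
  qed
  define \<delta> where "\<delta> = (\<lambda>(i :: int, j :: int). w [^] i \<otimes> s [^] j)"
  have hom: "\<delta> \<in> hom ?N G"
  proof (rule homI)
    fix p p' :: "int \<times> int"
    obtain i j i' j' where ij: "p = (i, j)" "p' = (i', j')" by (cases p; cases p')
    show "\<delta> (p \<otimes>\<^bsub>?N\<^esub> p') = \<delta> p \<otimes> \<delta> p'"
      unfolding ij \<delta>_def using w s by (simp only: N_group_mult prod.case w_pow s_pow)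
        (simp add: int_pow_mult m_ac)
  qed (use w s in \<open>auto simp: \<delta>_def\<close>)
  interpret h: group_hom ?N G \<delta>
    using hom by (simp add: group_hom_def group_hom_axioms_def N_group_group)
  have "p = \<one>\<^bsub>?N\<^esub>" if p: "p \<in> carrier ?N" and one: "\<delta> p = \<one>" for p
  proof -
    obtain i j where ij: "p = (i, j)" by (cases p)
    have rng: "i = 0 \<or> i = 1" "0 \<le> j" "j < 2 ^ (m + 1)" using p ij by (auto simp: N_group_carrier)
    have eq: "w [^] i \<otimes> s [^] j = \<one>" using one ij by (simp add: \<delta>_def)
    have "i = 0"
    proof (rule ccontr)
      assume "i \<noteq> 0"
      then have "w \<otimes> s [^] j = \<one>" using eq rng(1) w by simp
      then have "w = s [^] (- j)" using w s by (simp add: int_pow_neg inv_unique' inv_equality)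
      then show False using w_notin unfolding S_eq by blast
    qed
    then have "s [^] j = \<one>" using eq s by simp
    then have "2 ^ (m + 1) dvd j" using int_pow_eq_id[OF s(1)] ord_s by simp
    then have "j = 0" using rng zdvd_not_zless[of j "2 ^ (m + 1)"] by force
    with \<open>i = 0\<close> ij show ?thesis by (simp add: N_group_one)
  qed
  then have inj: "inj_on \<delta> (carrier ?N)" using h.inj_on_one_iff by blast
  have "\<delta> ` carrier ?N = carrier G"
    using card_image[OF inj] card h.hom_closed
    by (intro card_subset_eq[OF fin]) (auto simp: N_group_card)
  then have "\<delta> \<in> iso ?N G" using hom inj by (simp add: iso_def bij_betw_def)
  then have "inv_into (carrier ?N) \<delta> \<in> iso G ?N" by (rule N.iso_set_sym)
  moreover have "inv_into (carrier ?N) \<delta> s = (0, 1)"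
  proof (rule inv_into_f_eq[OF inj])
    show "(0, 1) \<in> carrier ?N" by (intro N_group_memI one_less_power) auto
    show "\<delta> (0, 1) = s" using s by (simp add: \<delta>_def)
  qed
  ultimately show ?thesis by blast
qed

text \<open>Bijectivity needs only the values at three involutions: a^(2^m) has (0, 2^m), and the
  other two have first coordinate 1.\<close>

lemma forms_realised:
  fixes x y z x' :: int
  assumes m: "3 \<le> m" and gens: "M_generators m G a b"
    and z: "even z" and x': "x' \<in> {0, 1}" and xy: "even (x' * y)"
  shows "\<exists>h \<in> hom G (hol (N_group m)). h a = (lin m x y (1 + 2 * z), (0, 1)) \<and>
    h b = (lin m x' 0 (1 + 2 ^ m * (1 + x)), (1, 2 ^ (m - 1) * x')) \<and>
    snd (h (a [^]\<^bsub>G\<^esub> (2 ^ m :: nat))) = (0, 2 ^ m) \<and>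
    bij_betw (\<lambda>g. snd (h g)) (carrier G) (carrier (N_group m))"
proof -
  let ?N = "N_group m" let ?H = "hol ?N" let ?w = "1 + 2 * z" and ?W = "1 + 2 ^ m * (1 + x)"
  interpret modular_relations G m a b by (rule M_generators_relations[OF gens])
  obtain h where h: "h \<in> hom G ?H" "h a = (lin m x y ?w, (0, 1))"
      "h b = (lin m x' 0 ?W, (1, 2 ^ (m - 1) * x'))"
    using von_Dyck[OF gens forms_satisfy_relations[OF m z x' xy]] by blast
  interpret h: group_hom G ?H h
    using h(1) by (simp add: group_hom_def group_hom_axioms_def N_hol_group)
  have m1: "1 \<le> m" and m2: "2 \<le> m" using m by simp_all
  have q: "h (a [^]\<^bsub>G\<^esub> (2 ^ m :: nat)) = (\<lambda>p \<in> carrier ?N. p, (0, 2 ^ m))"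
    using h.hom_nat_pow[OF a_closed, of "2 ^ m"] lin_pair_pow_half[OF m _ , of ?w "1 + z" x y] z h(2)
    by simp
  have eq: "(0, 2 ^ m) \<in> carrier ?N" by (intro N_group_memI) auto
  have qb: "fst (snd (h (a [^]\<^bsub>G\<^esub> (2 ^ m :: nat) \<otimes>\<^bsub>G\<^esub> b))) = 1"
    using h.hom_mult[of "a [^]\<^bsub>G\<^esub> (2 ^ m :: nat)" b] q h(3) eq by (simp add: lin_apply)
  then have qb': "snd (h (a [^]\<^bsub>G\<^esub> (2 ^ m :: nat) \<otimes>\<^bsub>G\<^esub> b)) \<noteq> (0, 0)" by auto
  have "bij_betw (\<lambda>g. snd (h g)) (carrier G) (carrier ?N)"
    by (rule snd_hom_hol_bij[OF m2 gens N_group_comm h(1)])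
      (use N_group_card q qb' h(3) in \<open>simp_all add: N_group_one\<close>)
  then show ?thesis using h q by auto
qed

text \<open>The involutions are a^(2^m), b and their product. As \<gamma>(b) = (1, 0), all three
  have a multiple of 2^m as second coordinate, so doubling kills them.\<close>

lemma first_form_double:
  assumes m: "3 \<le> m" and A: "brace A" and z: "even z"
    and form: "brace_of_form m A (first_form m x y z)"
    and g: "g \<in> carrier A" and sq: "g \<otimes>\<^bsub>A\<^esub> g = \<one>\<^bsub>A\<^esub>"
  shows "g \<oplus>\<^bsub>A\<^esub> g = \<zero>\<^bsub>A\<^esub>"
proof -
  let ?N = "N_group m" let ?H = "hol ?N" let ?W = "1 + 2 ^ m * (1 + x)" let ?G = "adjoint_group A"
  interpret brace A by fact
  obtain a b \<gamma> where gens: "M_generators m ?G a b" and \<gamma>: "\<gamma> \<in> iso (add_monoid A) ?N"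
    and eqs: "transported_rho m A \<gamma> a = lin m x y (1 + 2 * z)"
      "transported_rho m A \<gamma> b = lin m 0 0 ?W" "\<gamma> a = (0, 1)" "\<gamma> b = (1, 0)"
    using form unfolding brace_of_form_def first_form_lin by auto
  interpret G: modular_relations ?G m a b by (rule M_generators_relations[OF gens])
  define h where "h = (\<lambda>g. (transported_rho m A \<gamma> g, \<gamma> g))"
  have h: "h \<in> hom ?G ?H" unfolding h_def by (rule transported_hom[OF A \<gamma> N_group_comm])
  interpret h: group_hom ?G ?H h
    using h by (simp add: group_hom_def group_hom_axioms_def N_hol_group)
  have ha: "h a = (lin m x y (1 + 2 * z), (0, 1))" "h b = (lin m 0 0 ?W, (1, 0))"
    using eqs by (simp_all add: h_def)
  have m2: "2 \<le> m" using m by simp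
  have q: "h (a [^]\<^bsub>?G\<^esub> (2 ^ m :: nat)) = (\<lambda>p \<in> carrier ?N. p, (0, 2 ^ m))"
    using h.hom_nat_pow[OF G.a_closed, of "2 ^ m"] lin_pair_pow_half[OF m _ , of "1 + 2 * z" "1 + z" x y]
      z ha(1) by simp
  have eq: "(0, 2 ^ m) \<in> carrier ?N" by (intro N_group_memI) auto
  have qb: "snd (h (a [^]\<^bsub>?G\<^esub> (2 ^ m :: nat) \<otimes>\<^bsub>?G\<^esub> b)) = (1, (2 ^ m * ?W) mod 2 ^ (m + 1))"
    using h.hom_mult[of "a [^]\<^bsub>?G\<^esub> (2 ^ m :: nat)" b] q ha(2) eq
    by (simp add: lin_apply mult.commute)
  have triv: "j = 0 \<and> 2 ^ (m + 1) dvd i" if "snd (h (G.normal_form (i, j))) = \<one>\<^bsub>?N\<^esub>" "j < 2" for i j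
    by (rule snd_hom_hol_trivial[OF m2 G.modular_relations_axioms N_group_comm h _ _ _ that])
      (use q qb ha(2) in \<open>simp_all add: N_group_one\<close>)
  have one: "snd (h \<one>\<^bsub>?G\<^esub>) = (0, 0)"
    using snd_hom_hol_one[OF G.is_group N_group_comm h] by (simp add: N_group_one)
  \<comment> \<open>The order of a is recovered from the cocycle: a trivial power has value 0, and
    zeros have exponents divisible by 2^(m+1).\<close>
  have order: "2 ^ (m + 1) dvd i" if "a [^]\<^bsub>?G\<^esub> i = \<one>\<^bsub>?G\<^esub>" for i :: nat
    using triv[of i 0] that one by (simp add: G.normal_form_def N_group_one)
  have g': "g \<in> carrier ?G" "g \<otimes>\<^bsub>?G\<^esub> g = \<one>\<^bsub>?G\<^esub>"
    using g sq by (simp_all add: adjoint_group_def)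
  obtain i j where "g = G.normal_form (i, j)" "j < 2"
    using M_generators_normal_form[OF gens g'(1)] by blast
  from G.involution_cases[OF m2 order this g'(2)]
  have "\<gamma> g \<otimes>\<^bsub>?N\<^esub> \<gamma> g = (0, 0)"
    using one q qb eqs(4) by (auto simp: h_def)
  moreover have "\<gamma> (g \<oplus>\<^bsub>A\<^esub> g) = \<gamma> g \<otimes>\<^bsub>?N\<^esub> \<gamma> g"
    using \<gamma> g by (auto simp: iso_def hom_def)
  moreover have "\<gamma> \<zero>\<^bsub>A\<^esub> = (0, 0)"
    using hom_one[of \<gamma> "add_monoid A" ?N] \<gamma> N_group_group add.is_group
    by (simp add: iso_def N_group_one)
  moreover have "inj_on \<gamma> (carrier A)" using \<gamma> by (auto simp: iso_def bij_betw_def)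
  ultimately show ?thesis using g inj_onD[of \<gamma> "carrier A" "g \<oplus>\<^bsub>A\<^esub> g" "\<zero>\<^bsub>A\<^esub>"] by simp
qed

text \<open>The witness is b: twice (1, 2^(m-1)) is (0, 2^m).\<close>

lemma second_form_double:
  assumes m: "3 \<le> m" and B: "brace B" and form: "brace_of_form m B (second_form m x z)"
  shows "\<exists>g \<in> carrier B. g \<otimes>\<^bsub>B\<^esub> g = \<one>\<^bsub>B\<^esub> \<and> g \<oplus>\<^bsub>B\<^esub> g \<noteq> \<zero>\<^bsub>B\<^esub>"
proof -
  interpret brace B by fact
  obtain a b \<gamma> where gens: "M_generators m (adjoint_group B) a b"
    and \<gamma>: "\<gamma> \<in> iso (add_monoid B) (N_group m)" and b: "\<gamma> b = (1, 2 ^ (m - 1))"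
    using form unfolding brace_of_form_def second_form_lin by auto
  interpret G: modular_relations "adjoint_group B" m a b by (rule M_generators_relations[OF gens])
  have bB: "b \<in> carrier B" "b \<otimes>\<^bsub>B\<^esub> b = \<one>\<^bsub>B\<^esub>"
    using G.b_closed G.b_sq by (simp_all add: adjoint_group_def)
  have "2 ^ (m - 1) + 2 ^ (m - 1) = (2::int) ^ m"
    using m power_Suc[of "2::int" "m - 1"] by simp
  then have "\<gamma> (b \<oplus>\<^bsub>B\<^esub> b) = (0, 2 ^ m)"
    using \<gamma> bB b by (auto simp: iso_def hom_def)
  moreover have "\<gamma> \<zero>\<^bsub>B\<^esub> = (0, 0)"
    using hom_one[of \<gamma> "add_monoid B" "N_group m"] \<gamma> N_group_group add.is_group
    by (simp add: iso_def N_group_one)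
  ultimately have "b \<oplus>\<^bsub>B\<^esub> b \<noteq> \<zero>\<^bsub>B\<^esub>" by auto
  with bB show ?thesis by blast
qed

lemma forms_not_isomorphic:
  assumes m: "3 \<le> m" and A: "brace A" and B: "brace B" and z: "even z"
    and formA: "brace_of_form m A (first_form m x y z)"
    and formB: "brace_of_form m B (second_form m x' z')"
  shows "\<not> brace_isomorphic A B"
proof
  assume "brace_isomorphic A B"
  then obtain f where add: "f \<in> iso (add_monoid A) (add_monoid B)"
    and mult: "f \<in> iso (adjoint_group A) (adjoint_group B)"
    unfolding brace_isomorphic_def by blast
  interpret A: brace A by fact
  interpret B: brace B by fact
  obtain g' where g': "g' \<in> carrier B" "g' \<otimes>\<^bsub>B\<^esub> g' = \<one>\<^bsub>B\<^esub>" "g' \<oplus>\<^bsub>B\<^esub> g' \<noteq> \<zero>\<^bsub>B\<^esub>"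
    using second_form_double[OF m B formB] by blast
  have bij: "bij_betw f (carrier A) (carrier B)" using add by (simp add: iso_def)
  then obtain g where g: "g \<in> carrier A" "f g = g'" using g'(1) by (metis bij_betw_imp_surj_on imageE)
  have "f \<one>\<^bsub>A\<^esub> = \<one>\<^bsub>B\<^esub>"
    using hom_one[of f "adjoint_group A" "adjoint_group B"] mult A.adjoint_group B.adjoint_group
    by (simp add: iso_def adjoint_group_def)
  moreover have "f (g \<otimes>\<^bsub>A\<^esub> g) = g' \<otimes>\<^bsub>B\<^esub> g'"
    using mult g by (auto simp: iso_def hom_def adjoint_group_def)
  ultimately have "g \<otimes>\<^bsub>A\<^esub> g = \<one>\<^bsub>A\<^esub>"
    using inj_onD[OF bij_betw_imp_inj_on[OF bij], of "g \<otimes>\<^bsub>A\<^esub> g" "\<one>\<^bsub>A\<^esub>"] g g'(2) by simp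
  then have "g \<oplus>\<^bsub>A\<^esub> g = \<zero>\<^bsub>A\<^esub>" by (rule first_form_double[OF m A z formA g(1)])
  moreover have "f \<zero>\<^bsub>A\<^esub> = \<zero>\<^bsub>B\<^esub>"
    using hom_one[of f "add_monoid A" "add_monoid B"] add A.add.is_group B.add.is_group
    by (simp add: iso_def)
  moreover have "f (g \<oplus>\<^bsub>A\<^esub> g) = g' \<oplus>\<^bsub>B\<^esub> g'"
    using add g by (auto simp: iso_def hom_def)
  ultimately show False using g'(3) by simp
qed

lemma additive_order_generator:
  assumes m: "3 \<le> m" and A: "brace A" and card: "card (carrier A) = 2 ^ (m + 2)"
    and noncyclic: "\<not> cyclic_group (add_monoid A)"
    and rel: "modular_relations (adjoint_group A) m a b"
    and ne: "a [^]\<^bsub>adjoint_group A\<^esub> (2 ^ m :: nat) \<noteq> \<one>\<^bsub>A\<^esub>"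
  shows "a [^]\<^bsub>add_monoid A\<^esub> (2 ^ m :: nat) \<noteq> \<zero>\<^bsub>A\<^esub>"
proof -
  interpret brace A by fact
  let ?G = "adjoint_group A"
  interpret G: modular_relations ?G m a b by fact
  define c where "c k = a [^]\<^bsub>?G\<^esub> (2 ^ k :: nat)" for k
  have c_closed: "c k \<in> carrier A" for k
    using G.nat_pow_closed[OF G.a_closed, of "2 ^ k"] unfolding c_def by (simp add: adjoint_group_def)
  have c_Suc: "c (Suc k) = c k \<otimes>\<^bsub>A\<^esub> c k" for k
  proof -
    have "c (Suc k) = a [^]\<^bsub>?G\<^esub> (2 ^ k + 2 ^ k :: nat)" unfolding c_def by (simp add: mult_2)
    also have "\<dots> = c k \<otimes>\<^bsub>?G\<^esub> c k" unfolding c_def by (simp only: G.nat_pow_mult G.a_closed)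
    finally show ?thesis by (simp add: adjoint_group_def)
  qed
  have c_n: "c (m + 1) = \<one>\<^bsub>A\<^esub>" unfolding c_def G.a_pow by (simp add: adjoint_group_def)
  have zero: "\<one>\<^bsub>A\<^esub> = \<zero>\<^bsub>A\<^esub>"
    using rho_mult[of "\<one>\<^bsub>A\<^esub>" "\<one>\<^bsub>A\<^esub>"] rho_one[of "\<one>\<^bsub>A\<^esub>"] G.l_one[OF G.one_closed]
    by (simp add: adjoint_group_def)
  have comm: "comm_group (add_monoid A)" by (rule a_comm_group)
  interpret aff: iterated_affine "add_monoid A" "\<lambda>k. rho (c k)" c "m + 1"
  proof (intro iterated_affine.intro comm iterated_affine_axioms.intro)
    show "rho (c k) \<in> hom (add_monoid A) (add_monoid A)" for k
      using rho_auto[OF c_closed] by (simp add: auto_def)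
    show "rho (c (Suc k)) x = rho (c k) (rho (c k) x)" if "x \<in> carrier (add_monoid A)" for x k
      using that rho_compose[OF c_closed c_closed] c_Suc by simp
    show "rho (c (m + 1)) x = x" if "x \<in> carrier (add_monoid A)" for x
      using that rho_one unfolding c_n by simp
    show "c (Suc k) = c k \<otimes>\<^bsub>add_monoid A\<^esub> rho (c k) (c k)" for k
      using rho_mult[OF c_closed c_closed, of k k] c_closed c_Suc by (simp add: a_comm)
  qed (use m card c_closed in simp_all)
  have "c 0 [^]\<^bsub>add_monoid A\<^esub> (2 ^ (m + 1 - 1) :: nat) \<noteq> \<one>\<^bsub>add_monoid A\<^esub>"
    by (rule aff.additive_order) (use noncyclic ne zero in \<open>simp_all add: c_def\<close>)
  then show ?thesis by (simp add: c_def)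
qed

text \<open>Collapse of the presentation is ruled out by a model: the cocycle of the first form with
  all parameters 0 maps bijectively onto N and separates the elements in question.\<close>

lemma generators_invariants:
  assumes m: "3 \<le> m" and gens: "M_generators m G a b"
  shows "card (carrier G) = 2 ^ (m + 2)" and "a [^]\<^bsub>G\<^esub> (2 ^ m :: nat) \<noteq> \<one>\<^bsub>G\<^esub>"
    and "b \<noteq> \<one>\<^bsub>G\<^esub>" and "b \<noteq> a [^]\<^bsub>G\<^esub> (2 ^ m :: nat)"
proof -
  interpret modular_relations G m a b by (rule M_generators_relations[OF gens])
  obtain h where h: "h \<in> hom G (hol (N_group m))" "snd (h b) = (1, 0)"
    "snd (h (a [^]\<^bsub>G\<^esub> (2 ^ m :: nat))) = (0, 2 ^ m)"
    "bij_betw (\<lambda>g. snd (h g)) (carrier G) (carrier (N_group m))"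
    using forms_realised[OF m gens, of 0 0 0 0] by auto
  show "card (carrier G) = 2 ^ (m + 2)" using bij_betw_same_card[OF h(4)] N_group_card by simp
  have one: "snd (h \<one>\<^bsub>G\<^esub>) = (0, 0)"
    using snd_hom_hol_one[OF is_group N_group_comm h(1)] by (simp add: N_group_one)
  show "a [^]\<^bsub>G\<^esub> (2 ^ m :: nat) \<noteq> \<one>\<^bsub>G\<^esub>" "b \<noteq> \<one>\<^bsub>G\<^esub>" "b \<noteq> a [^]\<^bsub>G\<^esub> (2 ^ m :: nat)"
    using one h by auto
qed

text \<open>Fixing \<gamma>(a) = (0, 1) does not fix \<gamma>: the automorphism that adds 2^m times
  the first coordinate to the second preserves (0, 1). The two alternatives for v reflect this
  freedom.\<close>

lemma form_of_iso:
  assumes m: "3 \<le> m" and A: "brace A" and gens: "M_generators m (adjoint_group A) a b"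
    and \<gamma>: "\<gamma> \<in> iso (add_monoid A) (N_group m)" and \<gamma>a: "\<gamma> a = (0, 1)"
  shows "\<exists>x y z x' v. (x, y, z) \<in> parameters m \<and> x' \<in> {0, 1} \<and> (x' = 0 \<or> y = 0) \<and>
    transported_rho m A \<gamma> a = lin m x y (1 + 2 * z) \<and>
    transported_rho m A \<gamma> b = lin m x' 0 (1 + 2 ^ m * (1 + x)) \<and>
    \<gamma> b = (1, v) \<and> (v = 2 ^ (m - 1) * x' \<or> v = 2 ^ (m - 1) * x' + 2 ^ m)"
proof -
  let ?N = "N_group m" let ?H = "hol ?N" let ?G = "adjoint_group A"
  interpret brace A by fact
  interpret G: modular_relations ?G m a b by (rule M_generators_relations[OF gens])
  have m1: "1 \<le> m" using m by simp
  define h where "h = (\<lambda>g. (transported_rho m A \<gamma> g, \<gamma> g))"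
  have h: "h \<in> hom ?G ?H" unfolding h_def by (rule transported_hom[OF A \<gamma> N_group_comm])
  interpret h: group_hom ?G ?H h
    using h by (simp add: group_hom_def group_hom_axioms_def N_hol_group)
  have ha: "h a \<in> carrier ?H" "h b \<in> carrier ?H" by (auto intro: h.hom_closed simp del: carrier_hol)
  then have auto: "transported_rho m A \<gamma> a \<in> auto ?N" "transported_rho m A \<gamma> b \<in> auto ?N"
    by (simp_all add: h_def)
  obtain x y w where S: "x \<in> {0, 1}" "y \<in> {0, 1}" "w \<in> {0..<2 ^ (m + 1)}" "odd w"
    "transported_rho m A \<gamma> a = lin m x y w" using auto_lin[OF m1 auto(1)] by blast
  obtain x' y' w' where T: "x' \<in> {0, 1}" "y' \<in> {0, 1}" "odd w'"
    "transported_rho m A \<gamma> b = lin m x' y' w'" using auto_lin[OF m1 auto(2)] by blast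
  obtain u v where uv: "\<gamma> b = (u, v)" by (cases "\<gamma> b")
  have h_eqs: "h a = (lin m x y w, (0, 1))" "h b = (lin m x' y' w', (u, v))"
    using S T uv \<gamma>a by (simp_all add: h_def)
  have "modular_relations ?H m (h a) (h b)"
  proof (intro modular_relations.intro N_hol_group modular_relations_axioms.intro ha)
    show "h a [^]\<^bsub>?H\<^esub> (2 ^ (m + 1) :: nat) = \<one>\<^bsub>?H\<^esub>"
      using h.hom_nat_pow[OF G.a_closed, of "2 ^ (m + 1)"] G.a_pow h.hom_one by simp
    show "h b \<otimes>\<^bsub>?H\<^esub> h b = \<one>\<^bsub>?H\<^esub>"
      using h.hom_mult[OF G.b_closed G.b_closed] G.b_sq h.hom_one by simp
    show "h b \<otimes>\<^bsub>?H\<^esub> h a = h a [^]\<^bsub>?H\<^esub> (1 + 2 ^ m :: nat) \<otimes>\<^bsub>?H\<^esub> h b"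
      using h.hom_mult[OF G.b_closed G.a_closed] h.hom_nat_pow[OF G.a_closed, of "1 + 2 ^ m"]
        h.hom_mult[OF G.nat_pow_closed[OF G.a_closed] G.b_closed, of "1 + 2 ^ m"] G.b_a by metis
  qed
  then have rel: "modular_relations ?H m (lin m x y w, (0, 1)) (lin m x' y' w', (u, v))"
    by (simp only: h_eqs)
  have inj: "inj_on \<gamma> (carrier A)" using \<gamma> by (auto simp: iso_def bij_betw_def)
  have one: "\<gamma> \<one>\<^bsub>?G\<^esub> = (0, 0)"
    using snd_hom_hol_one[OF G.is_group N_group_comm h] by (simp add: N_group_one h_def)
  have carr: "carrier ?G = carrier A" by (simp add: adjoint_group_def)
  note inv = generators_invariants(2-4)[OF m gens]
  have cl: "\<one>\<^bsub>?G\<^esub> \<in> carrier A" "b \<in> carrier A" "a [^]\<^bsub>?G\<^esub> (2 ^ m :: nat) \<in> carrier A"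
    using G.b_closed G.one_closed G.nat_pow_closed[OF G.a_closed] by (simp_all only: carr)
  have half: "snd ((lin m x y w, (0, 1)) [^]\<^bsub>?H\<^esub> (2 ^ m :: nat)) = \<gamma> (a [^]\<^bsub>?G\<^esub> (2 ^ m :: nat))"
  proof -
    have "snd (h (a [^]\<^bsub>?G\<^esub> (2 ^ m :: nat))) = \<gamma> (a [^]\<^bsub>?G\<^esub> (2 ^ m :: nat))" by (simp add: h_def)
    then show ?thesis using h.hom_nat_pow[OF G.a_closed, of "2 ^ m"] h_eqs(1) by metis
  qed
  have half_ne: "snd ((lin m x y w, (0, 1)) [^]\<^bsub>?H\<^esub> (2 ^ m :: nat)) \<noteq> (0, 0)"
    unfolding half using inj_onD[OF inj _ cl(3,1)] inv(1) one by auto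
  obtain t where t: "1 + w = 2 * t" using S(4) by (elim oddE) (auto intro: that[of "_ + 1"])
  have half_eq: "\<gamma> (a [^]\<^bsub>?G\<^esub> (2 ^ m :: nat)) = (0, 2 ^ m)"
    using half half_ne lin_pair_pow_half[OF m S(4) t, of x y] by (auto split: if_splits)
  have uv_ne: "(u, v) \<noteq> (0, 0)" "(u, v) \<noteq> (0, 2 ^ m)"
    using inj_onD[OF inj _ cl(2,1)] inj_onD[OF inj _ cl(2,3)] inv(2,3) uv one half_eq by auto
  have "(u, v) \<in> carrier ?N" using ha(2) h_eqs(2) by simp
  then have u01: "u \<in> {0, 1}" by (auto simp: N_group_carrier)
  have concl: "4 dvd w - 1" "u = 1" "y' = 0" "x' = 0 \<or> y = 0"
      "2 ^ (m + 1) dvd w' - (1 + 2 ^ m * (1 + x))"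
      "v = 2 ^ (m - 1) * x' \<or> v = 2 ^ (m - 1) * x' + 2 ^ m"
    using relations_determine_form[OF m rel T(1,2) u01 S(2,4) T(3) half_ne uv_ne] by auto
  obtain k where k: "w - 1 = 4 * k" using concl(1) by (elim dvdE)
  define z where "z = 2 * k"
  have w: "w = 1 + 2 * z" using k by (simp add: z_def)
  have "0 \<le> z" "z < 2 ^ m" using S(3) unfolding w by auto
  then have "(x, y, z) \<in> parameters m"
    using S(1,2) by (auto simp: parameters_def carrier_integer_mod_group z_def)
  moreover have "lin m x' y' w' = lin m x' 0 (1 + 2 ^ m * (1 + x))"
    by (rule lin_cong) (use concl in simp_all)
  ultimately show ?thesis using S T w uv concl by (intro exI[of _ x] exI[of _ y] exI[of _ z] exI[of _ x'] exI[of _ v]) simp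
qed

lemma brace_has_form:
  assumes m: "3 \<le> m" and A: "modular_maximal_cyclic_brace m A"
    and noncyclic: "\<not> cyclic_group (add_monoid A)"
  shows "\<exists>(x, y, z) \<in> parameters m.
    brace_of_form m A (first_form m x y z) \<or> brace_of_form m A (second_form m x z)"
proof -
  let ?N = "N_group m" let ?G = "adjoint_group A" let ?w = "word_class (M_relations m)"
  have br: "brace A" using A by (simp add: modular_maximal_cyclic_brace_def)
  interpret brace A by fact
  obtain \<psi> where "\<psi> \<in> iso ?G (M_group m)"
    using A by (auto simp: modular_maximal_cyclic_brace_def is_iso_def)
  then have "inv_into (carrier ?G) \<psi> \<in> iso (M_group m) ?G"
    by (rule group.iso_set_sym[OF adjoint_group])
  then obtain a b where gens: "M_generators m ?G a b"
    unfolding M_generators_def using adjoint_group by blast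
  interpret G: modular_relations ?G m a b by (rule M_generators_relations[OF gens])
  have carr: "carrier ?G = carrier A" and one: "\<one>\<^bsub>?G\<^esub> = \<one>\<^bsub>A\<^esub>" by (simp_all add: adjoint_group_def)
  note inv = generators_invariants[OF m gens, unfolded carr one]
  have "a [^]\<^bsub>add_monoid A\<^esub> (2 ^ m :: nat) \<noteq> \<one>\<^bsub>add_monoid A\<^esub>"
    using additive_order_generator[OF m br inv(1) noncyclic G.modular_relations_axioms inv(2)] by simp
  then obtain \<gamma> where \<gamma>: "\<gamma> \<in> iso (add_monoid A) ?N" "\<gamma> a = (0, 1)"
    using comm_group.complement_iso[OF a_comm_group, of m a] inv(1) noncyclic G.a_closed carr by auto
  have "\<exists>\<gamma> x y z x'. \<gamma> \<in> iso (add_monoid A) ?N \<and> \<gamma> a = (0, 1) \<and> (x, y, z) \<in> parameters m \<and>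
      x' \<in> {0, 1} \<and> (x' = 0 \<or> y = 0) \<and>
      transported_rho m A \<gamma> a = lin m x y (1 + 2 * z) \<and>
      transported_rho m A \<gamma> b = lin m x' 0 (1 + 2 ^ m * (1 + x)) \<and> \<gamma> b = (1, 2 ^ (m - 1) * x')"
  proof -
    obtain x y z x' v where *: "(x, y, z) \<in> parameters m" "x' \<in> {0, 1}" "x' = 0 \<or> y = 0"
      "transported_rho m A \<gamma> a = lin m x y (1 + 2 * z)"
      "transported_rho m A \<gamma> b = lin m x' 0 (1 + 2 ^ m * (1 + x))"
      "\<gamma> b = (1, v)" "v = 2 ^ (m - 1) * x' \<or> v = 2 ^ (m - 1) * x' + 2 ^ m"
      using form_of_iso[OF m br gens \<gamma>] by blast
    show ?thesis
    proof (cases "v = 2 ^ (m - 1) * x'")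
      case True
      with * \<gamma> show ?thesis
        by (intro exI[of _ \<gamma>] exI[of _ x] exI[of _ y] exI[of _ z] exI[of _ x'] conjI) simp_all
    next
      case False
      then have v: "v = 2 ^ (m - 1) * x' + 2 ^ m" using * by blast
      \<comment> \<open>This automorphism is (i, j) -> (i, j + 2^m i); it keeps the value at a and
        moves the value at b by (0, 2^m), cancelling the surplus.\<close>
      define \<gamma>' where "\<gamma>' = lin m 1 0 1 \<circ> \<gamma>"
      have "lin m 1 0 1 \<in> iso ?N ?N"
        using lin_auto[of m 1 1 0] m by (simp add: auto_def Bij_def iso_def)
      then have \<gamma>': "\<gamma>' \<in> iso (add_monoid A) ?N"
        unfolding \<gamma>'_def using iso_set_trans[OF \<gamma>(1)] by blast
      have e2: "(0, 1) \<in> carrier ?N" by (intro N_group_memI one_less_power) auto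
      have \<gamma>'a: "\<gamma>' a = (0, 1)" using \<gamma>(2) lin_apply[OF e2, of 1 0 1] e2
        by (simp add: \<gamma>'_def N_group_carrier)
      have half_lt: "2 ^ (m - 1) * x' < 2 ^ m" "0 \<le> 2 ^ (m - 1) * x'"
        using *(2) m power_strict_increasing[of "m - 1" m "2::int"] by auto
      have eb: "(1, v) \<in> carrier ?N" using half_lt v by (intro N_group_memI) auto
      have "\<gamma>' b = (1, (2 ^ m + v) mod 2 ^ (m + 1))"
        using *(6) lin_apply[OF eb, of 1 0 1] by (simp add: \<gamma>'_def)
      moreover have "2 ^ m + v = 2 ^ (m - 1) * x' + 1 * 2 ^ (m + 1)" using v by simp
      then have "(2 ^ m + v) mod 2 ^ (m + 1) = (2 ^ (m - 1) * x') mod 2 ^ (m + 1)" by (rule mod_eqI)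
      moreover have "\<dots> = 2 ^ (m - 1) * x'" using half_lt by (intro mod_pos_pos_trivial) auto
      ultimately have \<gamma>'b: "\<gamma>' b = (1, 2 ^ (m - 1) * x')" by simp
      \<comment> \<open>Applying \<open>form_of_iso\<close> afresh spares the conjugation of the
        matrices; the parameters may differ from the earlier ones.\<close>
      obtain x y z x'' v' where **: "(x, y, z) \<in> parameters m" "x'' \<in> {0, 1}" "x'' = 0 \<or> y = 0"
        "transported_rho m A \<gamma>' a = lin m x y (1 + 2 * z)"
        "transported_rho m A \<gamma>' b = lin m x'' 0 (1 + 2 ^ m * (1 + x))"
        "\<gamma>' b = (1, v')" "v' = 2 ^ (m - 1) * x'' \<or> v' = 2 ^ (m - 1) * x'' + 2 ^ m"
        using form_of_iso[OF m br gens \<gamma>' \<gamma>'a] by blast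
      \<comment> \<open>Decided by size: the second coordinate at b is now below 2^m, the rejected
        alternative is at least 2^m.\<close>
      have "v' \<noteq> 2 ^ (m - 1) * x'' + 2 ^ m" using **(2,6) \<gamma>'b half_lt by auto
      with ** \<gamma>' \<gamma>'a show ?thesis
        by (intro exI[of _ \<gamma>'] exI[of _ x] exI[of _ y] exI[of _ z] exI[of _ x''] conjI) simp_all
    qed
  qed
  then obtain \<gamma> x y z x' where *: "\<gamma> \<in> iso (add_monoid A) ?N" "\<gamma> a = (0, 1)"
      "(x, y, z) \<in> parameters m" "x' \<in> {0, 1}" "x' = 0 \<or> y = 0"
      "transported_rho m A \<gamma> a = lin m x y (1 + 2 * z)"
      "transported_rho m A \<gamma> b = lin m x' 0 (1 + 2 ^ m * (1 + x))" "\<gamma> b = (1, 2 ^ (m - 1) * x')"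
    by blast
  have "(\<lambda>g. (transported_rho m A \<gamma> g, \<gamma> g)) \<in> hom ?G (hol ?N)"
    by (rule transported_hom[OF br *(1) N_group_comm])
  from hom_in_carrier[OF this G.a_closed] hom_in_carrier[OF this G.b_closed]
  have auto: "transported_rho m A \<gamma> a \<in> auto ?N" "transported_rho m A \<gamma> b \<in> auto ?N" by simp_all
  have "brace_of_form m A (first_form m x y z) \<or> brace_of_form m A (second_form m x z)"
  proof (cases "x' = 0")
    case True
    then have "brace_of_form m A (first_form m x y z)"
      unfolding brace_of_form_def first_form_lin
      using gens * auto by (intro exI[of _ a] exI[of _ b] exI[of _ \<gamma>]) simp
    then show ?thesis ..
  next
    case False
    then have "x' = 1" "y = 0" using * by auto
    then have "brace_of_form m A (second_form m x z)"
      unfolding brace_of_form_def second_form_lin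
      using gens * auto by (intro exI[of _ a] exI[of _ b] exI[of _ \<gamma>]) simp
    then show ?thesis ..
  qed
  with *(3) show ?thesis by blast
qed

lemma form_realised_by_cocycle:
  fixes G :: "'g monoid"
  assumes m: "3 \<le> m" and gens: "M_generators m G a b" and par: "(x, y, z) \<in> parameters m"
    and D: "D \<in> {first_form m x y z, second_form m x z}"
  shows "\<exists>\<rho> \<gamma>. right_linear_action G (N_group m) \<rho> \<and> right_cocycle G (N_group m) \<rho> \<gamma> \<and>
    bij_betw \<gamma> (carrier G) (carrier (N_group m)) \<and> (\<rho> a, \<rho> b, \<gamma> a, \<gamma> b) = D \<and>
    brace (cocycle_brace G (N_group m) \<gamma>) \<and>
    adjoint_group (cocycle_brace G (N_group m) \<gamma>) = G"
proof -
  have z: "even z" using par by (simp add: parameters_def)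
  have grp: "group G" using gens by (simp add: M_generators_def)
  \<comment> \<open>Both forms become one family: y' is y for the first form and 0 for the second,
    where the given y does not occur in D.\<close>
  have "\<exists>x' y'. x' \<in> {0, 1} \<and> even (x' * y') \<and>
      D = (lin m x y' (1 + 2 * z), lin m x' 0 (1 + 2 ^ m * (1 + x)), (0, 1), (1, 2 ^ (m - 1) * x'))"
    using D
  proof (elim insertE emptyE)
    assume "D = first_form m x y z"
    then show ?thesis unfolding first_form_lin by (intro exI[of _ 0] exI[of _ y]) simp
  next
    assume "D = second_form m x z"
    then show ?thesis unfolding second_form_lin by (intro exI[of _ 1] exI[of _ 0]) simp
  qed
  then obtain x' y' where xy: "x' \<in> {0, 1}" "even (x' * y')"
    and D: "D = (lin m x y' (1 + 2 * z), lin m x' 0 (1 + 2 ^ m * (1 + x)), (0, 1), (1, 2 ^ (m - 1) * x'))"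
    by blast
  obtain h where h: "h \<in> hom G (hol (N_group m))" "h a = (lin m x y' (1 + 2 * z), (0, 1))"
    "h b = (lin m x' 0 (1 + 2 ^ m * (1 + x)), (1, 2 ^ (m - 1) * x'))"
    "bij_betw (\<lambda>g. snd (h g)) (carrier G) (carrier (N_group m))"
    using forms_realised[OF m gens z xy, of x] by blast
  note act = hom_hol_action[OF grp N_group_comm h(1)]
  show ?thesis
    by (intro exI[of _ "\<lambda>g. fst (h g)"] exI[of _ "\<lambda>g. snd (h g)"] conjI act h(4)
        cocycle_brace_brace[OF act h(4)] adjoint_group_cocycle_brace) (simp add: h(2,3) D)
qed

theorem theorem6p6:
  fixes m :: nat
  assumes "m \<ge> 3"
  shows
    "(\<forall>A :: 'a ring.
        modular_maximal_cyclic_brace m A \<and> \<not> cyclic_group (add_monoid A) \<longrightarrow>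
        (\<exists>(x, y, z) \<in> parameters m.
           brace_of_form m A (first_form m x y z) \<or> brace_of_form m A (second_form m x z)))
     \<and>
     (\<forall>(G :: 'g monoid) a b. M_generators m G a b \<longrightarrow>
        (\<forall>(x, y, z) \<in> parameters m. \<forall>D \<in> {first_form m x y z, second_form m x z}.
           \<exists>\<rho> \<gamma>. right_linear_action G (N_group m) \<rho> \<and>
             right_cocycle G (N_group m) \<rho> \<gamma> \<and>
             bij_betw \<gamma> (carrier G) (carrier (N_group m)) \<and>
             (\<rho> a, \<rho> b, \<gamma> a, \<gamma> b) = D \<and>
             brace (cocycle_brace G (N_group m) \<gamma>) \<and>
             adjoint_group (cocycle_brace G (N_group m) \<gamma>) = G))
     \<and>
     (\<forall>(A :: 'b ring) (B :: 'c ring).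
        \<forall>(x, y, z) \<in> parameters m. \<forall>(x', y', z') \<in> parameters m.
          brace A \<and> brace_of_form m A (first_form m x y z) \<and>
          brace B \<and> brace_of_form m B (second_form m x' z') \<longrightarrow>
          \<not> brace_isomorphic A B)"
proof (intro conjI allI impI)
  fix A :: "'a ring"
  assume "modular_maximal_cyclic_brace m A \<and> \<not> cyclic_group (add_monoid A)"
  then show "\<exists>(x, y, z) \<in> parameters m.
      brace_of_form m A (first_form m x y z) \<or> brace_of_form m A (second_form m x z)"
    using brace_has_form[OF assms] by blast
next
  fix G :: "'g monoid" and a b
  assume "M_generators m G a b"
  note realised = form_realised_by_cocycle[OF assms this]
  show "\<forall>(x, y, z) \<in> parameters m. \<forall>D \<in> {first_form m x y z, second_form m x z}.
      \<exists>\<rho> \<gamma>. right_linear_action G (N_group m) \<rho> \<and>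
        right_cocycle G (N_group m) \<rho> \<gamma> \<and>
        bij_betw \<gamma> (carrier G) (carrier (N_group m)) \<and>
        (\<rho> a, \<rho> b, \<gamma> a, \<gamma> b) = D \<and>
        brace (cocycle_brace G (N_group m) \<gamma>) \<and>
        adjoint_group (cocycle_brace G (N_group m) \<gamma>) = G"
  proof (intro ballI, unfold split_paired_all prod.case, intro ballI)
    fix x y z D
    assume "(x, y, z) \<in> parameters m" "D \<in> {first_form m x y z, second_form m x z}"
    then show "\<exists>\<rho> \<gamma>. right_linear_action G (N_group m) \<rho> \<and>
        right_cocycle G (N_group m) \<rho> \<gamma> \<and>
        bij_betw \<gamma> (carrier G) (carrier (N_group m)) \<and>
        (\<rho> a, \<rho> b, \<gamma> a, \<gamma> b) = D \<and>
        brace (cocycle_brace G (N_group m) \<gamma>) \<and>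
        adjoint_group (cocycle_brace G (N_group m) \<gamma>) = G"
      by (rule realised)
  qed
next
  fix A :: "'b ring" and B :: "'c ring"
  show "\<forall>(x, y, z) \<in> parameters m. \<forall>(x', y', z') \<in> parameters m.
      brace A \<and> brace_of_form m A (first_form m x y z) \<and>
      brace B \<and> brace_of_form m B (second_form m x' z') \<longrightarrow>
      \<not> brace_isomorphic A B"
  proof (intro ballI, unfold split_paired_all prod.case, intro ballI,
      unfold split_paired_all prod.case, intro impI)
    fix x y z x' y' z'
    assume "(x, y, z) \<in> parameters m"
    then have z: "even z" by (simp add: parameters_def)
    assume "brace A \<and> brace_of_form m A (first_form m x y z) \<and>
      brace B \<and> brace_of_form m B (second_form m x' z')"
    then show "\<not> brace_isomorphic A B" using forms_not_isomorphic[OF assms _ _ z] by blast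
  qed
qed

end
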